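(* Let $R$ be a commutative ring, $M$ a finitely generated flat $R$-module, and $X\subseteq\operatorname{Spec}(R)$ a subset. Put $S:=\prod_{\mathfrak{p}\in X}\kappa(\mathfrak{p})$ and $S':=\prod_{\mathfrak{p}\in X_{s}}\kappa(\mathfrak{p})$, where $X_s$ is the specialization cone of $X$. Then $M\otimes_{R}S$ is a projective $S$-module if and only if $M\otimes_{R}S'$ is a projective $S'$-module.
   Context: All rings are commutative (with identity). For a prime ideal $\mathfrak{p}$ of $R$, $\kappa(\mathfrak{p})=R_{\mathfrak p}/\mathfrak{p}R_{\mathfrak p}$ denotes the residue field of $R$ at $\mathfrak{p}$; products of residue fields are $R$-algebras via the canonical maps. For a subset $X\subseteq\operatorname{Spec}(R)$, the specialization cone of $X$ is $X_{s}:=\bigcup_{\mathfrak{p}\in X}V(\mathfrak{p})$, where $V(\mathfrak{p})=\{\mathfrak{q}\in\operatorname{Spec}(R):\mathfrak{p}\subseteq\mathfrak{q}\}$. *)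

theory Defs
  imports
    "HOL-Algebra.Module"
    "HOL-Algebra.QuotRing"
    "HOL-Algebra.Generated_Groups"
    "HOL-Algebra.Free_Abelian_Groups"
begin

section \<open>Modules\<close>

definition module_hom ::
    "('a, 'x) ring_scheme \<Rightarrow> ('a, 'm, 'y) module_scheme \<Rightarrow> ('a, 'n, 'z) module_scheme \<Rightarrow> ('m \<Rightarrow> 'n) set"
  where "module_hom R M N =
    {f \<in> hom (add_monoid M) (add_monoid N).
       \<forall>r \<in> carrier R. \<forall>x \<in> carrier M. f (r \<odot>\<^bsub>M\<^esub> x) = r \<odot>\<^bsub>N\<^esub> f x}"

definition finitely_generated_module ::
    "('a, 'x) ring_scheme \<Rightarrow> ('a, 'm, 'y) module_scheme \<Rightarrow> bool"
  where "finitely_generated_module R M \<longleftrightarrow> module R M \<and>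
    (\<exists>A. finite A \<and> A \<subseteq> carrier M \<and>
      (\<forall>x \<in> carrier M. \<exists>c \<in> A \<rightarrow> carrier R. x = (\<Oplus>\<^bsub>M\<^esub>a\<in>A. c a \<odot>\<^bsub>M\<^esub> a)))"

text \<open>
  Lifting along surjections of modules.  HOL cannot quantify over the carrier types of the test
  modules inside a definition, so they are fixed, large enough for the free module on
  \<open>carrier P\<close>.  Lemma \<open>projective_module_lift\<close> below shows that
  the lifting property then holds for test modules over arbitrary types.
\<close>

definition projective_module ::
    "('s, 'x) ring_scheme \<Rightarrow> ('s, 'p, 'y) module_scheme \<Rightarrow> bool"
  where "projective_module S P \<longleftrightarrow> module S P \<and>
    (\<forall>(A :: ('s, 'p \<Rightarrow> 's) module) (B :: ('s, 'p) module) g f.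
       module S A \<and> module S B \<and>
       g \<in> module_hom S A B \<and> g ` carrier A = carrier B \<and> f \<in> module_hom S P B \<longrightarrow>
       (\<exists>h \<in> module_hom S P A. \<forall>x \<in> carrier P. g (h x) = f x))"


section \<open>Tensor products\<close>

text \<open>
  \<open>M \<otimes>\<^sub>R N\<close> is the free abelian group on \<open>M \<times> N\<close> modulo the
  relations of bilinearity; its elements are cosets.
\<close>

definition tensor_relations ::
    "('a, 'x) ring_scheme \<Rightarrow> ('a, 'm, 'y) module_scheme \<Rightarrow> ('a, 'n, 'z) module_scheme
      \<Rightarrow> ('m \<times> 'n \<Rightarrow>\<^sub>0 int) set"
  where "tensor_relations R M N =
    {frag_of (m \<oplus>\<^bsub>M\<^esub> m', n) - frag_of (m, n) - frag_of (m', n) | m m' n.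
       m \<in> carrier M \<and> m' \<in> carrier M \<and> n \<in> carrier N} \<union>
    {frag_of (m, n \<oplus>\<^bsub>N\<^esub> n') - frag_of (m, n) - frag_of (m, n') | m n n'.
       m \<in> carrier M \<and> n \<in> carrier N \<and> n' \<in> carrier N} \<union>
    {frag_of (r \<odot>\<^bsub>M\<^esub> m, n) - frag_of (m, r \<odot>\<^bsub>N\<^esub> n) | r m n.
       r \<in> carrier R \<and> m \<in> carrier M \<and> n \<in> carrier N}"

definition tensor_kernel ::
    "('a, 'x) ring_scheme \<Rightarrow> ('a, 'm, 'y) module_scheme \<Rightarrow> ('a, 'n, 'z) module_scheme
      \<Rightarrow> ('m \<times> 'n \<Rightarrow>\<^sub>0 int) set"
  where "tensor_kernel R M N =
    generate (free_Abelian_group (carrier M \<times> carrier N)) (tensor_relations R M N)"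

definition tensor_group ::
    "('a, 'x) ring_scheme \<Rightarrow> ('a, 'm, 'y) module_scheme \<Rightarrow> ('a, 'n, 'z) module_scheme
      \<Rightarrow> ('m \<times> 'n \<Rightarrow>\<^sub>0 int) set monoid"
  where "tensor_group R M N =
    free_Abelian_group (carrier M \<times> carrier N) Mod tensor_kernel R M N"

definition tensor_push :: "('n \<Rightarrow> 'k) \<Rightarrow> ('m \<times> 'n \<Rightarrow>\<^sub>0 int) \<Rightarrow> ('m \<times> 'k \<Rightarrow>\<^sub>0 int)"
  where "tensor_push f = frag_extend (\<lambda>(m, n). frag_of (m, f n))"

text \<open>
  The map \<open>id \<otimes> f : M \<otimes>\<^sub>R N \<rightarrow> M \<otimes>\<^sub>R N'\<close>, with
  \<open>f\<close> applied to representatives.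
\<close>

definition tensor_map ::
    "('a, 'x) ring_scheme \<Rightarrow> ('a, 'm, 'y) module_scheme \<Rightarrow> ('a, 'n, 'z) module_scheme \<Rightarrow>
     ('a, 'k, 'w) module_scheme \<Rightarrow> ('n \<Rightarrow> 'k) \<Rightarrow>
     ('m \<times> 'n \<Rightarrow>\<^sub>0 int) set \<Rightarrow> ('m \<times> 'k \<Rightarrow>\<^sub>0 int) set"
  where "tensor_map R M N N' f T =
    (\<Union>c \<in> T. tensor_kernel R M N' #>\<^bsub>free_Abelian_group (carrier M \<times> carrier N')\<^esub> tensor_push f c)"

text \<open>
  The functor \<open>M \<otimes>\<^sub>R _\<close> preserves injections.  Up to isomorphism, the type
  \<open>'a list\<close> contains the carriers of all finitely generated modules over
  \<open>R\<close>; lemma \<open>flat_module_inj\<close> below shows that the property then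
  holds for modules over arbitrary types.
\<close>

definition flat_module :: "('a, 'x) ring_scheme \<Rightarrow> ('a, 'm, 'y) module_scheme \<Rightarrow> bool"
  where "flat_module R M \<longleftrightarrow> module R M \<and>
    (\<forall>(N :: ('a, 'a list) module) (N' :: ('a, 'a list) module) f.
       module R N \<and> module R N' \<and> f \<in> module_hom R N N' \<and> inj_on f (carrier N) \<longrightarrow>
       inj_on (tensor_map R M N N' f) (carrier (tensor_group R M N)))"

definition restrict_scalars :: "('a \<Rightarrow> 's) \<Rightarrow> ('s, 'x) ring_scheme \<Rightarrow> ('a, 's) module"
  where "restrict_scalars \<phi> S =
    \<lparr>carrier = carrier S, monoid.mult = monoid.mult S, one = \<one>\<^bsub>S\<^esub>, ring.zero = \<zero>\<^bsub>S\<^esub>, add = add S,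
     smult = (\<lambda>r x. \<phi> r \<otimes>\<^bsub>S\<^esub> x)\<rparr>"

text \<open>
  \<open>M \<otimes>\<^sub>R S\<close> as an \<open>S\<close>-module, where \<open>S\<close> is an
  \<open>R\<close>-algebra via \<open>\<phi>\<close>.  The fields \<open>mult\<close> and
  \<open>one\<close> of the module record play no role.
\<close>

definition base_change ::
    "('a, 'x) ring_scheme \<Rightarrow> ('a, 'm, 'y) module_scheme \<Rightarrow> ('a \<Rightarrow> 's) \<Rightarrow> ('s, 'z) ring_scheme
      \<Rightarrow> ('s, ('m \<times> 's \<Rightarrow>\<^sub>0 int) set) module"
  where "base_change R M \<phi> S =
    \<lparr>carrier = carrier (tensor_group R M (restrict_scalars \<phi> S)),
     monoid.mult = undefined, one = undefined,
     ring.zero = \<one>\<^bsub>tensor_group R M (restrict_scalars \<phi> S)\<^esub>,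
     add = monoid.mult (tensor_group R M (restrict_scalars \<phi> S)),
     smult = (\<lambda>s. tensor_map R M (restrict_scalars \<phi> S) (restrict_scalars \<phi> S) (\<lambda>x. s \<otimes>\<^bsub>S\<^esub> x))\<rparr>"


section \<open>Localization, residue fields and their products\<close>

definition frac_rel :: "('a, 'x) ring_scheme \<Rightarrow> 'a set \<Rightarrow> (('a \<times> 'a) \<times> ('a \<times> 'a)) set"
  where "frac_rel R D =
    {((r, s), (r', s')). r \<in> carrier R \<and> r' \<in> carrier R \<and> s \<in> D \<and> s' \<in> D \<and>
       (\<exists>t \<in> D. t \<otimes>\<^bsub>R\<^esub> (s' \<otimes>\<^bsub>R\<^esub> r) = t \<otimes>\<^bsub>R\<^esub> (s \<otimes>\<^bsub>R\<^esub> r'))}"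

definition fraction :: "('a, 'x) ring_scheme \<Rightarrow> 'a set \<Rightarrow> 'a \<Rightarrow> 'a \<Rightarrow> ('a \<times> 'a) set"
  where "fraction R D r s = frac_rel R D `` {(r, s)}"

text \<open>The ring of fractions of \<open>R\<close> with denominators in \<open>D\<close>.\<close>

definition localization :: "('a, 'x) ring_scheme \<Rightarrow> 'a set \<Rightarrow> ('a \<times> 'a) set ring"
  where "localization R D =
    \<lparr>carrier = (carrier R \<times> D) // frac_rel R D,
     monoid.mult = (\<lambda>F G. \<Union>(r, s) \<in> F. \<Union>(r', s') \<in> G. fraction R D (r \<otimes>\<^bsub>R\<^esub> r') (s \<otimes>\<^bsub>R\<^esub> s')),
     one = fraction R D \<one>\<^bsub>R\<^esub> \<one>\<^bsub>R\<^esub>,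
     ring.zero = fraction R D \<zero>\<^bsub>R\<^esub> \<one>\<^bsub>R\<^esub>,
     add = (\<lambda>F G. \<Union>(r, s) \<in> F. \<Union>(r', s') \<in> G.
              fraction R D ((s' \<otimes>\<^bsub>R\<^esub> r) \<oplus>\<^bsub>R\<^esub> (s \<otimes>\<^bsub>R\<^esub> r')) (s \<otimes>\<^bsub>R\<^esub> s'))\<rparr>"

definition localization_at :: "('a, 'x) ring_scheme \<Rightarrow> 'a set \<Rightarrow> ('a \<times> 'a) set ring"
  where "localization_at R p = localization R (carrier R - p)"

text \<open>The ideal \<open>p R\<^sub>p\<close> of \<open>R\<^sub>p\<close>.\<close>

definition extended_ideal :: "('a, 'x) ring_scheme \<Rightarrow> 'a set \<Rightarrow> ('a \<times> 'a) set set"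
  where "extended_ideal R p =
    Idl\<^bsub>localization_at R p\<^esub> ((\<lambda>r. fraction R (carrier R - p) r \<one>\<^bsub>R\<^esub>) ` p)"

definition residue_field :: "('a, 'x) ring_scheme \<Rightarrow> 'a set \<Rightarrow> ('a \<times> 'a) set set ring"
  where "residue_field R p = localization_at R p Quot extended_ideal R p"

definition residue_map :: "('a, 'x) ring_scheme \<Rightarrow> 'a set \<Rightarrow> 'a \<Rightarrow> ('a \<times> 'a) set set"
  where "residue_map R p r =
    extended_ideal R p +>\<^bsub>localization_at R p\<^esub> fraction R (carrier R - p) r \<one>\<^bsub>R\<^esub>"

definition product_ring :: "'i set \<Rightarrow> ('i \<Rightarrow> ('b, 'x) ring_scheme) \<Rightarrow> ('i \<Rightarrow> 'b) ring"
  where "product_ring I A =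
    \<lparr>carrier = (\<Pi>\<^sub>E i\<in>I. carrier (A i)),
     monoid.mult = (\<lambda>x y. \<lambda>i\<in>I. x i \<otimes>\<^bsub>A i\<^esub> y i),
     one = (\<lambda>i\<in>I. \<one>\<^bsub>A i\<^esub>),
     ring.zero = (\<lambda>i\<in>I. \<zero>\<^bsub>A i\<^esub>),
     add = (\<lambda>x y. \<lambda>i\<in>I. x i \<oplus>\<^bsub>A i\<^esub> y i)\<rparr>"

definition residue_product ::
    "('a, 'x) ring_scheme \<Rightarrow> 'a set set \<Rightarrow> ('a set \<Rightarrow> ('a \<times> 'a) set set) ring"
  where "residue_product R X = product_ring X (residue_field R)"

definition residue_product_map ::
    "('a, 'x) ring_scheme \<Rightarrow> 'a set set \<Rightarrow> 'a \<Rightarrow> 'a set \<Rightarrow> ('a \<times> 'a) set set"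
  where "residue_product_map R X r = (\<lambda>p\<in>X. residue_map R p r)"

definition Spec :: "('a, 'x) ring_scheme \<Rightarrow> 'a set set"
  where "Spec R = {p. primeideal p R}"

definition specialization_cone :: "('a, 'x) ring_scheme \<Rightarrow> 'a set set \<Rightarrow> 'a set set"
  where "specialization_cone R X = (\<Union>p\<in>X. {q \<in> Spec R. p \<subseteq> q})"


section \<open>Basic facts\<close>

subsection \<open>Tensor products\<close>

lemma r_coset_free_Abelian_group:
  "K #>\<^bsub>free_Abelian_group S\<^esub> c = (\<lambda>k. k + c) ` K"
  by (auto simp: r_coset_def free_Abelian_group_def)

lemma module_homD:
  assumes "f \<in> module_hom R M N"
  shows "x \<in> carrier M \<Longrightarrow> f x \<in> carrier N"
    and "x \<in> carrier M \<Longrightarrow> y \<in> carrier M \<Longrightarrow> f (x \<oplus>\<^bsub>M\<^esub> y) = f x \<oplus>\<^bsub>N\<^esub> f y"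
    and "r \<in> carrier R \<Longrightarrow> x \<in> carrier M \<Longrightarrow> f (r \<odot>\<^bsub>M\<^esub> x) = r \<odot>\<^bsub>N\<^esub> f x"
  using assms by (auto simp: module_hom_def hom_def)

lemma module_homI:
  assumes "\<And>x. x \<in> carrier M \<Longrightarrow> f x \<in> carrier N"
    and "\<And>x y. x \<in> carrier M \<Longrightarrow> y \<in> carrier M \<Longrightarrow> f (x \<oplus>\<^bsub>M\<^esub> y) = f x \<oplus>\<^bsub>N\<^esub> f y"
    and "\<And>r x. r \<in> carrier R \<Longrightarrow> x \<in> carrier M \<Longrightarrow> f (r \<odot>\<^bsub>M\<^esub> x) = r \<odot>\<^bsub>N\<^esub> f x"
  shows "f \<in> module_hom R M N"
  using assms by (auto simp: module_hom_def hom_def)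

lemma tensor_relations_closed:
  assumes "module R M" "module R N"
  shows "tensor_relations R M N \<subseteq> carrier (free_Abelian_group (carrier M \<times> carrier N))"
proof -
  interpret M: module R M by fact
  interpret N: module R N by fact
  show ?thesis
    unfolding tensor_relations_def
    by (auto dest!: subsetD[OF keys_diff])
qed

lemma tensor_kernel_subgroup:
  assumes "module R M" "module R N"
  shows "subgroup (tensor_kernel R M N) (free_Abelian_group (carrier M \<times> carrier N))"
  unfolding tensor_kernel_def
  by (intro group.generate_is_subgroup tensor_relations_closed assms) auto

lemma tensor_kernel_closed:
  assumes "module R M" "module R N"
  shows "0 \<in> tensor_kernel R M N"
    and "c \<in> tensor_kernel R M N \<Longrightarrow> d \<in> tensor_kernel R M N \<Longrightarrow> c + d \<in> tensor_kernel R M N"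
    and "c \<in> tensor_kernel R M N \<Longrightarrow> - c \<in> tensor_kernel R M N"
    and "c \<in> tensor_kernel R M N \<Longrightarrow> d \<in> tensor_kernel R M N \<Longrightarrow> c - d \<in> tensor_kernel R M N"
    and "c \<in> tensor_kernel R M N \<Longrightarrow> Poly_Mapping.keys c \<subseteq> carrier M \<times> carrier N"
proof -
  let ?G = "free_Abelian_group (carrier M \<times> carrier N)"
  note K = tensor_kernel_subgroup[OF assms]
  show "0 \<in> tensor_kernel R M N"
    using subgroup.one_closed[OF K] by simp
  show sub: "Poly_Mapping.keys c \<subseteq> carrier M \<times> carrier N" if "c \<in> tensor_kernel R M N" for c
    using subgroup.mem_carrier[OF K that] by simp
  show add: "c + d \<in> tensor_kernel R M N" if "c \<in> tensor_kernel R M N" "d \<in> tensor_kernel R M N" for c d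
    using subgroup.m_closed[OF K that] by simp
  show neg: "- c \<in> tensor_kernel R M N" if "c \<in> tensor_kernel R M N" for c
    using subgroup.m_inv_closed[OF K that] sub[OF that] by simp
  show "c - d \<in> tensor_kernel R M N" if "c \<in> tensor_kernel R M N" "d \<in> tensor_kernel R M N" for c d
    using add[OF that(1) neg[OF that(2)]] by simp
qed

lemma tensor_coset_eq_iff:
  assumes "module R M" "module R N"
  shows "tensor_kernel R M N #>\<^bsub>free_Abelian_group (carrier M \<times> carrier N)\<^esub> c =
         tensor_kernel R M N #>\<^bsub>free_Abelian_group (carrier M \<times> carrier N)\<^esub> d
         \<longleftrightarrow> c - d \<in> tensor_kernel R M N"
    (is "?l \<longleftrightarrow> ?r")
proof
  note K = tensor_kernel_closed[OF assms]
  assume ?l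
  moreover have "c \<in> (\<lambda>k. k + c) ` tensor_kernel R M N"
    using K(1) by force
  ultimately obtain k where "k \<in> tensor_kernel R M N" "c = k + d"
    unfolding r_coset_free_Abelian_group by auto
  thus ?r by simp
next
  note K = tensor_kernel_closed[OF assms]
  assume r: ?r
  have "k + c \<in> (\<lambda>k. k + d) ` tensor_kernel R M N" if "k \<in> tensor_kernel R M N" for k
    using K(2)[OF that r] by (intro image_eqI[where x = "k + (c - d)"]) auto
  moreover have "k + d \<in> (\<lambda>k. k + c) ` tensor_kernel R M N" if "k \<in> tensor_kernel R M N" for k
    using K(4)[OF that r] by (intro image_eqI[where x = "k - (c - d)"]) auto
  ultimately show ?l
    unfolding r_coset_free_Abelian_group by auto
qed

lemma carrier_tensor_group:
  "carrier (tensor_group R M N) =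
   (\<lambda>c. tensor_kernel R M N #>\<^bsub>free_Abelian_group (carrier M \<times> carrier N)\<^esub> c) `
     {c. Poly_Mapping.keys c \<subseteq> carrier M \<times> carrier N}"
  by (simp add: tensor_group_def carrier_FactGroup free_Abelian_group_def)

lemma tensor_group_comm_group:
  assumes "module R M" "module R N"
  shows "comm_group (tensor_group R M N)"
  unfolding tensor_group_def
  by (intro comm_group.abelian_FactGroup tensor_kernel_subgroup assms
      abelian_free_Abelian_group)

lemma mult_tensor_group:
  assumes "module R M" "module R N"
    and "Poly_Mapping.keys c \<subseteq> carrier M \<times> carrier N" "Poly_Mapping.keys d \<subseteq> carrier M \<times> carrier N"
  shows "(tensor_kernel R M N #>\<^bsub>free_Abelian_group (carrier M \<times> carrier N)\<^esub> c) \<otimes>\<^bsub>tensor_group R M N\<^esub>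
         (tensor_kernel R M N #>\<^bsub>free_Abelian_group (carrier M \<times> carrier N)\<^esub> d) =
         tensor_kernel R M N #>\<^bsub>free_Abelian_group (carrier M \<times> carrier N)\<^esub> (c + d)"
proof -
  interpret G: comm_group "free_Abelian_group (carrier M \<times> carrier N)"
    by (rule abelian_free_Abelian_group)
  have "normal (tensor_kernel R M N) (free_Abelian_group (carrier M \<times> carrier N))"
    by (rule G.subgroup_imp_normal[OF tensor_kernel_subgroup[OF assms(1,2)]])
  from normal.rcos_sum[OF this, of c d] assms(3,4) show ?thesis
    by (simp add: tensor_group_def)
qed

lemma tensor_push_simps [simp]:
  "tensor_push f 0 = 0"
  "tensor_push f (frag_of (m, n)) = frag_of (m, f n)"
  "tensor_push f (c + d) = tensor_push f c + tensor_push f d"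
  "tensor_push f (c - d) = tensor_push f c - tensor_push f d"
  "tensor_push f (- c) = - tensor_push f c"
  by (simp_all add: tensor_push_def frag_extend_add frag_extend_diff frag_extend_minus)

lemma keys_tensor_push:
  "Poly_Mapping.keys (tensor_push f c) \<subseteq> (\<lambda>(m, n). (m, f n)) ` Poly_Mapping.keys c"
  unfolding tensor_push_def
  using keys_frag_extend[of "\<lambda>(m, n). frag_of (m, f n)" c] by fastforce

lemma keys_tensor_push_subset:
  assumes "Poly_Mapping.keys c \<subseteq> A \<times> B" "f \<in> B \<rightarrow> C"
  shows "Poly_Mapping.keys (tensor_push f c) \<subseteq> A \<times> C"
  using keys_tensor_push[of f c] assms by fastforce

lemma tensor_push_cong:
  assumes "\<And>m n. (m, n) \<in> Poly_Mapping.keys c \<Longrightarrow> f n = g n"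
  shows "tensor_push f c = tensor_push g c"
  unfolding tensor_push_def by (rule frag_extend_eq) (use assms in auto)

lemma tensor_push_comp: "tensor_push f (tensor_push g c) = tensor_push (f \<circ> g) c"
proof -
  have "tensor_push f (tensor_push g c) = frag_extend (\<lambda>(m, n). frag_of (m, f n))
     (frag_extend (frag_of \<circ> (\<lambda>(m, n). (m, g n))) c)"
    unfolding tensor_push_def by (intro arg_cong[where f = "frag_extend _"] frag_extend_eq) auto
  also have "\<dots> = frag_extend ((\<lambda>(m, n). frag_of (m, f n)) \<circ> (\<lambda>(m, n). (m, g n))) c"
    by (rule frag_extend_compose)
  also have "\<dots> = tensor_push (f \<circ> g) c"
    unfolding tensor_push_def by (intro frag_extend_eq) auto
  finally show ?thesis .
qed

lemma tensor_push_id: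
  assumes "\<And>m n. (m, n) \<in> Poly_Mapping.keys c \<Longrightarrow> f n = n"
  shows "tensor_push f c = c"
proof -
  have "tensor_push f c = frag_extend frag_of c"
    unfolding tensor_push_def by (rule frag_extend_eq) (use assms in auto)
  thus ?thesis using frag_expansion[of c] by simp
qed

lemma tensor_relations_push:
  assumes "module R M" "module R N" "module R N'" "f \<in> module_hom R N N'"
    and "c \<in> tensor_relations R M N"
  shows "tensor_push f c \<in> tensor_relations R M N'"
proof -
  note f = module_homD[OF assms(4)]
  from assms(5) consider
      (1) m m' n where "c = frag_of (m \<oplus>\<^bsub>M\<^esub> m', n) - frag_of (m, n) - frag_of (m', n)"
        "m \<in> carrier M" "m' \<in> carrier M" "n \<in> carrier N"
    | (2) m n n' where "c = frag_of (m, n \<oplus>\<^bsub>N\<^esub> n') - frag_of (m, n) - frag_of (m, n')"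
        "m \<in> carrier M" "n \<in> carrier N" "n' \<in> carrier N"
    | (3) r m n where "c = frag_of (r \<odot>\<^bsub>M\<^esub> m, n) - frag_of (m, r \<odot>\<^bsub>N\<^esub> n)"
        "r \<in> carrier R" "m \<in> carrier M" "n \<in> carrier N"
    unfolding tensor_relations_def by blast
  thus ?thesis
  proof cases
    case 1 thus ?thesis using f(1)[of n] unfolding tensor_relations_def by auto
  next
    case 2 thus ?thesis using f(1)[of n] f(1)[of n'] unfolding tensor_relations_def
      by (auto simp: f(2))
  next
    case 3 thus ?thesis using f(1)[of n] unfolding tensor_relations_def
      by (auto simp: f(3))
  qed
qed

lemma tensor_kernel_induct [consumes 3, case_names zero rel neg_rel add]:
  assumes "module R M" "module R N" "c \<in> tensor_kernel R M N"
    and "P 0"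
    and "\<And>c. c \<in> tensor_relations R M N \<Longrightarrow> P c"
    and "\<And>c. c \<in> tensor_relations R M N \<Longrightarrow> P (- c)"
    and "\<And>c d. c \<in> tensor_kernel R M N \<Longrightarrow> d \<in> tensor_kernel R M N \<Longrightarrow> P c \<Longrightarrow> P d \<Longrightarrow> P (c + d)"
  shows "P c"
  using assms(3) unfolding tensor_kernel_def
proof (induction rule: generate.induct)
  case one thus ?case using assms(4) by simp
next
  case (incl h) thus ?case using assms(5) by simp
next
  case (inv h)
  moreover have "h \<in> carrier (free_Abelian_group (carrier M \<times> carrier N))"
    using subsetD[OF tensor_relations_closed[OF assms(1,2)] inv(1)] .
  ultimately show ?case using assms(6)[OF inv] by simp
next
  case (eng h1 h2) thus ?case using assms(7) by (simp add: tensor_kernel_def)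
qed

lemma tensor_kernel_rel: "c \<in> tensor_relations R M N \<Longrightarrow> c \<in> tensor_kernel R M N"
  unfolding tensor_kernel_def by (rule generate.incl)

lemma tensor_kernel_push:
  assumes "module R M" "module R N" "module R N'" "f \<in> module_hom R N N'"
    and "c \<in> tensor_kernel R M N"
  shows "tensor_push f c \<in> tensor_kernel R M N'"
  using assms(1,2,5)
proof (induction rule: tensor_kernel_induct)
  case zero show ?case using tensor_kernel_closed(1)[OF assms(1,3)] by simp
next
  case (rel c) thus ?case by (intro tensor_kernel_rel tensor_relations_push[OF assms(1-4)])
next
  case (neg_rel c)
  hence "tensor_push f c \<in> tensor_kernel R M N'"
    by (intro tensor_kernel_rel tensor_relations_push[OF assms(1-4)])
  thus ?case using tensor_kernel_closed(3)[OF assms(1,3)] by simp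
next
  case (add c d) thus ?case using tensor_kernel_closed(2)[OF assms(1,3)] by simp
qed

lemma tensor_map_coset:
  assumes "module R M" "module R N" "module R N'" "f \<in> module_hom R N N'"
  shows "tensor_map R M N N' f (tensor_kernel R M N #>\<^bsub>free_Abelian_group (carrier M \<times> carrier N)\<^esub> c) =
         tensor_kernel R M N' #>\<^bsub>free_Abelian_group (carrier M \<times> carrier N')\<^esub> tensor_push f c"
proof -
  have *: "tensor_kernel R M N' #>\<^bsub>free_Abelian_group (carrier M \<times> carrier N')\<^esub> tensor_push f (k + c) =
        tensor_kernel R M N' #>\<^bsub>free_Abelian_group (carrier M \<times> carrier N')\<^esub> tensor_push f c"
    if "k \<in> tensor_kernel R M N" for k
    using tensor_kernel_push[OF assms that]
    by (subst tensor_coset_eq_iff[OF assms(1,3)]) simp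
  show ?thesis
  proof -
    let ?f = "\<lambda>c. tensor_kernel R M N' #>\<^bsub>free_Abelian_group (carrier M \<times> carrier N')\<^esub> tensor_push f c"
    have "(\<Union>d \<in> (\<lambda>k. k + c) ` tensor_kernel R M N. ?f d) = (\<Union>k \<in> tensor_kernel R M N. ?f (k + c))"
      by (rule UN_simps)
    also have "\<dots> = (\<Union>k \<in> tensor_kernel R M N. ?f c)"
      by (rule SUP_cong[OF refl *])
    also have "\<dots> = ?f c"
      using tensor_kernel_closed(1)[OF assms(1,2)] by (intro UN_constant_eq) auto
    finally show ?thesis
      unfolding tensor_map_def r_coset_free_Abelian_group[where K = "tensor_kernel R M N"] .
  qed
qed

lemma tensor_map_inj_iff:
  assumes "module R M" "module R N" "module R N'" "f \<in> module_hom R N N'"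
  shows "inj_on (tensor_map R M N N' f) (carrier (tensor_group R M N)) \<longleftrightarrow>
    (\<forall>c. Poly_Mapping.keys c \<subseteq> carrier M \<times> carrier N \<longrightarrow>
       tensor_push f c \<in> tensor_kernel R M N' \<longrightarrow> c \<in> tensor_kernel R M N)"
    (is "?l \<longleftrightarrow> ?r")
proof
  assume l: ?l
  show ?r
  proof (intro allI impI)
    fix c
    assume c: "Poly_Mapping.keys c \<subseteq> carrier M \<times> carrier N" "tensor_push f c \<in> tensor_kernel R M N'"
    have "tensor_kernel R M N #>\<^bsub>free_Abelian_group (carrier M \<times> carrier N)\<^esub> c =
          tensor_kernel R M N #>\<^bsub>free_Abelian_group (carrier M \<times> carrier N)\<^esub> 0"
      by (rule inj_onD[OF l])
        (use c in \<open>auto simp: carrier_tensor_group tensor_map_coset[OF assms]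
            tensor_coset_eq_iff[OF assms(1,3)]\<close>)
    thus "c \<in> tensor_kernel R M N"
      by (simp add: tensor_coset_eq_iff[OF assms(1,2)])
  qed
next
  assume r: ?r
  show ?l
  proof (rule inj_onI)
    fix X Y assume "X \<in> carrier (tensor_group R M N)" "Y \<in> carrier (tensor_group R M N)"
      and eq: "tensor_map R M N N' f X = tensor_map R M N N' f Y"
    then obtain c d where
      c: "X = tensor_kernel R M N #>\<^bsub>free_Abelian_group (carrier M \<times> carrier N)\<^esub> c"
        "Poly_Mapping.keys c \<subseteq> carrier M \<times> carrier N" and
      d: "Y = tensor_kernel R M N #>\<^bsub>free_Abelian_group (carrier M \<times> carrier N)\<^esub> d"
        "Poly_Mapping.keys d \<subseteq> carrier M \<times> carrier N"
      by (auto simp: carrier_tensor_group)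
    have "tensor_push f (c - d) \<in> tensor_kernel R M N'"
      using eq unfolding c(1) d(1) tensor_map_coset[OF assms] tensor_coset_eq_iff[OF assms(1,3)] by simp
    moreover have "Poly_Mapping.keys (c - d) \<subseteq> carrier M \<times> carrier N"
      using c(2) d(2) keys_diff[of c d] by blast
    ultimately have "c - d \<in> tensor_kernel R M N" using r by blast
    thus "X = Y" unfolding c(1) d(1) by (simp add: tensor_coset_eq_iff[OF assms(1,2)])
  qed
qed

lemma module_restrict_scalars:
  assumes "cring R" "cring S" "\<phi> \<in> ring_hom R S"
  shows "module R (restrict_scalars \<phi> S)"
proof -
  interpret S: cring S by fact
  interpret R: cring R by fact
  note \<phi> = ring_hom_closed[OF assms(3)] ring_hom_add[OF assms(3)] ring_hom_mult[OF assms(3)]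
    ring_hom_one[OF assms(3)]
  show ?thesis
  proof (rule moduleI)
    show "abelian_group (restrict_scalars \<phi> S)"
    proof (rule abelian_groupI)
      fix x assume "x \<in> carrier (restrict_scalars \<phi> S)"
      thus "\<exists>y\<in>carrier (restrict_scalars \<phi> S).
          y \<oplus>\<^bsub>restrict_scalars \<phi> S\<^esub> x = \<zero>\<^bsub>restrict_scalars \<phi> S\<^esub>"
        by (intro bexI[of _ "\<ominus>\<^bsub>S\<^esub> x"]) (simp_all add: restrict_scalars_def S.l_neg)
    next
      fix x y assume "x \<in> carrier (restrict_scalars \<phi> S)" "y \<in> carrier (restrict_scalars \<phi> S)"
      thus "x \<oplus>\<^bsub>restrict_scalars \<phi> S\<^esub> y = y \<oplus>\<^bsub>restrict_scalars \<phi> S\<^esub> x"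
        by (simp add: restrict_scalars_def S.a_comm)
    next
fix x y z assume "x \<in> carrier (restrict_scalars \<phi> S)" "y \<in> carrier (restrict_scalars \<phi> S)" "z \<in> carrier (restrict_scalars \<phi> S)"
thus "x \<oplus>\<^bsub>restrict_scalars \<phi> S\<^esub> y \<oplus>\<^bsub>restrict_scalars \<phi> S\<^esub> z =
       x \<oplus>\<^bsub>restrict_scalars \<phi> S\<^esub> (y \<oplus>\<^bsub>restrict_scalars \<phi> S\<^esub> z)"
 by (simp add: restrict_scalars_def S.a_assoc)
    qed (simp_all add: restrict_scalars_def)
  qed (simp_all add: restrict_scalars_def S.l_distr S.r_distr S.m_assoc \<phi> R.is_cring)
qed


lemma module_base_change:
  assumes "module R M" "cring S" "\<phi> \<in> ring_hom R S"
  shows "module S (base_change R M \<phi> S)"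
proof -
  interpret M: module R M by fact
  interpret S: cring S by fact
  let ?N = "restrict_scalars \<phi> S"
  let ?K = "\<lambda>c. tensor_kernel R M ?N #>\<^bsub>free_Abelian_group (carrier M \<times> carrier ?N)\<^esub> c"
  let ?T = "tensor_group R M ?N"
  have N: "module R ?N" by (intro module_restrict_scalars assms M.is_cring)
  have cN [simp]: "carrier ?N = carrier S" by (simp add: restrict_scalars_def)
  have hom: "(\<lambda>x. s \<otimes>\<^bsub>S\<^esub> x) \<in> module_hom R ?N ?N" if "s \<in> carrier S" for s
    using that assms(3)
    by (intro module_homI) (simp_all add: restrict_scalars_def S.r_distr ring_hom_closed[OF assms(3)] S.m_lcomm)
  have sm: "s \<odot>\<^bsub>base_change R M \<phi> S\<^esub> ?K c = ?K (tensor_push (\<lambda>x. s \<otimes>\<^bsub>S\<^esub> x) c)" if "s \<in> carrier S" for s c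
    using tensor_map_coset[OF assms(1) N N hom[OF that], of c] by (simp add: base_change_def)
  interpret T: comm_group ?T by (rule tensor_group_comm_group[OF assms(1) N])
  have pk: "Poly_Mapping.keys (tensor_push (\<lambda>x. s \<otimes>\<^bsub>S\<^esub> x) c) \<subseteq> carrier M \<times> carrier S"
    if "s \<in> carrier S" "Poly_Mapping.keys c \<subseteq> carrier M \<times> carrier S" for s c
    using that by (intro keys_tensor_push_subset) auto
  have carr: "carrier (base_change R M \<phi> S) = ?K ` {c. Poly_Mapping.keys c \<subseteq> carrier M \<times> carrier S}"
    by (simp add: base_change_def carrier_tensor_group)
  have add: "?K c \<oplus>\<^bsub>base_change R M \<phi> S\<^esub> ?K d = ?K (c + d)"
    if "Poly_Mapping.keys c \<subseteq> carrier M \<times> carrier S" "Poly_Mapping.keys d \<subseteq> carrier M \<times> carrier S" for c d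
    using mult_tensor_group[OF assms(1) N, of c d] that by (simp add: base_change_def)
  have keys_add': "Poly_Mapping.keys (c + d) \<subseteq> carrier M \<times> carrier S"
    if "Poly_Mapping.keys c \<subseteq> carrier M \<times> carrier S" "Poly_Mapping.keys d \<subseteq> carrier M \<times> carrier S"
    for c d :: "_ \<Rightarrow>\<^sub>0 int"
    using that Poly_Mapping.keys_add[of c d] by blast
  show ?thesis
  proof (rule moduleI)
    show "abelian_group (base_change R M \<phi> S)"
    proof (rule abelian_groupI)
      fix x assume "x \<in> carrier (base_change R M \<phi> S)"
      hence "x \<in> carrier ?T" by (simp add: base_change_def)
      thus "\<exists>y\<in>carrier (base_change R M \<phi> S). y \<oplus>\<^bsub>base_change R M \<phi> S\<^esub> x = \<zero>\<^bsub>base_change R M \<phi> S\<^esub>"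
        by (intro bexI[of _ "inv\<^bsub>?T\<^esub> x"]) (simp_all add: base_change_def)
    next
      fix x y assume "x \<in> carrier (base_change R M \<phi> S)" "y \<in> carrier (base_change R M \<phi> S)"
      thus "x \<oplus>\<^bsub>base_change R M \<phi> S\<^esub> y = y \<oplus>\<^bsub>base_change R M \<phi> S\<^esub> x"
        by (simp add: base_change_def T.m_comm)
    next
      fix x y z assume "x \<in> carrier (base_change R M \<phi> S)" "y \<in> carrier (base_change R M \<phi> S)"
        "z \<in> carrier (base_change R M \<phi> S)"
      thus "x \<oplus>\<^bsub>base_change R M \<phi> S\<^esub> y \<oplus>\<^bsub>base_change R M \<phi> S\<^esub> z =
            x \<oplus>\<^bsub>base_change R M \<phi> S\<^esub> (y \<oplus>\<^bsub>base_change R M \<phi> S\<^esub> z)"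
        by (simp add: base_change_def T.m_assoc)
    qed (simp_all add: base_change_def)
  next
    fix a x assume a: "a \<in> carrier S" and "x \<in> carrier (base_change R M \<phi> S)"
    then obtain c where c: "x = ?K c" "Poly_Mapping.keys c \<subseteq> carrier M \<times> carrier S"
      unfolding carr by auto
    show "a \<odot>\<^bsub>base_change R M \<phi> S\<^esub> x \<in> carrier (base_change R M \<phi> S)"
      unfolding c(1) sm[OF a] unfolding carr using pk[OF a c(2)] by auto
  next
    fix a b x assume a: "a \<in> carrier S" and b: "b \<in> carrier S" and "x \<in> carrier (base_change R M \<phi> S)"
    then obtain c where c: "x = ?K c" "Poly_Mapping.keys c \<subseteq> carrier M \<times> carrier S"
      unfolding carr by auto
    have ab: "a \<oplus>\<^bsub>S\<^esub> b \<in> carrier S" using a b by simp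
    have "tensor_push (\<lambda>x. (a \<oplus>\<^bsub>S\<^esub> b) \<otimes>\<^bsub>S\<^esub> x) c
        - (tensor_push (\<lambda>x. a \<otimes>\<^bsub>S\<^esub> x) c + tensor_push (\<lambda>x. b \<otimes>\<^bsub>S\<^esub> x) c) \<in> tensor_kernel R M ?N"
      using c(2)
    proof (induction c rule: frag_induction)
      case zero show ?case using tensor_kernel_closed[OF assms(1) N] by simp
    next
      case (one y)
      obtain m n where y: "y = (m, n)" "m \<in> carrier M" "n \<in> carrier S" using one by auto
      have "frag_of (m, (a \<otimes>\<^bsub>S\<^esub> n) \<oplus>\<^bsub>?N\<^esub> (b \<otimes>\<^bsub>S\<^esub> n)) - frag_of (m, a \<otimes>\<^bsub>S\<^esub> n) - frag_of (m, b \<otimes>\<^bsub>S\<^esub> n)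
          \<in> tensor_relations R M ?N"
        using y a b unfolding tensor_relations_def cN by blast
      thus ?case using tensor_kernel_rel y a b
        by (simp add: restrict_scalars_def S.l_distr diff_diff_eq)
    next
      case (diff c d)
      show ?case using tensor_kernel_closed(4)[OF assms(1) N diff] by (simp add: algebra_simps)
    qed
    thus "(a \<oplus>\<^bsub>S\<^esub> b) \<odot>\<^bsub>base_change R M \<phi> S\<^esub> x
       = a \<odot>\<^bsub>base_change R M \<phi> S\<^esub> x \<oplus>\<^bsub>base_change R M \<phi> S\<^esub> b \<odot>\<^bsub>base_change R M \<phi> S\<^esub> x"
      unfolding c(1) sm[OF a] sm[OF b] sm[OF ab] add[OF pk[OF a c(2)] pk[OF b c(2)]]
        tensor_coset_eq_iff[OF assms(1) N] .
  next
    fix a x y assume a: "a \<in> carrier S" and "x \<in> carrier (base_change R M \<phi> S)"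
       "y \<in> carrier (base_change R M \<phi> S)"
    then obtain c d where c: "x = ?K c" "Poly_Mapping.keys c \<subseteq> carrier M \<times> carrier S"
       and d: "y = ?K d" "Poly_Mapping.keys d \<subseteq> carrier M \<times> carrier S"
      unfolding carr by auto
    show "a \<odot>\<^bsub>base_change R M \<phi> S\<^esub> (x \<oplus>\<^bsub>base_change R M \<phi> S\<^esub> y)
       = a \<odot>\<^bsub>base_change R M \<phi> S\<^esub> x \<oplus>\<^bsub>base_change R M \<phi> S\<^esub> a \<odot>\<^bsub>base_change R M \<phi> S\<^esub> y"
      unfolding c(1) d(1) sm[OF a] add[OF c(2) d(2)] add[OF pk[OF a c(2)] pk[OF a d(2)]] by simp
  next
    fix a b x assume a: "a \<in> carrier S" and b: "b \<in> carrier S" and "x \<in> carrier (base_change R M \<phi> S)"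
    then obtain c where c: "x = ?K c" "Poly_Mapping.keys c \<subseteq> carrier M \<times> carrier S"
      unfolding carr by auto
    have ab: "a \<otimes>\<^bsub>S\<^esub> b \<in> carrier S" using a b by simp
    have "tensor_push (\<lambda>x. (a \<otimes>\<^bsub>S\<^esub> b) \<otimes>\<^bsub>S\<^esub> x) c = tensor_push ((\<lambda>x. a \<otimes>\<^bsub>S\<^esub> x) \<circ> (\<lambda>x. b \<otimes>\<^bsub>S\<^esub> x)) c"
      by (rule tensor_push_cong) (use c(2) a b S.m_assoc in auto)
    thus "(a \<otimes>\<^bsub>S\<^esub> b) \<odot>\<^bsub>base_change R M \<phi> S\<^esub> x
       = a \<odot>\<^bsub>base_change R M \<phi> S\<^esub> (b \<odot>\<^bsub>base_change R M \<phi> S\<^esub> x)"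
      unfolding c(1) sm[OF ab] sm[OF b] sm[OF a] by (simp add: tensor_push_comp)
  next
    fix x assume "x \<in> carrier (base_change R M \<phi> S)"
    then obtain c where c: "x = ?K c" "Poly_Mapping.keys c \<subseteq> carrier M \<times> carrier S"
      unfolding carr by auto
    have "tensor_push (\<lambda>x. \<one>\<^bsub>S\<^esub> \<otimes>\<^bsub>S\<^esub> x) c = c"
      by (rule tensor_push_id) (use c(2) in auto)
    thus "\<one>\<^bsub>S\<^esub> \<odot>\<^bsub>base_change R M \<phi> S\<^esub> x = x"
      unfolding c(1) sm[OF S.one_closed] by simp
  qed (rule assms(2))
qed

subsection \<open>Localization and residue fields\<close>

locale mult_subset = cring R for R (structure) and D +
  assumes D_sub: "D \<subseteq> carrier R" and D_one: "\<one> \<in> D"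
    and D_mult: "s \<in> D \<Longrightarrow> s' \<in> D \<Longrightarrow> s \<otimes> s' \<in> D"
begin

lemma D_carr: "s \<in> D \<Longrightarrow> s \<in> carrier R"
  using D_sub by blast

lemma equiv_frac_rel: "equiv (carrier R \<times> D) (frac_rel R D)"
proof (rule equivI)
  show "frac_rel R D \<subseteq> (carrier R \<times> D) \<times> (carrier R \<times> D)"
    by (auto simp: frac_rel_def)
  show "refl_on (carrier R \<times> D) (frac_rel R D)"
    using D_one by (auto simp: frac_rel_def refl_on_def)
  show "sym (frac_rel R D)"
    by (auto simp: frac_rel_def sym_def) metis
  show "trans (frac_rel R D)"
  proof (rule transI; clarify)
    fix r s r' s' r'' s''
    assume "((r, s), (r', s')) \<in> frac_rel R D" "((r', s'), (r'', s'')) \<in> frac_rel R D"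
    then obtain t u where
      *: "r \<in> carrier R" "r' \<in> carrier R" "r'' \<in> carrier R" "s \<in> D" "s' \<in> D" "s'' \<in> D"
      and t: "t \<in> D" "t \<otimes> (s' \<otimes> r) = t \<otimes> (s \<otimes> r')"
      and u: "u \<in> D" "u \<otimes> (s'' \<otimes> r') = u \<otimes> (s' \<otimes> r'')"
      by (auto simp: frac_rel_def)
    note c = *(1-3) *(4-6)[THEN D_carr] t(1)[THEN D_carr] u(1)[THEN D_carr]
    have "(t \<otimes> u \<otimes> s') \<otimes> (s'' \<otimes> r) = (u \<otimes> s'') \<otimes> (t \<otimes> (s' \<otimes> r))"
      using c by (simp add: m_ac)
    also have "\<dots> = (t \<otimes> s) \<otimes> (u \<otimes> (s'' \<otimes> r'))"
      unfolding t(2) using c by (simp add: m_ac)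
    also have "\<dots> = (t \<otimes> u \<otimes> s') \<otimes> (s \<otimes> r'')"
      unfolding u(2) using c by (simp add: m_ac)
    finally show "((r, s), (r'', s'')) \<in> frac_rel R D"
      using * t(1) u(1) D_mult by (auto simp: frac_rel_def)
  qed
qed

lemma frac_eq_iff:
  assumes "r \<in> carrier R" "s \<in> D" "r' \<in> carrier R" "s' \<in> D"
  shows "fraction R D r s = fraction R D r' s' \<longleftrightarrow> (\<exists>t\<in>D. t \<otimes> (s' \<otimes> r) = t \<otimes> (s \<otimes> r'))"
  unfolding fraction_def using assms
  by (subst eq_equiv_class_iff[OF equiv_frac_rel]) (auto simp: frac_rel_def)

lemma mem_frac:
  assumes "r \<in> carrier R" "s \<in> D"
  shows "(r', s') \<in> fraction R D r s \<longleftrightarrow>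
    r' \<in> carrier R \<and> s' \<in> D \<and> (\<exists>t\<in>D. t \<otimes> (s' \<otimes> r) = t \<otimes> (s \<otimes> r'))"
  using assms by (auto simp: fraction_def frac_rel_def)

lemma frac_self: "r \<in> carrier R \<Longrightarrow> s \<in> D \<Longrightarrow> (r, s) \<in> fraction R D r s"
  using D_one by (auto simp: mem_frac)

lemma localization_carrier:
  "carrier (localization R D) = {fraction R D r s | r s. r \<in> carrier R \<and> s \<in> D}"
  by (auto simp: localization_def fraction_def quotient_def)

lemma UN_frac2:
  assumes "r \<in> carrier R" "s \<in> D" "p \<in> carrier R" "v \<in> D"
    and "\<And>r' s' p' v'. (r', s') \<in> fraction R D r s \<Longrightarrow> (p', v') \<in> fraction R D p v \<Longrightarrow> f r' s' p' v' = c"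
  shows "(\<Union>(r, s) \<in> fraction R D r s. \<Union>(r', s') \<in> fraction R D p v. f r s r' s') = c"
proof (rule equalityI; rule subsetI)
  fix x assume "x \<in> c"
  thus "x \<in> (\<Union>(r, s) \<in> fraction R D r s. \<Union>(r', s') \<in> fraction R D p v. f r s r' s')"
    using frac_self[OF assms(1,2)] frac_self[OF assms(3,4)] assms(5)[OF frac_self[OF assms(1,2)] frac_self[OF assms(3,4)]]
    by blast
next
  fix x assume "x \<in> (\<Union>(r, s) \<in> fraction R D r s. \<Union>(r', s') \<in> fraction R D p v. f r s r' s')"
  thus "x \<in> c" using assms(5) by auto
qed

lemma localization_mult:
  assumes "r \<in> carrier R" "s \<in> D" "p \<in> carrier R" "v \<in> D"
  shows "fraction R D r s \<otimes>\<^bsub>localization R D\<^esub> fraction R D p v = fraction R D (r \<otimes> p) (s \<otimes> v)"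
  unfolding localization_def monoid.simps
proof (rule UN_frac2[OF assms])
  fix r' s' p' v' assume "(r', s') \<in> fraction R D r s" "(p', v') \<in> fraction R D p v"
  then obtain t u where
    *: "r' \<in> carrier R" "s' \<in> D" "p' \<in> carrier R" "v' \<in> D"
    and t: "t \<in> D" "t \<otimes> (s' \<otimes> r) = t \<otimes> (s \<otimes> r')"
    and u: "u \<in> D" "u \<otimes> (v' \<otimes> p) = u \<otimes> (v \<otimes> p')"
    using assms by (auto simp: mem_frac)
  note c = assms(1,3) assms(2,4)[THEN D_carr] *(1,3) *(2,4)[THEN D_carr] t(1)[THEN D_carr] u(1)[THEN D_carr]
  have "(t \<otimes> u) \<otimes> ((s' \<otimes> v') \<otimes> (r \<otimes> p)) = (t \<otimes> (s' \<otimes> r)) \<otimes> (u \<otimes> (v' \<otimes> p))"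
    using c by (simp add: m_ac)
  also have "\<dots> = (t \<otimes> u) \<otimes> ((s \<otimes> v) \<otimes> (r' \<otimes> p'))"
    unfolding t(2) u(2) using c by (simp add: m_ac)
  finally show "fraction R D (r' \<otimes> p') (s' \<otimes> v') = fraction R D (r \<otimes> p) (s \<otimes> v)"
    using * assms t(1) u(1) by (subst frac_eq_iff) (metis D_mult m_closed)+
qed

lemma localization_add:
  assumes "r \<in> carrier R" "s \<in> D" "p \<in> carrier R" "v \<in> D"
  shows "fraction R D r s \<oplus>\<^bsub>localization R D\<^esub> fraction R D p v = fraction R D ((v \<otimes> r) \<oplus> (s \<otimes> p)) (s \<otimes> v)"
  unfolding localization_def ring_record_simps
proof (rule UN_frac2[OF assms])
  fix r' s' p' v' assume "(r', s') \<in> fraction R D r s" "(p', v') \<in> fraction R D p v"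
  then obtain t u where
    *: "r' \<in> carrier R" "s' \<in> D" "p' \<in> carrier R" "v' \<in> D"
    and t: "t \<in> D" "t \<otimes> (s' \<otimes> r) = t \<otimes> (s \<otimes> r')"
    and u: "u \<in> D" "u \<otimes> (v' \<otimes> p) = u \<otimes> (v \<otimes> p')"
    using assms by (auto simp: mem_frac)
  note c = assms(1,3) assms(2,4)[THEN D_carr] *(1,3) *(2,4)[THEN D_carr] t(1)[THEN D_carr] u(1)[THEN D_carr]
  have "(t \<otimes> u) \<otimes> ((s' \<otimes> v') \<otimes> ((v \<otimes> r) \<oplus> (s \<otimes> p)))
      = (u \<otimes> v' \<otimes> v) \<otimes> (t \<otimes> (s' \<otimes> r)) \<oplus> (t \<otimes> s' \<otimes> s) \<otimes> (u \<otimes> (v' \<otimes> p))"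
    using c by (simp add: r_distr m_ac)
  also have "\<dots> = (t \<otimes> u) \<otimes> ((s \<otimes> v) \<otimes> ((v' \<otimes> r') \<oplus> (s' \<otimes> p')))"
    unfolding t(2) u(2) using c by (simp add: r_distr m_ac)
  finally show "fraction R D ((v' \<otimes> r') \<oplus> (s' \<otimes> p')) (s' \<otimes> v') = fraction R D ((v \<otimes> r) \<oplus> (s \<otimes> p)) (s \<otimes> v)"
    using * assms t(1) u(1) c D_mult
    by (subst frac_eq_iff) (auto intro!: bexI[of _ "t \<otimes> u"])
qed

lemma localization_zero_one:
  "\<zero>\<^bsub>localization R D\<^esub> = fraction R D \<zero> \<one>" "\<one>\<^bsub>localization R D\<^esub> = fraction R D \<one> \<one>"
  by (simp_all add: localization_def)

lemma fracI:
  assumes "r \<in> carrier R" "s \<in> D" "r' \<in> carrier R" "s' \<in> D" "s' \<otimes> r = s \<otimes> r'"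
  shows "fraction R D r s = fraction R D r' s'"
  using assms D_one by (subst frac_eq_iff) auto

lemma frac_closed: "r \<in> carrier R \<Longrightarrow> s \<in> D \<Longrightarrow> fraction R D r s \<in> carrier (localization R D)"
  by (auto simp: localization_carrier)

lemma localization_cring: "cring (localization R D)"
proof (rule cringI)
  note simps = localization_mult localization_add localization_zero_one D_mult D_carr D_one
  show "abelian_group (localization R D)"
  proof (rule abelian_groupI)
    fix x y assume "x \<in> carrier (localization R D)" "y \<in> carrier (localization R D)"
    thus "x \<oplus>\<^bsub>localization R D\<^esub> y \<in> carrier (localization R D)"
      by (auto simp: localization_carrier simps) (metis D_carr D_mult a_closed m_closed)
  next
    fix x y z assume "x \<in> carrier (localization R D)" "y \<in> carrier (localization R D)"
      "z \<in> carrier (localization R D)"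
    thus "x \<oplus>\<^bsub>localization R D\<^esub> y \<oplus>\<^bsub>localization R D\<^esub> z =
        x \<oplus>\<^bsub>localization R D\<^esub> (y \<oplus>\<^bsub>localization R D\<^esub> z)"
      by (auto simp: localization_carrier simps r_distr m_ac a_ac)
  next
    fix x y assume "x \<in> carrier (localization R D)" "y \<in> carrier (localization R D)"
    thus "x \<oplus>\<^bsub>localization R D\<^esub> y = y \<oplus>\<^bsub>localization R D\<^esub> x"
      by (auto simp: localization_carrier simps m_ac a_ac)
  next
    show "\<zero>\<^bsub>localization R D\<^esub> \<in> carrier (localization R D)"
      by (simp add: simps frac_closed)
  next
    fix x assume "x \<in> carrier (localization R D)"
    thus "\<zero>\<^bsub>localization R D\<^esub> \<oplus>\<^bsub>localization R D\<^esub> x = x"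
      by (auto simp: localization_carrier simps)
  next
    fix x assume "x \<in> carrier (localization R D)"
    then obtain r s where x: "x = fraction R D r s" "r \<in> carrier R" "s \<in> D"
      by (auto simp: localization_carrier)
    have "fraction R D (\<ominus> r) s \<oplus>\<^bsub>localization R D\<^esub> x = fraction R D (s \<otimes> (\<ominus> r \<oplus> r)) (s \<otimes> s)"
      using x by (simp add: simps r_distr)
    also have "\<dots> = fraction R D \<zero> \<one>"
      using x by (intro fracI) (simp_all add: simps l_neg)
    finally show "\<exists>y\<in>carrier (localization R D). y \<oplus>\<^bsub>localization R D\<^esub> x = \<zero>\<^bsub>localization R D\<^esub>"
      using x by (intro bexI[of _ "fraction R D (\<ominus> r) s"]) (simp_all add: simps frac_closed)
  qed
next
  note simps = localization_mult localization_add localization_zero_one D_mult D_carr D_one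
  show "comm_monoid (localization R D)"
  proof (rule comm_monoidI)
    fix x y assume "x \<in> carrier (localization R D)" "y \<in> carrier (localization R D)"
    thus "x \<otimes>\<^bsub>localization R D\<^esub> y \<in> carrier (localization R D)"
      by (auto simp: localization_carrier simps) (metis D_mult m_closed)
  next
    fix x y z assume "x \<in> carrier (localization R D)" "y \<in> carrier (localization R D)"
      "z \<in> carrier (localization R D)"
    thus "x \<otimes>\<^bsub>localization R D\<^esub> y \<otimes>\<^bsub>localization R D\<^esub> z =
        x \<otimes>\<^bsub>localization R D\<^esub> (y \<otimes>\<^bsub>localization R D\<^esub> z)"
      by (auto simp: localization_carrier simps m_ac)
  next
    fix x y assume "x \<in> carrier (localization R D)" "y \<in> carrier (localization R D)"
    thus "x \<otimes>\<^bsub>localization R D\<^esub> y = y \<otimes>\<^bsub>localization R D\<^esub> x"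
      by (auto simp: localization_carrier simps m_ac)
  next
    show "\<one>\<^bsub>localization R D\<^esub> \<in> carrier (localization R D)"
      by (simp add: simps frac_closed)
  next
    fix x assume "x \<in> carrier (localization R D)"
    thus "\<one>\<^bsub>localization R D\<^esub> \<otimes>\<^bsub>localization R D\<^esub> x = x"
      by (auto simp: localization_carrier simps)
  qed
next
  note simps = localization_mult localization_add localization_zero_one D_mult D_carr D_one
  fix x y z assume "x \<in> carrier (localization R D)" "y \<in> carrier (localization R D)"
      "z \<in> carrier (localization R D)"
  then obtain r s p v q w where
    x: "x = fraction R D r s" "r \<in> carrier R" "s \<in> D" and
    y: "y = fraction R D p v" "p \<in> carrier R" "v \<in> D" and
    z: "z = fraction R D q w" "q \<in> carrier R" "w \<in> D"
    by (auto simp: localization_carrier)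
  show "(x \<oplus>\<^bsub>localization R D\<^esub> y) \<otimes>\<^bsub>localization R D\<^esub> z =
     x \<otimes>\<^bsub>localization R D\<^esub> z \<oplus>\<^bsub>localization R D\<^esub> y \<otimes>\<^bsub>localization R D\<^esub> z"
    unfolding x(1) y(1) z(1) using x(2,3) y(2,3) z(2,3)
    by (simp add: simps, intro fracI) (simp_all add: simps r_distr l_distr m_ac)
qed

lemma localization_hom: "(\<lambda>r. fraction R D r \<one>) \<in> ring_hom R (localization R D)"
  by (rule ring_hom_memI)
     (auto simp: localization_mult localization_add localization_zero_one D_one frac_closed)

end

lemma mult_subset_prime:
  assumes "primeideal p R"
  shows "mult_subset R (carrier R - p)"
proof -
  interpret primeideal p R by fact
  show ?thesis
    by unfold_locales (use I_prime I_notcarr one_imp_carrier in auto)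
qed

lemma extended_ideal_ideal:
  assumes "primeideal p R"
  shows "ideal (extended_ideal R p) (localization_at R p)"
proof -
  interpret mult_subset R "carrier R - p" by (rule mult_subset_prime[OF assms])
  interpret L: cring "localization_at R p"
    unfolding localization_at_def by (rule localization_cring)
  interpret p: primeideal p R by fact
  show ?thesis
    unfolding extended_ideal_def
    by (rule L.genideal_ideal)
      (use p.a_subset D_one in \<open>auto simp: localization_at_def intro!: frac_closed\<close>)
qed

lemma residue_field_cring:
  assumes "primeideal p R"
  shows "cring (residue_field R p)"
proof -
  interpret mult_subset R "carrier R - p" by (rule mult_subset_prime[OF assms])
  interpret L: cring "localization_at R p"
    unfolding localization_at_def by (rule localization_cring)
  show ?thesis
    unfolding residue_field_def
    by (intro ideal.quotient_is_cring extended_ideal_ideal[OF assms] L.is_cring)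
qed

lemma residue_field_field:
  assumes "primeideal p R"
  shows "field (residue_field R p)"
proof -
  interpret mult_subset R "carrier R - p" by (rule mult_subset_prime[OF assms])
  interpret p: primeideal p R by fact
  interpret L: cring "localization_at R p"
    unfolding localization_at_def by (rule localization_cring)
  let ?D = "carrier R - p"
  note defs = localization_at_def
  note Lc = localization_carrier[folded defs] and Lm = localization_mult[folded defs]
    and La = localization_add[folded defs] and L01 = localization_zero_one[folded defs]
    and Lcl = frac_closed[folded defs]
  interpret I: ideal "extended_ideal R p" "localization_at R p"
    by (rule extended_ideal_ideal[OF assms])
  have p_carr: "r \<in> carrier R" if "r \<in> p" for r using p.a_subset that by blast
  let ?J = "{fraction R ?D r s | r s. r \<in> p \<and> s \<in> ?D}"
  have J: "ideal ?J (localization_at R p)"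
  proof (rule idealI[OF L.ring_axioms])
    show "subgroup ?J (add_monoid (localization_at R p))"
    proof (rule L.add.subgroupI)
      show "?J \<subseteq> carrier (localization_at R p)" by (auto simp: Lc dest: p_carr)
      show "?J \<noteq> {}" using D_one p.zero_closed by blast
    next
      fix x assume "x \<in> ?J"
      then obtain r s where x: "x = fraction R ?D r s" "r \<in> p" "s \<in> ?D" by blast
      have c: "r \<in> carrier R" "s \<in> carrier R" "\<ominus>\<^bsub>R\<^esub> r \<in> p"
        using x p_carr p.a_inv_closed by auto
      have "fraction R ?D (\<ominus>\<^bsub>R\<^esub> r) s \<oplus>\<^bsub>localization_at R p\<^esub> x = fraction R ?D (s \<otimes>\<^bsub>R\<^esub> (\<ominus>\<^bsub>R\<^esub> r \<oplus>\<^bsub>R\<^esub> r)) (s \<otimes>\<^bsub>R\<^esub> s)"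
        unfolding x(1) using x c by (subst La) (simp_all add: r_distr)
      also have "\<dots> = \<zero>\<^bsub>localization_at R p\<^esub>"
        unfolding L01 using x c D_one D_mult[OF x(3,3)] by (intro fracI) (simp_all add: l_neg)
      finally have "\<ominus>\<^bsub>localization_at R p\<^esub> x = fraction R ?D (\<ominus>\<^bsub>R\<^esub> r) s"
        by (intro L.minus_equality) (use x c in \<open>auto intro!: Lcl\<close>)
      thus "\<ominus>\<^bsub>localization_at R p\<^esub> x \<in> ?J" using x(3) c(3) by blast
    next
      fix x y assume "x \<in> ?J" "y \<in> ?J"
      then obtain r s q t where x: "x = fraction R ?D r s" "r \<in> p" "s \<in> ?D"
        and y: "y = fraction R ?D q t" "q \<in> p" "t \<in> ?D" by blast
      have "t \<otimes>\<^bsub>R\<^esub> r \<oplus>\<^bsub>R\<^esub> s \<otimes>\<^bsub>R\<^esub> q \<in> p"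
        using x y by (intro p.a_closed p.I_l_closed) auto
      moreover have "x \<oplus>\<^bsub>localization_at R p\<^esub> y
          = fraction R ?D (t \<otimes>\<^bsub>R\<^esub> r \<oplus>\<^bsub>R\<^esub> s \<otimes>\<^bsub>R\<^esub> q) (s \<otimes>\<^bsub>R\<^esub> t)"
        unfolding x(1) y(1) using x y p_carr by (intro La) auto
      ultimately show "x \<oplus>\<^bsub>localization_at R p\<^esub> y \<in> ?J"
        using D_mult[OF x(3) y(3)] by auto
    qed
  next
    fix x y assume "x \<in> ?J" "y \<in> carrier (localization_at R p)"
    then obtain r s q t where x: "x = fraction R ?D r s" "r \<in> p" "s \<in> ?D"
      and y: "y = fraction R ?D q t" "q \<in> carrier R" "t \<in> ?D" by (auto simp: Lc)
    have "y \<otimes>\<^bsub>localization_at R p\<^esub> x = fraction R ?D (q \<otimes>\<^bsub>R\<^esub> r) (t \<otimes>\<^bsub>R\<^esub> s)"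
      unfolding x(1) y(1) using x y p_carr by (intro Lm) auto
    moreover have "q \<otimes>\<^bsub>R\<^esub> r \<in> p" using x y by (intro p.I_l_closed) auto
    ultimately show yx: "y \<otimes>\<^bsub>localization_at R p\<^esub> x \<in> ?J" using D_mult[OF y(3) x(3)] by auto
    have "x \<in> carrier (localization_at R p)" using x p_carr by (auto intro!: Lcl)
    thus "x \<otimes>\<^bsub>localization_at R p\<^esub> y \<in> ?J"
      using yx L.m_comm[OF \<open>y \<in> carrier (localization_at R p)\<close>, of x] by simp
  qed
  have sub: "extended_ideal R p \<subseteq> ?J"
    unfolding extended_ideal_def by (rule L.genideal_minimal[OF J]) (use D_one in auto)
  have gen: "fraction R ?D r \<one>\<^bsub>R\<^esub> \<in> extended_ideal R p" if "r \<in> p" for r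
  proof -
    have "(\<lambda>r. fraction R ?D r \<one>\<^bsub>R\<^esub>) ` p \<subseteq> carrier (localization_at R p)"
    proof
      fix x assume "x \<in> (\<lambda>r. fraction R ?D r \<one>\<^bsub>R\<^esub>) ` p"
      then obtain r where "x = fraction R ?D r \<one>\<^bsub>R\<^esub>" "r \<in> p" by blast
      thus "x \<in> carrier (localization_at R p)" using Lcl[OF p_carr D_one] by simp
    qed
    from L.genideal_self[OF this] that show ?thesis unfolding extended_ideal_def by blast
  qed
  have mem: "fraction R ?D r s \<in> extended_ideal R p" if "r \<in> p" "s \<in> ?D" for r s
  proof -
    have "fraction R ?D \<one>\<^bsub>R\<^esub> s \<otimes>\<^bsub>localization_at R p\<^esub> fraction R ?D r \<one>\<^bsub>R\<^esub> \<in> extended_ideal R p"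
      by (rule I.I_l_closed[OF gen[OF that(1)]]) (use that in \<open>auto intro!: Lcl\<close>)
    also have "fraction R ?D \<one>\<^bsub>R\<^esub> s \<otimes>\<^bsub>localization_at R p\<^esub> fraction R ?D r \<one>\<^bsub>R\<^esub> = fraction R ?D r s"
      using that p_carr[OF that(1)] D_one by (subst Lm) auto
    finally show ?thesis .
  qed
  have "maximalideal (extended_ideal R p) (localization_at R p)"
  proof (rule maximalidealI[OF I.ideal_axioms])
    show "carrier (localization_at R p) \<noteq> extended_ideal R p"
    proof
      assume "carrier (localization_at R p) = extended_ideal R p"
      hence "\<one>\<^bsub>localization_at R p\<^esub> \<in> ?J" using sub L.one_closed by blast
      then obtain r s where rs: "fraction R ?D \<one>\<^bsub>R\<^esub> \<one>\<^bsub>R\<^esub> = fraction R ?D r s" "r \<in> p" "s \<in> ?D"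
        by (auto simp: L01)
      then obtain t where t: "t \<in> ?D" "t \<otimes>\<^bsub>R\<^esub> (s \<otimes>\<^bsub>R\<^esub> \<one>\<^bsub>R\<^esub>) = t \<otimes>\<^bsub>R\<^esub> (\<one>\<^bsub>R\<^esub> \<otimes>\<^bsub>R\<^esub> r)"
        using D_one p_carr by (subst (asm) frac_eq_iff) auto
      hence "t \<otimes>\<^bsub>R\<^esub> s = t \<otimes>\<^bsub>R\<^esub> r" using rs p_carr by simp
      moreover have "t \<otimes>\<^bsub>R\<^esub> r \<in> p" using t rs by (intro p.I_l_closed) auto
      ultimately show False using D_mult[OF t(1) rs(3)] by auto
    qed
  next
    fix J' assume J': "ideal J' (localization_at R p)" "extended_ideal R p \<subseteq> J'"
      "J' \<subseteq> carrier (localization_at R p)"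
    show "J' = extended_ideal R p \<or> J' = carrier (localization_at R p)"
    proof (cases "J' \<subseteq> extended_ideal R p")
      case False
      then obtain x where x: "x \<in> J'" "x \<notin> extended_ideal R p" by blast
      then obtain r s where rs: "x = fraction R ?D r s" "r \<in> carrier R" "s \<in> ?D"
        using J'(3) by (auto simp: Lc)
      have r: "r \<in> ?D" using mem[of r s] rs x by auto
      have "fraction R ?D s r \<otimes>\<^bsub>localization_at R p\<^esub> x \<in> J'"
        by (rule ideal.I_l_closed[OF J'(1) x(1)]) (use rs r in \<open>auto intro!: Lcl\<close>)
      also have "fraction R ?D s r \<otimes>\<^bsub>localization_at R p\<^esub> x = fraction R ?D (s \<otimes>\<^bsub>R\<^esub> r) (r \<otimes>\<^bsub>R\<^esub> s)"
        unfolding rs(1) using rs r by (intro Lm) auto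
      also have "\<dots> = \<one>\<^bsub>localization_at R p\<^esub>"
        unfolding L01 using rs r D_one D_mult[OF r rs(3)] by (intro fracI) (auto simp: m_comm)
      finally show ?thesis using ideal.one_imp_carrier[OF J'(1)] by simp
    qed (use J'(2) in blast)
  qed
  thus ?thesis
    unfolding residue_field_def by (intro maximalideal.quotient_is_field L.is_cring)
qed

lemma residue_map_hom:
  assumes "primeideal p R"
  shows "residue_map R p \<in> ring_hom R (residue_field R p)"
proof -
  interpret mult_subset R "carrier R - p" by (rule mult_subset_prime[OF assms])
  have "(\<lambda>x. extended_ideal R p +>\<^bsub>localization_at R p\<^esub> x) \<circ> (\<lambda>r. fraction R (carrier R - p) r \<one>\<^bsub>R\<^esub>)
     \<in> ring_hom R (residue_field R p)"
    unfolding residue_field_def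
    by (rule ring_hom_trans[OF localization_hom[folded localization_at_def]
        ideal.rcos_ring_hom[OF extended_ideal_ideal[OF assms]]])
  moreover have "residue_map R p = (\<lambda>x. extended_ideal R p +>\<^bsub>localization_at R p\<^esub> x) \<circ> (\<lambda>r. fraction R (carrier R - p) r \<one>\<^bsub>R\<^esub>)"
    by (auto simp: residue_map_def)
  ultimately show ?thesis by simp
qed

lemma product_ring_cring:
  assumes "\<And>i. i \<in> I \<Longrightarrow> cring (A i)"
  shows "cring (product_ring I A)"
proof -
  note c = cring.axioms(1)[OF assms]
  note simps = product_ring_def PiE_iff
  show ?thesis
  proof (rule cringI)
    show "abelian_group (product_ring I A)"
    proof (rule abelian_groupI)
      fix x assume x: "x \<in> carrier (product_ring I A)"
      show "\<exists>y\<in>carrier (product_ring I A). y \<oplus>\<^bsub>product_ring I A\<^esub> x = \<zero>\<^bsub>product_ring I A\<^esub>"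
        using x c by (intro bexI[of _ "\<lambda>i\<in>I. \<ominus>\<^bsub>A i\<^esub> x i"])
          (auto simp: simps abelian_group.l_neg ring.is_abelian_group abelian_group.a_inv_closed
             intro!: restrict_ext)
    next
      fix x y assume x: "x \<in> carrier (product_ring I A)" "y \<in> carrier (product_ring I A)"
      show "x \<oplus>\<^bsub>product_ring I A\<^esub> y = y \<oplus>\<^bsub>product_ring I A\<^esub> x"
        using x c by (auto simp: simps intro!: restrict_ext abelian_monoid.a_comm
            abelian_group.axioms(1)[OF ring.is_abelian_group])
    next
      fix x y z assume x: "x \<in> carrier (product_ring I A)" "y \<in> carrier (product_ring I A)"
        "z \<in> carrier (product_ring I A)"
      show "x \<oplus>\<^bsub>product_ring I A\<^esub> y \<oplus>\<^bsub>product_ring I A\<^esub> z =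
         x \<oplus>\<^bsub>product_ring I A\<^esub> (y \<oplus>\<^bsub>product_ring I A\<^esub> z)"
        using x c by (auto simp: simps intro!: restrict_ext abelian_monoid.a_assoc
            abelian_group.axioms(1)[OF ring.is_abelian_group])
    next
      fix x assume x: "x \<in> carrier (product_ring I A)"
      show "\<zero>\<^bsub>product_ring I A\<^esub> \<oplus>\<^bsub>product_ring I A\<^esub> x = x"
        using x c by (intro ext) (auto simp: simps extensional_def abelian_monoid.l_zero
            abelian_group.axioms(1)[OF ring.is_abelian_group])
    qed (use c in \<open>auto simp: simps ring.ring_simprules\<close>)
    show "comm_monoid (product_ring I A)"
    proof (rule comm_monoidI)
      fix x y assume x: "x \<in> carrier (product_ring I A)" "y \<in> carrier (product_ring I A)"
      show "x \<otimes>\<^bsub>product_ring I A\<^esub> y = y \<otimes>\<^bsub>product_ring I A\<^esub> x"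
        using x assms by (auto simp: simps intro!: restrict_ext cring.cring_simprules(14))
    next
      fix x y z assume x: "x \<in> carrier (product_ring I A)" "y \<in> carrier (product_ring I A)"
        "z \<in> carrier (product_ring I A)"
      show "x \<otimes>\<^bsub>product_ring I A\<^esub> y \<otimes>\<^bsub>product_ring I A\<^esub> z =
         x \<otimes>\<^bsub>product_ring I A\<^esub> (y \<otimes>\<^bsub>product_ring I A\<^esub> z)"
        using x c by (auto simp: simps intro!: restrict_ext monoid.m_assoc ring.is_monoid)
    next
      fix x assume x: "x \<in> carrier (product_ring I A)"
      show "\<one>\<^bsub>product_ring I A\<^esub> \<otimes>\<^bsub>product_ring I A\<^esub> x = x"
        using x c by (intro ext) (auto simp: simps extensional_def ring.ring_simprules)
    qed (use c in \<open>auto simp: simps ring.ring_simprules\<close>)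
  next
    fix x y z assume x: "x \<in> carrier (product_ring I A)" "y \<in> carrier (product_ring I A)"
        "z \<in> carrier (product_ring I A)"
    show "(x \<oplus>\<^bsub>product_ring I A\<^esub> y) \<otimes>\<^bsub>product_ring I A\<^esub> z =
        x \<otimes>\<^bsub>product_ring I A\<^esub> z \<oplus>\<^bsub>product_ring I A\<^esub> y \<otimes>\<^bsub>product_ring I A\<^esub> z"
      using x c by (auto simp: simps intro!: restrict_ext ring.ring_simprules)
  qed
qed

lemma residue_product_cring:
  assumes "X \<subseteq> Spec R"
  shows "cring (residue_product R X)"
  unfolding residue_product_def
  by (rule product_ring_cring) (use assms in \<open>auto simp: Spec_def intro: residue_field_cring\<close>)

lemma residue_product_map_hom:
  assumes "X \<subseteq> Spec R"
  shows "residue_product_map R X \<in> ring_hom R (residue_product R X)"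
proof -
  have h: "residue_map R p \<in> ring_hom R (residue_field R p)" if "p \<in> X" for p
    using that assms by (intro residue_map_hom) (auto simp: Spec_def)
  show ?thesis
    by (rule ring_hom_memI)
      (auto simp: residue_product_map_def residue_product_def product_ring_def
        ring_hom_closed[OF h] ring_hom_mult[OF h] ring_hom_add[OF h] ring_hom_one[OF h] intro!: restrict_ext)
qed

lemma module_base_change_residue_product:
  assumes "module R M" "X \<subseteq> Spec R"
  shows "module (residue_product R X) (base_change R M (residue_product_map R X) (residue_product R X))"
  by (intro module_base_change residue_product_cring residue_product_map_hom assms)


subsection \<open>Projectivity\<close>

lemma module_hom_zero:
  assumes "module R M" "module R N" "f \<in> module_hom R M N"
  shows "f \<zero>\<^bsub>M\<^esub> = \<zero>\<^bsub>N\<^esub>"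
proof -
  interpret M: module R M by fact
  interpret N: module R N by fact
  have "f (\<zero>\<^bsub>R\<^esub> \<odot>\<^bsub>M\<^esub> \<zero>\<^bsub>M\<^esub>) = \<zero>\<^bsub>R\<^esub> \<odot>\<^bsub>N\<^esub> f \<zero>\<^bsub>M\<^esub>"
    by (rule module_homD(3)[OF assms(3)]) auto
  thus ?thesis using module_homD(1)[OF assms(3), of "\<zero>\<^bsub>M\<^esub>"] by simp
qed

lemma module_hom_finsum:
  assumes "module R M" "module R N" "f \<in> module_hom R M N" "finite T" "\<phi> \<in> T \<rightarrow> carrier M"
  shows "f (\<Oplus>\<^bsub>M\<^esub>x\<in>T. \<phi> x) = (\<Oplus>\<^bsub>N\<^esub>x\<in>T. f (\<phi> x))"
  using assms(4,5)
proof (induction rule: finite_induct)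
  interpret M: module R M by fact
  interpret N: module R N by fact
  case empty show ?case using module_hom_zero[OF assms(1-3)] by simp
next
  interpret M: module R M by fact
  interpret N: module R N by fact
  case (insert x T)
  hence "\<phi> \<in> T \<rightarrow> carrier M" "\<phi> x \<in> carrier M" by auto
  moreover from this have "(\<lambda>x. f (\<phi> x)) \<in> T \<rightarrow> carrier N" "f (\<phi> x) \<in> carrier N"
    using module_homD(1)[OF assms(3)] by auto
  ultimately show ?case using insert
    by (simp add: M.finsum_closed module_homD(2)[OF assms(3)])
qed

definition free_module :: "('s, 'x) ring_scheme \<Rightarrow> 'p set \<Rightarrow> ('s, 'p \<Rightarrow> 's) module"
  where "free_module S I =
    \<lparr>carrier = {c. (\<forall>x\<in>I. c x \<in> carrier S) \<and> (\<forall>x. x \<notin> I \<longrightarrow> c x = \<zero>\<^bsub>S\<^esub>) \<and> finite {x. c x \<noteq> \<zero>\<^bsub>S\<^esub>}},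
     monoid.mult = undefined, one = undefined,
     ring.zero = (\<lambda>_. \<zero>\<^bsub>S\<^esub>),
     add = (\<lambda>c d x. c x \<oplus>\<^bsub>S\<^esub> d x),
     smult = (\<lambda>s c x. s \<otimes>\<^bsub>S\<^esub> c x)\<rparr>"

definition linear_extension ::
    "('s, 'x) ring_scheme \<Rightarrow> ('s, 'm, 'y) module_scheme \<Rightarrow> ('p \<Rightarrow> 'm) \<Rightarrow> ('p \<Rightarrow> 's) \<Rightarrow> 'm"
  where "linear_extension S A \<phi> c = (\<Oplus>\<^bsub>A\<^esub>x\<in>{x. c x \<noteq> \<zero>\<^bsub>S\<^esub>}. c x \<odot>\<^bsub>A\<^esub> \<phi> x)"

lemma free_module_carrierD:
  assumes "cring S" "c \<in> carrier (free_module S I)"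
  shows "c x \<in> carrier S" "finite {x. c x \<noteq> \<zero>\<^bsub>S\<^esub>}" "{x. c x \<noteq> \<zero>\<^bsub>S\<^esub>} \<subseteq> I"
proof -
  interpret cring S by fact
  show "c x \<in> carrier S" using assms(2) by (cases "x \<in> I") (auto simp: free_module_def)
qed (use assms in \<open>auto simp: free_module_def\<close>)

lemma module_free_module:
  assumes "cring S"
  shows "module S (free_module S I)"
proof -
  interpret S: cring S by fact
  note carr = free_module_carrierD(1)[OF assms]
  show ?thesis
  proof (rule moduleI)
    show "abelian_group (free_module S I)"
    proof (rule abelian_groupI)
      fix x y assume "x \<in> carrier (free_module S I)" "y \<in> carrier (free_module S I)"
      moreover from this have "finite {i. x i \<oplus>\<^bsub>S\<^esub> y i \<noteq> \<zero>\<^bsub>S\<^esub>}"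
        by (intro finite_subset[OF _ finite_UnI[OF free_module_carrierD(2)[OF assms, of x I]
                free_module_carrierD(2)[OF assms, of y I]]]) auto
      ultimately show "x \<oplus>\<^bsub>free_module S I\<^esub> y \<in> carrier (free_module S I)"
        by (simp add: free_module_def)
    next
      fix x y assume "x \<in> carrier (free_module S I)" "y \<in> carrier (free_module S I)"
      thus "x \<oplus>\<^bsub>free_module S I\<^esub> y = y \<oplus>\<^bsub>free_module S I\<^esub> x"
        using carr[of x I] carr[of y I] by (simp add: free_module_def S.a_comm)
    next
      fix x y z assume "x \<in> carrier (free_module S I)" "y \<in> carrier (free_module S I)"
        "z \<in> carrier (free_module S I)"
      thus "x \<oplus>\<^bsub>free_module S I\<^esub> y \<oplus>\<^bsub>free_module S I\<^esub> z
          = x \<oplus>\<^bsub>free_module S I\<^esub> (y \<oplus>\<^bsub>free_module S I\<^esub> z)"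
        using carr[of x I] carr[of y I] carr[of z I] by (simp add: free_module_def S.a_assoc)
    next
      fix x assume "x \<in> carrier (free_module S I)"
      thus "\<zero>\<^bsub>free_module S I\<^esub> \<oplus>\<^bsub>free_module S I\<^esub> x = x"
        using carr[of x I] by (simp add: free_module_def)
    next
      fix x assume x: "x \<in> carrier (free_module S I)"
      have "\<ominus>\<^bsub>S\<^esub> x i \<noteq> \<zero>\<^bsub>S\<^esub> \<longleftrightarrow> x i \<noteq> \<zero>\<^bsub>S\<^esub>" for i
        using carr[OF x, of i] by simp
      hence "finite {i. \<ominus>\<^bsub>S\<^esub> x i \<noteq> \<zero>\<^bsub>S\<^esub>}"
        using free_module_carrierD(2)[OF assms x] by simp
      hence "(\<lambda>i. \<ominus>\<^bsub>S\<^esub> x i) \<in> carrier (free_module S I)"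
        using x by (simp add: free_module_def)
      moreover have "(\<lambda>i. \<ominus>\<^bsub>S\<^esub> x i) \<oplus>\<^bsub>free_module S I\<^esub> x = \<zero>\<^bsub>free_module S I\<^esub>"
        using carr[OF x] by (simp add: free_module_def S.l_neg)
      ultimately show "\<exists>y\<in>carrier (free_module S I). y \<oplus>\<^bsub>free_module S I\<^esub> x = \<zero>\<^bsub>free_module S I\<^esub>"
        by blast
    qed (simp add: free_module_def)
  next
    fix a x assume a: "a \<in> carrier S" and x: "x \<in> carrier (free_module S I)"
    have "finite {i. a \<otimes>\<^bsub>S\<^esub> x i \<noteq> \<zero>\<^bsub>S\<^esub>}"
      using a by (intro finite_subset[OF _ free_module_carrierD(2)[OF assms x]]) auto
    thus "a \<odot>\<^bsub>free_module S I\<^esub> x \<in> carrier (free_module S I)"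
      using a x by (simp add: free_module_def)
  next
    fix a b x assume "a \<in> carrier S" "b \<in> carrier S" and x: "x \<in> carrier (free_module S I)"
    thus "(a \<oplus>\<^bsub>S\<^esub> b) \<odot>\<^bsub>free_module S I\<^esub> x
       = a \<odot>\<^bsub>free_module S I\<^esub> x \<oplus>\<^bsub>free_module S I\<^esub> b \<odot>\<^bsub>free_module S I\<^esub> x"
      using carr[OF x] by (simp add: free_module_def S.l_distr)
  next
    fix a x y assume "a \<in> carrier S" and x: "x \<in> carrier (free_module S I)" "y \<in> carrier (free_module S I)"
    thus "a \<odot>\<^bsub>free_module S I\<^esub> (x \<oplus>\<^bsub>free_module S I\<^esub> y)
       = a \<odot>\<^bsub>free_module S I\<^esub> x \<oplus>\<^bsub>free_module S I\<^esub> a \<odot>\<^bsub>free_module S I\<^esub> y"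
      using carr[OF x(1)] carr[OF x(2)] by (simp add: free_module_def S.r_distr)
  next
    fix a b x assume "a \<in> carrier S" "b \<in> carrier S" and x: "x \<in> carrier (free_module S I)"
    thus "(a \<otimes>\<^bsub>S\<^esub> b) \<odot>\<^bsub>free_module S I\<^esub> x = a \<odot>\<^bsub>free_module S I\<^esub> (b \<odot>\<^bsub>free_module S I\<^esub> x)"
      using carr[OF x] by (simp add: free_module_def S.m_assoc)
  next
    fix x assume x: "x \<in> carrier (free_module S I)"
    thus "\<one>\<^bsub>S\<^esub> \<odot>\<^bsub>free_module S I\<^esub> x = x"
      using carr[OF x] by (simp add: free_module_def)
  qed (rule assms)
qed

lemma linear_extension_eq:
  assumes "module S A" "\<phi> \<in> I \<rightarrow> carrier A" "c \<in> carrier (free_module S I)"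
    and "finite T" "T \<subseteq> I" "{x. c x \<noteq> \<zero>\<^bsub>S\<^esub>} \<subseteq> T"
  shows "linear_extension S A \<phi> c = (\<Oplus>\<^bsub>A\<^esub>x\<in>T. c x \<odot>\<^bsub>A\<^esub> \<phi> x)"
proof -
  interpret A: module S A by fact
  note carr = free_module_carrierD(1)[OF A.is_cring assms(3)]
  show ?thesis
    unfolding linear_extension_def
    by (rule A.M.add.finprod_mono_neutral_cong_left[OF assms(4,6)])
       (use assms(2,5) carr in \<open>auto simp: Pi_iff subset_iff\<close>)
qed

lemma linear_extension_hom:
  assumes "module S A" "\<phi> \<in> I \<rightarrow> carrier A"
  shows "linear_extension S A \<phi> \<in> module_hom S (free_module S I) A"
proof -
  interpret A: module S A by fact
  interpret F: module S "free_module S I" by (rule module_free_module[OF A.is_cring])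
  note fD = free_module_carrierD[OF A.is_cring]
  note carr = fD(1)
  have cl: "(\<lambda>x. c x \<odot>\<^bsub>A\<^esub> \<phi> x) \<in> T \<rightarrow> carrier A" if "c \<in> carrier (free_module S I)" "T \<subseteq> I" for c T
    using carr[OF that(1)] that(2) assms(2) by auto
  show ?thesis
  proof (rule module_homI)
    fix c assume c: "c \<in> carrier (free_module S I)"
    show "linear_extension S A \<phi> c \<in> carrier A"
      unfolding linear_extension_def by (rule A.finsum_closed[OF cl[OF c fD(3)[OF c]]])
  next
    fix c d assume c: "c \<in> carrier (free_module S I)" and d: "d \<in> carrier (free_module S I)"
    let ?T = "{x. c x \<noteq> \<zero>\<^bsub>S\<^esub>} \<union> {x. d x \<noteq> \<zero>\<^bsub>S\<^esub>}"
    have T: "finite ?T" "?T \<subseteq> I" using fD(2,3)[OF c] fD(2,3)[OF d] by auto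
    have cd: "c \<oplus>\<^bsub>free_module S I\<^esub> d \<in> carrier (free_module S I)" using c d by simp
    have cd': "(c \<oplus>\<^bsub>free_module S I\<^esub> d) x = c x \<oplus>\<^bsub>S\<^esub> d x" for x by (simp add: free_module_def)
    have "linear_extension S A \<phi> (c \<oplus>\<^bsub>free_module S I\<^esub> d)
        = (\<Oplus>\<^bsub>A\<^esub>x\<in>?T. (c \<oplus>\<^bsub>free_module S I\<^esub> d) x \<odot>\<^bsub>A\<^esub> \<phi> x)"
      by (rule linear_extension_eq[OF assms cd T]) (auto simp: cd')
    also have "\<dots> = (\<Oplus>\<^bsub>A\<^esub>x\<in>?T. c x \<odot>\<^bsub>A\<^esub> \<phi> x \<oplus>\<^bsub>A\<^esub> d x \<odot>\<^bsub>A\<^esub> \<phi> x)"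
    proof (rule A.M.finsum_cong'[OF refl])
      show "(\<lambda>x. c x \<odot>\<^bsub>A\<^esub> \<phi> x \<oplus>\<^bsub>A\<^esub> d x \<odot>\<^bsub>A\<^esub> \<phi> x) \<in> ?T \<rightarrow> carrier A"
        using cl[OF c T(2)] cl[OF d T(2)] by auto
    next
      fix x assume "x \<in> ?T"
      hence "\<phi> x \<in> carrier A" using T(2) assms(2) by auto
      thus "(c \<oplus>\<^bsub>free_module S I\<^esub> d) x \<odot>\<^bsub>A\<^esub> \<phi> x = c x \<odot>\<^bsub>A\<^esub> \<phi> x \<oplus>\<^bsub>A\<^esub> d x \<odot>\<^bsub>A\<^esub> \<phi> x"
        using carr[OF c] carr[OF d] by (simp add: cd' A.smult_l_distr)
    qed
    also have "\<dots> = (\<Oplus>\<^bsub>A\<^esub>x\<in>?T. c x \<odot>\<^bsub>A\<^esub> \<phi> x) \<oplus>\<^bsub>A\<^esub> (\<Oplus>\<^bsub>A\<^esub>x\<in>?T. d x \<odot>\<^bsub>A\<^esub> \<phi> x)"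
      by (rule A.finsum_addf[OF cl[OF c T(2)] cl[OF d T(2)]])
    also have "\<dots> = linear_extension S A \<phi> c \<oplus>\<^bsub>A\<^esub> linear_extension S A \<phi> d"
      using linear_extension_eq[OF assms c T] linear_extension_eq[OF assms d T] by simp
    finally show "linear_extension S A \<phi> (c \<oplus>\<^bsub>free_module S I\<^esub> d)
        = linear_extension S A \<phi> c \<oplus>\<^bsub>A\<^esub> linear_extension S A \<phi> d" .
  next
    fix s c assume s: "s \<in> carrier S" and c: "c \<in> carrier (free_module S I)"
    let ?T = "{x. c x \<noteq> \<zero>\<^bsub>S\<^esub>}"
    have T: "finite ?T" "?T \<subseteq> I" using fD(2,3)[OF c] by auto
    have sc: "s \<odot>\<^bsub>free_module S I\<^esub> c \<in> carrier (free_module S I)" using s c by simp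
    have sc': "(s \<odot>\<^bsub>free_module S I\<^esub> c) x = s \<otimes>\<^bsub>S\<^esub> c x" for x by (simp add: free_module_def)
    have "linear_extension S A \<phi> (s \<odot>\<^bsub>free_module S I\<^esub> c)
        = (\<Oplus>\<^bsub>A\<^esub>x\<in>?T. (s \<odot>\<^bsub>free_module S I\<^esub> c) x \<odot>\<^bsub>A\<^esub> \<phi> x)"
      by (rule linear_extension_eq[OF assms sc T]) (use s in \<open>auto simp: sc'\<close>)
    also have "\<dots> = (\<Oplus>\<^bsub>A\<^esub>x\<in>?T. s \<odot>\<^bsub>A\<^esub> (c x \<odot>\<^bsub>A\<^esub> \<phi> x))"
    proof (rule A.M.finsum_cong'[OF refl])
      show "(\<lambda>x. s \<odot>\<^bsub>A\<^esub> (c x \<odot>\<^bsub>A\<^esub> \<phi> x)) \<in> ?T \<rightarrow> carrier A"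
        using cl[OF c T(2)] s by auto
    next
      fix x assume "x \<in> ?T"
      hence "\<phi> x \<in> carrier A" using T(2) assms(2) by auto
      thus "(s \<odot>\<^bsub>free_module S I\<^esub> c) x \<odot>\<^bsub>A\<^esub> \<phi> x = s \<odot>\<^bsub>A\<^esub> (c x \<odot>\<^bsub>A\<^esub> \<phi> x)"
        using carr[OF c] s by (simp add: sc' A.smult_assoc1)
    qed
    also have "\<dots> = s \<odot>\<^bsub>A\<^esub> linear_extension S A \<phi> c"
      unfolding linear_extension_def
      using A.finsum_smult_ldistr[OF T(1) s cl[OF c T(2)]] by simp
    finally show "linear_extension S A \<phi> (s \<odot>\<^bsub>free_module S I\<^esub> c) = s \<odot>\<^bsub>A\<^esub> linear_extension S A \<phi> c" .
  qed
qed

lemma module_hom_compose: "f \<in> module_hom R M N \<Longrightarrow> g \<in> module_hom R N K \<Longrightarrow> (\<lambda>x. g (f x)) \<in> module_hom R M K"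
  by (rule module_homI) (auto simp: module_homD)

lemma projective_module_lift:
  fixes P :: "('s, 'p, 't) module_scheme" and A :: "('s, 'a, 'u) module_scheme" and B :: "('s, 'b, 'v) module_scheme"
  assumes "projective_module S P" "module S A" "module S B"
    and "g \<in> module_hom S A B" "g ` carrier A = carrier B" "f \<in> module_hom S P B"
  shows "\<exists>h \<in> module_hom S P A. \<forall>x \<in> carrier P. g (h x) = f x"
proof -
  have P: "module S P" using assms(1) by (simp add: projective_module_def)
  interpret P: module S P by fact
  interpret A: module S A by fact
  interpret B: module S B by fact
  let ?F = "free_module S (carrier P)"
  define P' :: "('s, 'p) module" where "P' = \<lparr>carrier = carrier P, monoid.mult = undefined, one = undefined,
     ring.zero = \<zero>\<^bsub>P\<^esub>, add = add P, smult = smult P\<rparr>"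
  have P': "carrier P' = carrier P" "add P' = add P" "smult P' = smult P" "\<zero>\<^bsub>P'\<^esub> = \<zero>\<^bsub>P\<^esub>"
    by (simp_all add: P'_def)
  have hom_P': "h \<in> module_hom S N P' \<longleftrightarrow> h \<in> module_hom S N P" for h and N :: "('s, 'q, 'w) module_scheme"
    by (simp add: module_hom_def hom_def P')
  have mP': "module S P'"
  proof (rule moduleI)
    show "abelian_group P'"
    proof (rule abelian_groupI)
      fix x assume "x \<in> carrier P'"
      thus "\<exists>y\<in>carrier P'. y \<oplus>\<^bsub>P'\<^esub> x = \<zero>\<^bsub>P'\<^esub>"
        by (intro bexI[of _ "\<ominus>\<^bsub>P\<^esub> x"]) (simp_all add: P' P.M.l_neg)
    next
      fix x y assume "x \<in> carrier P'" "y \<in> carrier P'"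
      thus "x \<oplus>\<^bsub>P'\<^esub> y = y \<oplus>\<^bsub>P'\<^esub> x" by (simp add: P' P.M.a_comm)
    qed (simp_all add: P' P.M.a_assoc)
  qed (simp_all add: P' P.is_cring P.smult_l_distr P.smult_r_distr P.smult_assoc1)
  let ?\<epsilon> = "linear_extension S P (\<lambda>x. x)"
  have \<epsilon>: "?\<epsilon> \<in> module_hom S ?F P" by (rule linear_extension_hom[OF P]) auto
  have surj: "?\<epsilon> ` carrier ?F = carrier P"
  proof (rule equalityI; rule subsetI)
    fix x assume x: "x \<in> carrier P"
    define c where "c = (\<lambda>y. if y = x then \<one>\<^bsub>S\<^esub> else \<zero>\<^bsub>S\<^esub>)"
    have c: "c \<in> carrier ?F"
      using x by (auto simp: free_module_def c_def)
    have "?\<epsilon> c = (\<Oplus>\<^bsub>P\<^esub>y\<in>{x}. c y \<odot>\<^bsub>P\<^esub> y)"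
      by (rule linear_extension_eq[OF P _ c]) (use x in \<open>auto simp: c_def\<close>)
    also have "\<dots> = x" using x by (simp add: c_def)
    finally show "x \<in> ?\<epsilon> ` carrier ?F" using c by (metis imageI)
  next
    fix x assume "x \<in> ?\<epsilon> ` carrier ?F"
    then obtain c where "c \<in> carrier ?F" "x = ?\<epsilon> c" by blast
    thus "x \<in> carrier P" using module_homD(1)[OF \<epsilon>] by simp
  qed
  have "(\<lambda>x. x) \<in> module_hom S P P'"
    by (rule module_homI) (simp_all add: P')
  moreover have "?\<epsilon> \<in> module_hom S ?F P'" using \<epsilon> by (simp add: hom_P')
  ultimately have "\<exists>s \<in> module_hom S P ?F. \<forall>x \<in> carrier P. ?\<epsilon> (s x) = x"
    using assms(1)[unfolded projective_module_def, THEN conjunct2, rule_format, of ?F P' ?\<epsilon> "\<lambda>x. x"]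
      mP' module_free_module[OF P.is_cring, of "carrier P"] surj P'(1) by simp
  then obtain s where s: "s \<in> module_hom S P ?F" "\<And>x. x \<in> carrier P \<Longrightarrow> ?\<epsilon> (s x) = x"
    by blast
  define \<phi> where "\<phi> x = (SOME a. a \<in> carrier A \<and> g a = f x)" for x
  have \<phi>: "\<phi> x \<in> carrier A \<and> g (\<phi> x) = f x" if "x \<in> carrier P" for x
  proof -
    have "f x \<in> g ` carrier A" using module_homD(1)[OF assms(6) that] assms(5) by simp
    then obtain a where "a \<in> carrier A \<and> g a = f x" by (metis imageE)
    thus ?thesis unfolding \<phi>_def by (rule someI)
  qed
  have \<phi>': "\<phi> \<in> carrier P \<rightarrow> carrier A" using \<phi> by auto
  have *: "g (linear_extension S A \<phi> c) = f (?\<epsilon> c)" if c: "c \<in> carrier ?F" for c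
  proof -
    note fD = free_module_carrierD[OF P.is_cring c]
    have "g (linear_extension S A \<phi> c) = (\<Oplus>\<^bsub>B\<^esub>x\<in>{x. c x \<noteq> \<zero>\<^bsub>S\<^esub>}. g (c x \<odot>\<^bsub>A\<^esub> \<phi> x))"
      unfolding linear_extension_def
      by (rule module_hom_finsum[OF assms(2-4) fD(2)]) (use fD \<phi> in auto)
    also have "\<dots> = (\<Oplus>\<^bsub>B\<^esub>x\<in>{x. c x \<noteq> \<zero>\<^bsub>S\<^esub>}. f (c x \<odot>\<^bsub>P\<^esub> x))"
    proof (rule B.M.finsum_cong'[OF refl])
      show "(\<lambda>x. f (c x \<odot>\<^bsub>P\<^esub> x)) \<in> {x. c x \<noteq> \<zero>\<^bsub>S\<^esub>} \<rightarrow> carrier B"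
        using fD module_homD(1)[OF assms(6)] by auto
    next
      fix x assume "x \<in> {x. c x \<noteq> \<zero>\<^bsub>S\<^esub>}"
      hence x: "x \<in> carrier P" using fD(3) by auto
      thus "g (c x \<odot>\<^bsub>A\<^esub> \<phi> x) = f (c x \<odot>\<^bsub>P\<^esub> x)"
        using \<phi>[OF x] fD(1) by (simp add: module_homD(3)[OF assms(4)] module_homD(3)[OF assms(6)])
    qed
    also have "\<dots> = f (?\<epsilon> c)"
      unfolding linear_extension_def
      by (rule module_hom_finsum[OF P assms(3,6) fD(2), symmetric]) (use fD in auto)
    finally show ?thesis .
  qed
  show ?thesis
  proof (intro bexI[of _ "\<lambda>x. linear_extension S A \<phi> (s x)"] ballI)
    fix x assume x: "x \<in> carrier P"
    show "g (linear_extension S A \<phi> (s x)) = f x"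
      using *[OF module_homD(1)[OF s(1) x]] s(2)[OF x] by simp
  qed (rule module_hom_compose[OF s(1) linear_extension_hom[OF assms(2) \<phi>']])
qed


subsection \<open>Flatness\<close>

lemma transport_module:
  fixes N :: "('a, 'n, 'z) module_scheme" and e :: "'n \<Rightarrow> 't"
  assumes "module R N" "inj_on e (carrier N)"
  obtains T :: "('a, 't) module" where "module R T" "carrier T = e ` carrier N"
    "e \<in> module_hom R N T" "the_inv_into (carrier N) e \<in> module_hom R T N"
proof -
  interpret N: module R N by fact
  let ?i = "the_inv_into (carrier N) e"
  define T :: "('a, 't) module" where
    "T = \<lparr>carrier = e ` carrier N, monoid.mult = undefined, one = undefined,
       ring.zero = e \<zero>\<^bsub>N\<^esub>, add = (\<lambda>X Y. e (?i X \<oplus>\<^bsub>N\<^esub> ?i Y)), smult = (\<lambda>r X. e (r \<odot>\<^bsub>N\<^esub> ?i X))\<rparr>"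
  have T: "carrier T = e ` carrier N" "\<zero>\<^bsub>T\<^esub> = e \<zero>\<^bsub>N\<^esub>"
    "x \<in> carrier N \<Longrightarrow> y \<in> carrier N \<Longrightarrow> e x \<oplus>\<^bsub>T\<^esub> e y = e (x \<oplus>\<^bsub>N\<^esub> y)"
    "x \<in> carrier N \<Longrightarrow> r \<odot>\<^bsub>T\<^esub> e x = e (r \<odot>\<^bsub>N\<^esub> x)" for x y r
    by (simp_all add: T_def the_inv_into_f_f[OF assms(2)])
  have mT: "module R T"
  proof (rule moduleI)
    show "abelian_group T"
    proof (rule abelian_groupI)
      fix x assume "x \<in> carrier T"
      then obtain x' where "x = e x'" "x' \<in> carrier N" by (auto simp: T)
      thus "\<exists>y\<in>carrier T. y \<oplus>\<^bsub>T\<^esub> x = \<zero>\<^bsub>T\<^esub>"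
        by (intro bexI[of _ "e (\<ominus>\<^bsub>N\<^esub> x')"]) (simp_all add: T N.M.l_neg)
    next
      fix x y assume "x \<in> carrier T" "y \<in> carrier T"
      thus "x \<oplus>\<^bsub>T\<^esub> y = y \<oplus>\<^bsub>T\<^esub> x" by (auto simp: T N.M.a_comm)
    qed (auto simp: T N.M.a_assoc)
  qed (auto simp: T N.is_cring N.smult_l_distr N.smult_r_distr N.smult_assoc1)
  show thesis
  proof (rule that[OF mT T(1)])
    show "e \<in> module_hom R N T" by (rule module_homI) (simp_all add: T)
    show "?i \<in> module_hom R T N"
      by (rule module_homI) (auto simp: T the_inv_into_f_f[OF assms(2)])
  qed
qed

fun list_lincomb :: "('a, 'n, 'z) module_scheme \<Rightarrow> 'a list \<Rightarrow> 'n list \<Rightarrow> 'n" where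
  "list_lincomb N (a # as) (x # xs) = a \<odot>\<^bsub>N\<^esub> x \<oplus>\<^bsub>N\<^esub> list_lincomb N as xs"
| "list_lincomb N _ _ = \<zero>\<^bsub>N\<^esub>"

definition module_span ::
    "('a, 'x) ring_scheme \<Rightarrow> ('a, 'n, 'z) module_scheme \<Rightarrow> 'n list \<Rightarrow> 'n set" where
  "module_span R N xs = {list_lincomb N as xs | as. length as = length xs \<and> set as \<subseteq> carrier R}"

lemma lincomb_closed:
  assumes "module R N" "length as = length xs" "set as \<subseteq> carrier R" "set xs \<subseteq> carrier N"
  shows "list_lincomb N as xs \<in> carrier N"
proof -
  interpret N: module R N by fact
  show ?thesis using assms(2-) by (induction as xs rule: list_induct2) auto
qed

lemma module_span_submodule:
  assumes "module R N" "set xs \<subseteq> carrier N"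
  shows "submodule (module_span R N xs) R N" and "set xs \<subseteq> module_span R N xs"
proof -
  interpret N: module R N by fact
  note lc = lincomb_closed[OF assms(1)]
  have zero: "list_lincomb N (replicate (length xs) \<zero>\<^bsub>R\<^esub>) xs = \<zero>\<^bsub>N\<^esub>"
    using assms(2) by (induction xs) auto
  have zero_in: "\<zero>\<^bsub>N\<^esub> \<in> module_span R N xs"
    unfolding module_span_def using zero by (auto intro!: exI[of _ "replicate (length xs) \<zero>\<^bsub>R\<^esub>"])
  have smult: "r \<odot>\<^bsub>N\<^esub> list_lincomb N as xs = list_lincomb N (map (\<lambda>a. r \<otimes>\<^bsub>R\<^esub> a) as) xs"
    if "r \<in> carrier R" "length as = length xs" "set as \<subseteq> carrier R" for r as
    using that(2,3) assms(2) that(1)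
    by (induction as xs rule: list_induct2) (auto simp: N.smult_r_distr N.smult_assoc1 lc)
  have smult_in: "r \<odot>\<^bsub>N\<^esub> x \<in> module_span R N xs" if r: "r \<in> carrier R" and x: "x \<in> module_span R N xs" for r x
  proof -
    from x obtain as where as: "x = list_lincomb N as xs" "length as = length xs" "set as \<subseteq> carrier R"
      by (auto simp: module_span_def)
    show ?thesis unfolding module_span_def as(1) smult[OF r as(2,3)]
      using as(2,3) r by (intro CollectI exI[of _ "map (\<lambda>a. r \<otimes>\<^bsub>R\<^esub> a) as"]) auto
  qed
  have add: "list_lincomb N as xs \<oplus>\<^bsub>N\<^esub> list_lincomb N bs xs = list_lincomb N (map2 (\<lambda>a b. a \<oplus>\<^bsub>R\<^esub> b) as bs) xs"
    if "length as = length bs" "length bs = length xs" "set as \<subseteq> carrier R" "set bs \<subseteq> carrier R" for as bs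
    using that assms(2)
  proof (induction as bs xs rule: list_induct3)
    case (Cons a as b bs x xs)
    have "list_lincomb N as xs \<in> carrier N" "list_lincomb N bs xs \<in> carrier N"
      using Cons by (auto intro!: lc)
    moreover have "list_lincomb N (map2 (\<lambda>a b. a \<oplus>\<^bsub>R\<^esub> b) as bs) xs = list_lincomb N as xs \<oplus>\<^bsub>N\<^esub> list_lincomb N bs xs"
      using Cons by simp
    ultimately show ?case using Cons.prems by (simp add: N.smult_l_distr N.M.a_ac)
  qed simp
  have add_in: "x \<oplus>\<^bsub>N\<^esub> y \<in> module_span R N xs" if x: "x \<in> module_span R N xs" and y: "y \<in> module_span R N xs" for x y
  proof -
    from x obtain as where as: "x = list_lincomb N as xs" "length as = length xs" "set as \<subseteq> carrier R"
      by (auto simp: module_span_def)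
    from y obtain bs where bs: "y = list_lincomb N bs xs" "length bs = length xs" "set bs \<subseteq> carrier R"
      by (auto simp: module_span_def)
    have l: "length as = length bs" using as bs by simp
    have "set (map2 (\<lambda>a b. a \<oplus>\<^bsub>R\<^esub> b) as bs) \<subseteq> carrier R"
    proof
      fix z assume "z \<in> set (map2 (\<lambda>a b. a \<oplus>\<^bsub>R\<^esub> b) as bs)"
      then obtain a b where ab: "(a, b) \<in> set (zip as bs)" "z = a \<oplus>\<^bsub>R\<^esub> b" by auto
      from set_zip_leftD[OF ab(1)] set_zip_rightD[OF ab(1)] show "z \<in> carrier R"
        using as(3) bs(3) ab(2) by auto
    qed
    thus ?thesis unfolding module_span_def as(1) bs(1) add[OF l bs(2) as(3) bs(3)]
      using as bs by (intro CollectI exI[of _ "map2 (\<lambda>a b. a \<oplus>\<^bsub>R\<^esub> b) as bs"]) simp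
  qed
  have sub: "module_span R N xs \<subseteq> carrier N"
    using lc assms(2) by (auto simp: module_span_def)
  show "submodule (module_span R N xs) R N"
  proof (rule N.submoduleI[OF sub zero_in])
    fix x assume x: "x \<in> module_span R N xs"
    have "(\<ominus>\<^bsub>R\<^esub> \<one>\<^bsub>R\<^esub>) \<odot>\<^bsub>N\<^esub> x = \<ominus>\<^bsub>N\<^esub> x"
      using x sub by (subst N.smult_l_minus) auto
    thus "\<ominus>\<^bsub>N\<^esub> x \<in> module_span R N xs"
      using smult_in[of "\<ominus>\<^bsub>R\<^esub> \<one>\<^bsub>R\<^esub>" x] x by simp
  qed (fact add_in smult_in)+
  show "set xs \<subseteq> module_span R N xs"
    using assms(2)
  proof (induction xs)
    case (Cons x xs)
    have z: "list_lincomb N (replicate (length ys) \<zero>\<^bsub>R\<^esub>) ys = \<zero>\<^bsub>N\<^esub>" if "set ys \<subseteq> carrier N" for ys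
      using that by (induction ys) auto
    show ?case
    proof
      fix y assume "y \<in> set (x # xs)"
      then consider "y = x" | "y \<in> set xs" by auto
      thus "y \<in> module_span R N (x # xs)"
      proof cases
        case 1
        have "list_lincomb N (\<one>\<^bsub>R\<^esub> # replicate (length xs) \<zero>\<^bsub>R\<^esub>) (x # xs) = x"
          using Cons.prems by (simp add: z)
        thus ?thesis unfolding module_span_def 1
          by (intro CollectI exI[of _ "\<one>\<^bsub>R\<^esub> # replicate (length xs) \<zero>\<^bsub>R\<^esub>"]) auto
      next
        case 2
        then obtain as where as: "y = list_lincomb N as xs" "length as = length xs" "set as \<subseteq> carrier R"
          using Cons by (auto simp: module_span_def)
        have "list_lincomb N as xs \<in> carrier N" using as Cons.prems by (intro lc) auto
        hence "list_lincomb N (\<zero>\<^bsub>R\<^esub> # as) (x # xs) = y"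
          using Cons.prems as by simp
        thus ?thesis unfolding module_span_def
          using as by (intro CollectI exI[of _ "\<zero>\<^bsub>R\<^esub> # as"]) auto
      qed
    qed
  qed simp
qed

lemma module_span_inj_list:
  obtains e :: "'n \<Rightarrow> 'a list" where
    "inj_on e (module_span (R :: ('a, 'x) ring_scheme) (N :: ('a, 'n, 'z) module_scheme) xs)"
proof -
  have "module_span R N xs \<subseteq> (\<lambda>as. list_lincomb N as xs) ` UNIV" by (auto simp: module_span_def)
  hence "inj_on (inv_into UNIV (\<lambda>as. list_lincomb N as xs)) (module_span R N xs)"
    by (rule inj_on_inv_into)
  thus thesis by (rule that)
qed

lemma tensor_kernel_local:
  assumes "module R M" "module R N" "z \<in> tensor_kernel R M N"
  shows "\<exists>E. finite E \<and> E \<subseteq> carrier N \<and>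
    (\<forall>H. submodule H R N \<longrightarrow> E \<subseteq> H \<longrightarrow> z \<in> tensor_kernel R M (N\<lparr>carrier := H\<rparr>))"
  using assms
proof (induction rule: tensor_kernel_induct)
  have mH: "module R (N\<lparr>carrier := H\<rparr>)" if "submodule H R N" for H
    using submodule.submodule_is_module[OF that assms(2)] .
  note K = tensor_kernel_closed[OF assms(1) mH]
  have rel: "\<exists>E. finite E \<and> E \<subseteq> carrier N \<and>
    (\<forall>H. submodule H R N \<longrightarrow> E \<subseteq> H \<longrightarrow> c \<in> tensor_kernel R M (N\<lparr>carrier := H\<rparr>))"
    if "c \<in> tensor_relations R M N" for c
  proof -
    from that consider
      (1) m m' n where "c = frag_of (m \<oplus>\<^bsub>M\<^esub> m', n) - frag_of (m, n) - frag_of (m', n)"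
        "m \<in> carrier M" "m' \<in> carrier M" "n \<in> carrier N"
    | (2) m n n' where "c = frag_of (m, n \<oplus>\<^bsub>N\<^esub> n') - frag_of (m, n) - frag_of (m, n')"
        "m \<in> carrier M" "n \<in> carrier N" "n' \<in> carrier N"
    | (3) r m n where "c = frag_of (r \<odot>\<^bsub>M\<^esub> m, n) - frag_of (m, r \<odot>\<^bsub>N\<^esub> n)"
        "r \<in> carrier R" "m \<in> carrier M" "n \<in> carrier N"
      unfolding tensor_relations_def by blast
    thus ?thesis
    proof cases
      case 1
      have "c \<in> tensor_kernel R M (N\<lparr>carrier := H\<rparr>)" if "n \<in> H" for H
        by (rule tensor_kernel_rel) (use 1 that in \<open>auto simp: tensor_relations_def\<close>)
      thus ?thesis using 1 by (intro exI[of _ "{n}"]) auto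
    next
      case 2
      have "c \<in> tensor_kernel R M (N\<lparr>carrier := H\<rparr>)" if "n \<in> H" "n' \<in> H" for H
        by (rule tensor_kernel_rel) (use 2 that in \<open>auto simp: tensor_relations_def\<close>)
      thus ?thesis using 2 by (intro exI[of _ "{n, n'}"]) auto
    next
      case 3
      have "c \<in> tensor_kernel R M (N\<lparr>carrier := H\<rparr>)" if "n \<in> H" for H
        by (rule tensor_kernel_rel) (use 3 that in \<open>auto simp: tensor_relations_def\<close>)
      thus ?thesis using 3 by (intro exI[of _ "{n}"]) auto
    qed
  qed
  {
    case zero show ?case using K(1) by (intro exI[of _ "{}"]) auto
  next
    case (rel c) thus ?case using \<open>\<And>c. c \<in> tensor_relations R M N \<Longrightarrow> _\<close> by blast
  next
    case (neg_rel c)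
    from rel[OF this] obtain E where "finite E" "E \<subseteq> carrier N"
      "\<forall>H. submodule H R N \<longrightarrow> E \<subseteq> H \<longrightarrow> c \<in> tensor_kernel R M (N\<lparr>carrier := H\<rparr>)" by blast
    thus ?case using K(3) by (intro exI[of _ E]) blast
  next
    case (add c d)
    from add(3) obtain E where E: "finite E" "E \<subseteq> carrier N"
      "\<forall>H. submodule H R N \<longrightarrow> E \<subseteq> H \<longrightarrow> c \<in> tensor_kernel R M (N\<lparr>carrier := H\<rparr>)" by blast
    from add(4) obtain E' where E': "finite E'" "E' \<subseteq> carrier N"
      "\<forall>H. submodule H R N \<longrightarrow> E' \<subseteq> H \<longrightarrow> d \<in> tensor_kernel R M (N\<lparr>carrier := H\<rparr>)" by blast
    show ?case using E E' K(2) by (intro exI[of _ "E \<union> E'"]) blast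
  }
qed

lemma module_hom_inclusion:
  "H \<subseteq> carrier N \<Longrightarrow> (\<lambda>x. x) \<in> module_hom R (N\<lparr>carrier := H\<rparr>) N"
  by (rule module_homI) auto

lemma flat_module_inj:
  fixes N :: "('a, 'n, 'z) module_scheme" and N' :: "('a, 'k, 'w) module_scheme"
  assumes "flat_module R M" "module R N" "module R N'"
    and "f \<in> module_hom R N N'" "inj_on f (carrier N)"
  shows "inj_on (tensor_map R M N N' f) (carrier (tensor_group R M N))"
proof (subst tensor_map_inj_iff)
  show M: "module R M" using assms(1) by (simp add: flat_module_def)
  show "module R N" "module R N'" "f \<in> module_hom R N N'" by fact+
  show "\<forall>c. Poly_Mapping.keys c \<subseteq> carrier M \<times> carrier N \<longrightarrow>
       tensor_push f c \<in> tensor_kernel R M N' \<longrightarrow> c \<in> tensor_kernel R M N"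
  proof (intro allI impI)
    fix c assume c: "Poly_Mapping.keys c \<subseteq> carrier M \<times> carrier N"
      and fc: "tensor_push f c \<in> tensor_kernel R M N'"
    obtain E where E: "finite E" "E \<subseteq> carrier N'"
      "\<And>H. submodule H R N' \<Longrightarrow> E \<subseteq> H \<Longrightarrow> tensor_push f c \<in> tensor_kernel R M (N'\<lparr>carrier := H\<rparr>)"
      using tensor_kernel_local[OF M assms(3) fc] by blast
    let ?C = "snd ` Poly_Mapping.keys c"
    have C: "finite ?C" "?C \<subseteq> carrier N" using c by auto
    obtain xs where xs: "set xs = ?C" using finite_list[OF C(1)] by blast
    define G where "G = module_span R N xs"
    have G: "submodule G R N" "?C \<subseteq> G"
      unfolding G_def xs[symmetric] by (intro module_span_submodule assms(2); use xs C in simp)+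
    have fG: "f x \<in> carrier N'" if "x \<in> carrier N" for x by (rule module_homD(1)[OF assms(4) that])
    obtain ys where ys: "set ys = E \<union> f ` ?C" using finite_list[of "E \<union> f ` ?C"] E(1) C(1) by blast
    have ysN: "set ys \<subseteq> carrier N'" using ys E(2) C(2) fG by auto
    define H where "H = module_span R N' ys"
    have H: "submodule H R N'" "E \<union> f ` ?C \<subseteq> H"
      unfolding H_def ys[symmetric] by (intro module_span_submodule assms(3) ysN)+
    interpret N: module R N by fact
    interpret N': module R N' by fact
    note Gs = N.submoduleE[OF G(1)] and Hs = N'.submoduleE[OF H(1)]
    let ?N = "N\<lparr>carrier := G\<rparr>" and ?N' = "N'\<lparr>carrier := H\<rparr>"
    have mG: "module R ?N" using submodule.submodule_is_module[OF G(1) assms(2)] .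
    have mH: "module R ?N'" using submodule.submodule_is_module[OF H(1) assms(3)] .
    have fGH: "f x \<in> H" if "x \<in> G" for x
    proof -
      from that obtain as where as: "x = list_lincomb N as xs" "length as = length xs" "set as \<subseteq> carrier R"
        unfolding G_def module_span_def by auto
      have "f (list_lincomb N as xs) \<in> H" using as(2,3) xs H(2) C(2)
      proof -
        have "set xs \<subseteq> carrier N" "f ` set xs \<subseteq> H" using xs C H(2) by auto
        with as(2,3) show ?thesis
        proof (induction as xs rule: list_induct2)
          case Nil
          show ?case using module_hom_zero[OF assms(2,3,4)] N'.submoduleE(2)[OF H(1)]
            subgroup.one_closed[OF submodule.axioms(1)[OF H(1)]] by simp
        next
          case (Cons a as y ys)
          have "list_lincomb N as ys \<in> carrier N" using Cons by (intro lincomb_closed[OF assms(2)]) auto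
          hence "f (list_lincomb N (a # as) (y # ys)) = a \<odot>\<^bsub>N'\<^esub> f y \<oplus>\<^bsub>N'\<^esub> f (list_lincomb N as ys)"
            using Cons.prems by (simp add: module_homD(2,3)[OF assms(4)])
          thus ?case using Cons Hs(4,5) by simp
        qed
      qed
      thus ?thesis using as by simp
    qed
    obtain e :: "'n \<Rightarrow> 'a list" where e: "inj_on e G"
      unfolding G_def by (rule module_span_inj_list)
    obtain e' :: "'k \<Rightarrow> 'a list" where e': "inj_on e' H"
      unfolding H_def by (rule module_span_inj_list)
    obtain T :: "('a, 'a list) module" where T: "module R T" "carrier T = e ` carrier ?N"
      "e \<in> module_hom R ?N T" "the_inv_into (carrier ?N) e \<in> module_hom R T ?N"
      by (rule transport_module[OF mG, of e]) (use e in auto)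
    obtain T' :: "('a, 'a list) module" where T': "module R T'" "carrier T' = e' ` carrier ?N'"
      "e' \<in> module_hom R ?N' T'"
      by (rule transport_module[OF mH, of e']) (use e' in auto)
    let ?i = "the_inv_into G e"
    have i: "?i \<in> module_hom R T ?N" using T(4) by simp
    have f: "f \<in> module_hom R ?N ?N'"
      by (rule module_homI) (use fGH Gs(1) in \<open>auto simp: module_homD[OF assms(4)] subset_iff\<close>)
    let ?h = "\<lambda>x. e' (f (?i x))"
    have h: "?h \<in> module_hom R T T'"
      by (rule module_hom_compose[OF i module_hom_compose[OF f T'(3)]])
    have ie: "?i (e x) = x" if "x \<in> G" for x by (rule the_inv_into_f_f[OF e that])
    have "inj_on ?h (carrier T)"
    proof (rule inj_onI)
      fix x y assume "x \<in> carrier T" "y \<in> carrier T" and eq: "?h x = ?h y"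
      then obtain x' y' where "x = e x'" "y = e y'" "x' \<in> G" "y' \<in> G" by (auto simp: T(2))
      moreover from this eq have "f x' = f y'"
        using inj_onD[OF e'] fGH by (simp add: ie)
      ultimately show "x = y" using inj_onD[OF assms(5), of x' y'] Gs(1) by auto
    qed
    hence "inj_on (tensor_map R M T T' ?h) (carrier (tensor_group R M T))"
      using assms(1) T(1) T'(1) h unfolding flat_module_def by blast
    hence *: "d \<in> tensor_kernel R M T" if "Poly_Mapping.keys d \<subseteq> carrier M \<times> carrier T"
      "tensor_push ?h d \<in> tensor_kernel R M T'" for d
      using that unfolding tensor_map_inj_iff[OF M T(1) T'(1) h] by blast
    have cG: "n \<in> G" "m \<in> carrier M" if "(m, n) \<in> Poly_Mapping.keys c" for m n
      using that G(2) c by force+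
    have "tensor_push e c \<in> tensor_kernel R M T"
    proof (rule *)
      show "Poly_Mapping.keys (tensor_push e c) \<subseteq> carrier M \<times> carrier T"
        by (rule keys_tensor_push_subset[of _ _ G]) (use cG T(2) in auto)
      have "tensor_push ?h (tensor_push e c) = tensor_push (\<lambda>x. e' (f x)) c"
        unfolding tensor_push_comp by (rule tensor_push_cong) (simp add: ie cG)
      also have "\<dots> = tensor_push e' (tensor_push f c)"
        unfolding tensor_push_comp by (rule tensor_push_cong) simp
      also have "\<dots> \<in> tensor_kernel R M T'"
        by (rule tensor_kernel_push[OF M mH T'(1) T'(3) E(3)[OF H(1)]]) (use H(2) in auto)
      finally show "tensor_push ?h (tensor_push e c) \<in> tensor_kernel R M T'" .
    qed
    hence "tensor_push ?i (tensor_push e c) \<in> tensor_kernel R M ?N"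
      by (rule tensor_kernel_push[OF M T(1) mG i])
    also have "tensor_push ?i (tensor_push e c) = c"
      unfolding tensor_push_comp by (rule tensor_push_id) (simp add: ie cG)
    finally have "tensor_push (\<lambda>x. x) c \<in> tensor_kernel R M N"
      by (rule tensor_kernel_push[OF M mG assms(2) module_hom_inclusion[OF Gs(1)]])
    moreover have "tensor_push (\<lambda>x. x) c = c" by (rule tensor_push_id) simp
    ultimately show "c \<in> tensor_kernel R M N" by simp
  qed
qed

end

theory Submission
  imports Defs
begin

text \<open>
  For a finitely generated flat module \<open>M\<close>, projectivity of \<open>M \<otimes> S\<close> depends only on the kernel
  of \<open>R \<rightarrow> S\<close>.  Write \<open>M = R\<^sup>A / K\<close>, so that \<open>M \<otimes> S = S\<^sup>A / K S\<close>.  If \<open>M \<otimes> S\<close> is projective, \<open>K S\<close> is a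
  direct summand of \<open>S\<^sup>A\<close>, hence spanned by finitely many elements of \<open>K\<close>.  By flatness some linear map
  \<open>E : R\<^sup>A \<rightarrow> K\<close> fixes these, and then it fixes all of \<open>K\<close> modulo the kernel.  Conversely, such
  an \<open>E\<close> induces a projection of \<open>S\<^sup>A\<close> onto \<open>K S\<close>.  The products over \<open>X\<close> and over its
  specialization cone have the same kernel, since the primes of \<open>X\<close> and those of the cone have
  the same intersection.
\<close>


section \<open>Linear maps on free modules\<close>

text \<open>The obstacle is that \<open>K\<close> need not be finitely generated, and an
  \<open>E\<close> over \<open>R\<close> fixing all of \<open>K\<close> would make \<open>M\<close>
  itself projective. Projectivity of \<open>M \<otimes> S\<close> serves to reach a finite set: a
  projection of \<open>S^A\<close> onto \<open>K S\<close> has finitely many columns, each an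
  \<open>S\<close>-combination of finitely many elements of \<open>K\<close>; an \<open>E\<close>
  fixing these elements exactly fixes all of \<open>K S\<close> after extension of scalars. Such an
  \<open>E\<close> comes from the equational criterion: for \<open>f\<close> in \<open>K\<close>,
  flatness gives matrices \<open>B\<close> and \<open>D\<close> with \<open>B f = 0\<close> and
  \<open>D f = f\<close> whose columns agree modulo \<open>K\<close>, and \<open>E = D - B\<close>.
  Since \<open>E\<close> has entries in \<open>R\<close>, the condition that it fix \<open>K\<close>
  modulo the kernel compares vectors over \<open>R\<close>, and this lets one \<open>E\<close> serve
  for different rings \<open>S\<close>. Right exactness of the tensor product is needed twice, for
  the kernel of \<open>S^A \<rightarrow> M \<otimes> S\<close> and inside the equational criterion;
  both times it is proved on formal sums, one bilinearity relation at a time.\<close>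

definition unit_vector :: "('s, 'x) ring_scheme \<Rightarrow> 'p \<Rightarrow> 'p \<Rightarrow> 's"
  where "unit_vector S i = (\<lambda>j. if j = i then \<one>\<^bsub>S\<^esub> else \<zero>\<^bsub>S\<^esub>)"

text \<open>\<open>S\<close> as a module over itself, built from the identity map so that it is
  literally the tensor factor of the trivial base change from \<open>R\<close> to \<open>R\<close>;
  the equational criterion relies on this coincidence.\<close>

abbreviation regular_module :: "('s, 'x) ring_scheme \<Rightarrow> ('s, 's) module"
  where "regular_module S \<equiv> restrict_scalars (\<lambda>x. x) S"

lemma module_regular_module: "cring S \<Longrightarrow> module S (regular_module S)"
  by (intro module_restrict_scalars ring_hom_memI) auto

lemma regular_module_simps [simp]:
  "carrier (regular_module S) = carrier S" "\<zero>\<^bsub>regular_module S\<^esub> = \<zero>\<^bsub>S\<^esub>"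
  "x \<oplus>\<^bsub>regular_module S\<^esub> y = x \<oplus>\<^bsub>S\<^esub> y" "x \<odot>\<^bsub>regular_module S\<^esub> y = x \<otimes>\<^bsub>S\<^esub> y"
  by (simp_all add: restrict_scalars_def)

lemma free_module_simps:
  "\<zero>\<^bsub>free_module S I\<^esub> = (\<lambda>_. \<zero>\<^bsub>S\<^esub>)"
  "(c \<oplus>\<^bsub>free_module S I\<^esub> d) i = c i \<oplus>\<^bsub>S\<^esub> d i" "(s \<odot>\<^bsub>free_module S I\<^esub> c) i = s \<otimes>\<^bsub>S\<^esub> c i"
  by (simp_all add: free_module_def)

lemma unit_vector_commute: "unit_vector S i j = unit_vector S j i"
  by (auto simp: unit_vector_def)

lemma unit_vector_closed:
  assumes "cring S" "i \<in> I"
  shows "unit_vector S i \<in> carrier (free_module S I)"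
proof -
  interpret cring S by fact
  show ?thesis using assms(2) by (auto simp: unit_vector_def free_module_def)
qed

lemma ring_hom_zero':
  assumes "cring R" "cring S" "\<phi> \<in> ring_hom R S"
  shows "\<phi> \<zero>\<^bsub>R\<^esub> = \<zero>\<^bsub>S\<^esub>"
  using ring_hom_zero[OF assms(3)] assms(1,2) by (simp add: cring.axioms(1))

lemma comp_free_module_closed:
  assumes "cring R" "cring S" "\<phi> \<in> ring_hom R S" "c \<in> carrier (free_module R I)"
  shows "\<phi> \<circ> c \<in> carrier (free_module S I)"
proof -
  have "finite {x. \<phi> (c x) \<noteq> \<zero>\<^bsub>S\<^esub>}"
    by (rule finite_subset[OF _ free_module_carrierD(2)[OF assms(1,4)]])
      (auto simp: ring_hom_zero'[OF assms(1-3)])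
  thus ?thesis
    using assms(4) ring_hom_closed[OF assms(3)] ring_hom_zero'[OF assms(1-3)]
    by (auto simp: free_module_def)
qed

text \<open>Linearity is asked only along a ring map because the same computation serves
  \<open>R\<close>-linear maps and the passage from \<open>R\<close> to \<open>S\<close>, where
  \<open>g\<close> is \<open>incl\<close> or \<open>\<lambda>x. \<phi> \<circ> E x\<close>.\<close>

lemma semilinear_linear_extension:
  assumes "module R M" "module S N" "\<phi> \<in> ring_hom R S"
    and g: "\<And>x. x \<in> carrier M \<Longrightarrow> g x \<in> carrier N"
      "\<And>x y. x \<in> carrier M \<Longrightarrow> y \<in> carrier M \<Longrightarrow> g (x \<oplus>\<^bsub>M\<^esub> y) = g x \<oplus>\<^bsub>N\<^esub> g y"
      "\<And>r x. r \<in> carrier R \<Longrightarrow> x \<in> carrier M \<Longrightarrow> g (r \<odot>\<^bsub>M\<^esub> x) = \<phi> r \<odot>\<^bsub>N\<^esub> g x"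
    and v: "v \<in> I \<rightarrow> carrier M" and c: "c \<in> carrier (free_module R I)"
  shows "g (linear_extension R M v c) = linear_extension S N (g \<circ> v) (\<phi> \<circ> c)"
proof -
  interpret M: module R M by fact
  interpret N: module S N by fact
  note fD = free_module_carrierD[OF M.is_cring c]
  have \<phi>0: "\<phi> \<zero>\<^bsub>R\<^esub> = \<zero>\<^bsub>S\<^esub>" by (rule ring_hom_zero'[OF M.is_cring N.is_cring assms(3)])
  have g0: "g \<zero>\<^bsub>M\<^esub> = \<zero>\<^bsub>N\<^esub>"
    using g(3)[of "\<zero>\<^bsub>R\<^esub>" "\<zero>\<^bsub>M\<^esub>"] g(1)[of "\<zero>\<^bsub>M\<^esub>"] by (simp add: \<phi>0)
  have "g (\<Oplus>\<^bsub>M\<^esub>x\<in>T. c x \<odot>\<^bsub>M\<^esub> v x) = (\<Oplus>\<^bsub>N\<^esub>x\<in>T. (\<phi> \<circ> c) x \<odot>\<^bsub>N\<^esub> (g \<circ> v) x)"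
    if "finite T" "T \<subseteq> I" for T
    using that
  proof (induction rule: finite_induct)
    case empty show ?case by (simp add: g0)
  next
    case (insert x T)
    hence "(\<lambda>x. c x \<odot>\<^bsub>M\<^esub> v x) \<in> T \<rightarrow> carrier M" "v x \<in> carrier M" using v fD(1) by auto
    moreover have "(\<lambda>x. \<phi> (c x) \<odot>\<^bsub>N\<^esub> g (v x)) \<in> T \<rightarrow> carrier N" "g (v x) \<in> carrier N"
      using insert v fD(1) g(1) ring_hom_closed[OF assms(3)]
      by (auto intro!: N.smult_closed simp: Pi_iff subset_iff)
    ultimately show ?case
      using insert fD(1) by (simp add: M.finsum_closed g ring_hom_closed[OF assms(3)])
  qed
  from this[OF fD(2,3)] have "g (linear_extension R M v c)
      = (\<Oplus>\<^bsub>N\<^esub>x\<in>{x. c x \<noteq> \<zero>\<^bsub>R\<^esub>}. (\<phi> \<circ> c) x \<odot>\<^bsub>N\<^esub> (g \<circ> v) x)"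
    by (simp add: linear_extension_def)
  also have "\<dots> = linear_extension S N (g \<circ> v) (\<phi> \<circ> c)"
    by (rule linear_extension_eq[OF assms(2) _ comp_free_module_closed[OF M.is_cring N.is_cring assms(3) c]
          fD(2,3), symmetric]) (use v g(1) \<phi>0 in auto)
  finally show ?thesis .
qed

lemma module_hom_linear_extension:
  assumes "module R M" "module R N" "g \<in> module_hom R M N"
    and "v \<in> I \<rightarrow> carrier M" "c \<in> carrier (free_module R I)"
  shows "g (linear_extension R M v c) = linear_extension R N (g \<circ> v) c"
  using semilinear_linear_extension[OF assms(1,2) _ _ _ _ assms(4,5), of "\<lambda>x. x" g] module_homD[OF assms(3)]
  by (simp add: ring_hom_def comp_def)

lemma linear_extension_cong:
  assumes "module S N" "c \<in> carrier (free_module S I)" "w \<in> I \<rightarrow> carrier N"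
    and "\<And>i. i \<in> I \<Longrightarrow> c i \<noteq> \<zero>\<^bsub>S\<^esub> \<Longrightarrow> v i = w i"
  shows "linear_extension S N v c = linear_extension S N w c"
proof -
  interpret N: module S N by fact
  note fD = free_module_carrierD[OF N.is_cring assms(2)]
  show ?thesis
    unfolding linear_extension_def
    by (rule N.M.finsum_cong'[OF refl]) (use assms(3,4) fD in \<open>auto simp: subset_iff Pi_iff\<close>)
qed

lemma linear_extension_zero:
  assumes "module S N" "c \<in> carrier (free_module S I)"
  shows "linear_extension S N (\<lambda>_. \<zero>\<^bsub>N\<^esub>) c = \<zero>\<^bsub>N\<^esub>"
proof -
  interpret N: module S N by fact
  note fD = free_module_carrierD[OF N.is_cring assms(2)]
  have "linear_extension S N (\<lambda>_. \<zero>\<^bsub>N\<^esub>) c = (\<Oplus>\<^bsub>N\<^esub>x\<in>{x. c x \<noteq> \<zero>\<^bsub>S\<^esub>}. \<zero>\<^bsub>N\<^esub>)"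
    unfolding linear_extension_def by (rule N.M.finsum_cong'[OF refl]) (use fD in auto)
  thus ?thesis by simp
qed

lemma linear_extension_unit_vector:
  assumes "module S N" "v \<in> I \<rightarrow> carrier N" "i \<in> I"
  shows "linear_extension S N v (unit_vector S i) = v i"
proof -
  interpret N: module S N by fact
  have "linear_extension S N v (unit_vector S i) = (\<Oplus>\<^bsub>N\<^esub>j\<in>{i}. unit_vector S i j \<odot>\<^bsub>N\<^esub> v j)"
    by (rule linear_extension_eq[OF assms(1,2) unit_vector_closed[OF N.is_cring assms(3)]])
      (use assms(3) in \<open>auto simp: unit_vector_def\<close>)
  thus ?thesis using assms(2,3) by (auto simp: unit_vector_def Pi_iff)
qed

text \<open>Both sides are the dot product of two finitely supported vectors, computed over the
  union of the supports. The symmetry exchanges coefficients and values, which is how coordinates of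
  a combination are read off.\<close>

lemma linear_extension_regular_commute:
  assumes "cring S" "c \<in> carrier (free_module S I)" "d \<in> carrier (free_module S I)"
  shows "linear_extension S (regular_module S) c d = linear_extension S (regular_module S) d c"
proof -
  interpret cring S by fact
  interpret N: module S "regular_module S" by (rule module_regular_module) fact
  note cD = free_module_carrierD[OF assms(1,2)] and dD = free_module_carrierD[OF assms(1,3)]
  let ?T = "{x. c x \<noteq> \<zero>\<^bsub>S\<^esub>} \<union> {x. d x \<noteq> \<zero>\<^bsub>S\<^esub>}"
  have "linear_extension S (regular_module S) c d = (\<Oplus>\<^bsub>regular_module S\<^esub>x\<in>?T. d x \<otimes>\<^bsub>S\<^esub> c x)"
    by (subst linear_extension_eq[OF N.module_axioms _ assms(3), of _ ?T]) (use cD dD in auto)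
  also have "\<dots> = (\<Oplus>\<^bsub>regular_module S\<^esub>x\<in>?T. c x \<otimes>\<^bsub>S\<^esub> d x)"
    by (rule N.M.finsum_cong'[OF refl]) (use cD dD in \<open>auto simp: m_comm\<close>)
  also have "\<dots> = linear_extension S (regular_module S) d c"
    by (subst linear_extension_eq[OF N.module_axioms _ assms(2), of _ ?T]) (use cD dD in auto)
  finally show ?thesis .
qed

lemma eval_module_hom:
  assumes "cring S"
  shows "(\<lambda>c. c j) \<in> module_hom S (free_module S I) (regular_module S)"
  using free_module_carrierD(1)[OF assms] by (intro module_homI) (auto simp: free_module_simps)

lemma linear_extension_apply:
  assumes "cring S" "v \<in> I \<rightarrow> carrier (free_module S J)" "c \<in> carrier (free_module S I)"
  shows "linear_extension S (free_module S J) v c j = linear_extension S (regular_module S) (\<lambda>i. v i j) c"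
  using module_hom_linear_extension[OF module_free_module module_regular_module eval_module_hom assms(2,3)] assms(1)
  by (simp add: comp_def)

lemma linear_extension_unit_vectors:
  assumes "cring S" "c \<in> carrier (free_module S I)"
  shows "linear_extension S (free_module S I) (unit_vector S) c = c"
proof
  fix j
  interpret cring S by fact
  note uv = unit_vector_closed[OF assms(1)]
  \<comment> \<open>The unit matrix is symmetric, so coordinate \<open>j\<close> of the combination
    pairs \<open>c\<close> with \<open>unit_vector S j\<close>.\<close>
  have *: "linear_extension S (free_module S I) (unit_vector S) c j
      = linear_extension S (regular_module S) (unit_vector S j) c"
    using assms uv by (subst linear_extension_apply) (auto simp: unit_vector_commute[of S _ j])
  show "linear_extension S (free_module S I) (unit_vector S) c j = c j"
  proof (cases "j \<in> I")
    case True
    thus ?thesis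
      unfolding * linear_extension_regular_commute[OF assms(1) uv[OF True] assms(2)]
      using free_module_carrierD(1)[OF assms]
      by (subst linear_extension_unit_vector[OF module_regular_module[OF assms(1)]]) auto
  next
    \<comment> \<open>Off \<open>I\<close> both sides vanish, since elements of
      \<open>free_module S I\<close> are zero there.\<close>
    case False
    have "linear_extension S (free_module S I) (unit_vector S) c \<in> carrier (free_module S I)"
      by (rule module_homD(1)[OF linear_extension_hom[OF module_free_module[OF assms(1)]] assms(2)])
         (use uv in auto)
    with False assms(2) show ?thesis by (auto simp: free_module_def)
  qed
qed

lemma module_hom_free_module_eq:
  assumes "module S N" "g \<in> module_hom S (free_module S I) N" "c \<in> carrier (free_module S I)"
  shows "g c = linear_extension S N (g \<circ> unit_vector S) c"
proof -
  interpret N: module S N by fact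
  have "unit_vector S \<in> I \<rightarrow> carrier (free_module S I)"
    by (rule Pi_I) (rule unit_vector_closed[OF N.is_cring])
  from module_hom_linear_extension[OF module_free_module[OF N.is_cring] assms(1,2) this assms(3)]
  show ?thesis unfolding linear_extension_unit_vectors[OF N.is_cring assms(3)] .
qed

lemma module_hom_add:
  assumes "module R N" "f \<in> module_hom R M N" "g \<in> module_hom R M N"
  shows "(\<lambda>x. f x \<oplus>\<^bsub>N\<^esub> g x) \<in> module_hom R M N"
proof -
  interpret N: module R N by fact
  note fg = module_homD[OF assms(2)] module_homD[OF assms(3)]
  show ?thesis
    by (rule module_homI) (simp_all add: fg N.smult_r_distr N.M.a_ac)
qed

lemma module_hom_minus:
  assumes "module R N" "f \<in> module_hom R M N" "g \<in> module_hom R M N"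
  shows "(\<lambda>x. f x \<ominus>\<^bsub>N\<^esub> g x) \<in> module_hom R M N"
proof -
  interpret N: module R N by fact
  note fg = module_homD[OF assms(2)] module_homD[OF assms(3)]
  show ?thesis
    by (rule module_homI)
      (simp_all add: fg N.smult_r_distr N.smult_r_minus N.M.minus_add N.M.a_ac N.M.minus_eq)
qed

lemma module_hom_diff:
  assumes "module R M" "module R N" "f \<in> module_hom R M N" "x \<in> carrier M" "y \<in> carrier M"
  shows "f (x \<ominus>\<^bsub>M\<^esub> y) = f x \<ominus>\<^bsub>N\<^esub> f y"
proof -
  interpret M: module R M by fact
  interpret N: module R N by fact
  note f = module_homD[OF assms(3)]
  have "f (x \<ominus>\<^bsub>M\<^esub> y) \<oplus>\<^bsub>N\<^esub> f y = f x"
    using assms(4,5) by (simp add: f(2)[symmetric] M.M.minus_eq M.M.a_assoc M.M.l_neg)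
  moreover have "f (x \<ominus>\<^bsub>M\<^esub> y) \<in> carrier N" "f y \<in> carrier N" using assms(4,5) f(1) by auto
  ultimately show ?thesis
    by (metis N.M.a_assoc N.M.minus_eq N.M.r_neg N.M.r_zero N.M.a_inv_closed)
qed

text \<open>\<open>\<rho>\<close> kills the kernel of \<open>\<pi>\<close>, so it descends to a
  section of \<open>\<pi>\<close>, and \<open>P\<close> is a direct summand of a free module. Giving
  the endomorphism \<open>\<rho>\<close> instead of the section suits the application, where
  \<open>\<rho>\<close> is a matrix.\<close>

lemma projective_moduleI_split:
  assumes P: "module S P" and \<pi>: "\<pi> \<in> module_hom S (free_module S I) P"
    and surj: "\<pi> ` carrier (free_module S I) = carrier P"
    and \<rho>: "\<rho> \<in> module_hom S (free_module S I) (free_module S I)"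
    and kernel: "\<And>c. c \<in> carrier (free_module S I) \<Longrightarrow> \<pi> c = \<zero>\<^bsub>P\<^esub> \<Longrightarrow> \<rho> c = \<zero>\<^bsub>free_module S I\<^esub>"
    and split: "\<And>c. c \<in> carrier (free_module S I) \<Longrightarrow> \<pi> (\<rho> c) = \<pi> c"
  shows "projective_module S (P :: ('s, 'p, 'y) module_scheme)"
  unfolding projective_module_def
proof (intro conjI allI impI P)
  fix A :: "('s, 'p \<Rightarrow> 's) module" and B :: "('s, 'p) module" and g f
  assume "module S A \<and> module S B \<and> g \<in> module_hom S A B \<and> g ` carrier A = carrier B \<and> f \<in> module_hom S P B"
  hence A: "module S A" and B: "module S B" and g: "g \<in> module_hom S A B"
    and gs: "g ` carrier A = carrier B" and f: "f \<in> module_hom S P B" by auto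
  interpret P: module S P by fact
  interpret A: module S A by fact
  let ?F = "free_module S I"
  interpret F: module S ?F by (rule module_free_module[OF P.is_cring])
  note uv = unit_vector_closed[OF P.is_cring, where I = I]
  \<comment> \<open>By freeness \<open>f \<circ> \<pi>\<close> lifts along \<open>g\<close>: it
    suffices to choose preimages for the basis vectors.\<close>
  have "\<exists>a \<in> carrier A. g a = f (\<pi> (unit_vector S i))" if "i \<in> I" for i
    using gs module_homD(1)[OF f module_homD(1)[OF \<pi> uv[OF that]]] by (metis imageE)
  then obtain t where t: "\<And>i. i \<in> I \<Longrightarrow> t i \<in> carrier A"
    "\<And>i. i \<in> I \<Longrightarrow> g (t i) = f (\<pi> (unit_vector S i))" by metis
  let ?T = "linear_extension S A t"
  have T: "?T \<in> module_hom S ?F A" by (rule linear_extension_hom[OF A]) (use t in auto)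
  have gT: "g (?T c) = f (\<pi> c)" if c: "c \<in> carrier ?F" for c
  proof -
    have "g (?T c) = linear_extension S B (g \<circ> t) c"
      by (rule module_hom_linear_extension[OF A B g _ c]) (use t in auto)
    also have "\<dots> = linear_extension S B ((\<lambda>c. f (\<pi> c)) \<circ> unit_vector S) c"
      by (rule linear_extension_cong[OF B c]) (use t uv module_homD(1)[OF f] module_homD(1)[OF \<pi>] in auto)
    also have "\<dots> = f (\<pi> c)"
      by (rule module_hom_free_module_eq[OF B module_hom_compose[OF \<pi> f] c, symmetric])
    finally show ?thesis .
  qed
  \<comment> \<open>\<open>\<tau>\<close> is chosen without linearity. Only
    \<open>\<rho> \<circ> \<tau>\<close> enters the lift, and it is linear because
    \<open>\<rho> c\<close> depends only on \<open>\<pi> c\<close>.\<close>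
  have "\<exists>c \<in> carrier ?F. \<pi> c = x" if "x \<in> carrier P" for x using surj that by (metis imageE)
  then obtain \<tau> where \<tau>: "\<And>x. x \<in> carrier P \<Longrightarrow> \<tau> x \<in> carrier ?F" "\<And>x. x \<in> carrier P \<Longrightarrow> \<pi> (\<tau> x) = x"
    by metis
  have \<rho>_eq: "\<rho> c = \<rho> d" if "c \<in> carrier ?F" "d \<in> carrier ?F" "\<pi> c = \<pi> d" for c d
  proof -
    have "\<pi> (c \<ominus>\<^bsub>?F\<^esub> d) = \<zero>\<^bsub>P\<^esub>"
      using that module_homD(1)[OF \<pi>]
      by (simp add: module_hom_diff[OF F.module_axioms P \<pi>] P.M.r_neg P.M.minus_eq)
    hence "\<rho> (c \<ominus>\<^bsub>?F\<^esub> d) = \<zero>\<^bsub>?F\<^esub>" using kernel that by blast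
    hence "\<rho> c \<oplus>\<^bsub>?F\<^esub> \<ominus>\<^bsub>?F\<^esub> \<rho> d = \<zero>\<^bsub>?F\<^esub>"
      using that unfolding F.M.minus_eq[symmetric]
      by (simp only: module_hom_diff[OF F.module_axioms F.module_axioms \<rho>, symmetric])
    from F.M.minus_equality[OF this] show ?thesis
      using that module_homD(1)[OF \<rho>] by simp
  qed
  show "\<exists>h \<in> module_hom S P A. \<forall>x \<in> carrier P. g (h x) = f x"
  proof (intro bexI[of _ "\<lambda>x. ?T (\<rho> (\<tau> x))"] ballI module_homI)
    fix x y assume xy: "x \<in> carrier P" "y \<in> carrier P"
    have "\<rho> (\<tau> (x \<oplus>\<^bsub>P\<^esub> y)) = \<rho> (\<tau> x \<oplus>\<^bsub>?F\<^esub> \<tau> y)"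
      by (rule \<rho>_eq) (simp_all add: xy \<tau> module_homD(2)[OF \<pi>])
    thus "?T (\<rho> (\<tau> (x \<oplus>\<^bsub>P\<^esub> y))) = ?T (\<rho> (\<tau> x)) \<oplus>\<^bsub>A\<^esub> ?T (\<rho> (\<tau> y))"
      using \<tau>(1) xy by (simp add: module_homD[OF \<rho>] module_homD[OF T])
  next
    fix s x assume xy: "s \<in> carrier S" "x \<in> carrier P"
    have "\<rho> (\<tau> (s \<odot>\<^bsub>P\<^esub> x)) = \<rho> (s \<odot>\<^bsub>?F\<^esub> \<tau> x)"
      by (rule \<rho>_eq) (simp_all add: xy \<tau> module_homD(3)[OF \<pi>])
    thus "?T (\<rho> (\<tau> (s \<odot>\<^bsub>P\<^esub> x))) = s \<odot>\<^bsub>A\<^esub> ?T (\<rho> (\<tau> x))"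
      using \<tau>(1) xy by (simp add: module_homD[OF \<rho>] module_homD[OF T])
  next
    fix x assume "x \<in> carrier P"
    thus "g (?T (\<rho> (\<tau> x))) = f x" using \<tau> by (simp add: gT module_homD(1)[OF \<rho>] split)
  qed (use \<tau>(1) in \<open>auto intro!: module_homD(1)[OF T] module_homD(1)[OF \<rho>]\<close>)
qed


section \<open>Presentations and base change\<close>

lemma submodule_image:
  assumes "module R M" "module R N" "f \<in> module_hom R M N"
  shows "submodule (f ` carrier M) R N"
proof -
  interpret M: module R M by fact
  interpret N: module R N by fact
  note f = module_homD[OF assms(3)]
  show ?thesis
  proof (rule N.submoduleI)
    show "\<zero>\<^bsub>N\<^esub> \<in> f ` carrier M"
      using module_hom_zero[OF assms] M.zero_closed by (metis imageI)
  next
    fix a assume "a \<in> f ` carrier M"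
    then obtain x where x: "a = f x" "x \<in> carrier M" by blast
    have "f x \<oplus>\<^bsub>N\<^esub> f (\<ominus>\<^bsub>M\<^esub> x) = \<zero>\<^bsub>N\<^esub>"
      using x by (simp add: f(2)[symmetric] M.M.r_neg module_hom_zero[OF assms])
    hence "\<ominus>\<^bsub>N\<^esub> a = f (\<ominus>\<^bsub>M\<^esub> x)"
      using x by (intro N.M.minus_equality) (simp_all add: f(1) N.M.a_comm)
    thus "\<ominus>\<^bsub>N\<^esub> a \<in> f ` carrier M" using x(2) by simp
  next
    fix a b assume "a \<in> f ` carrier M" "b \<in> f ` carrier M"
    then obtain x y where "a = f x" "x \<in> carrier M" "b = f y" "y \<in> carrier M" by blast
    thus "a \<oplus>\<^bsub>N\<^esub> b \<in> f ` carrier M" by (intro image_eqI[of _ _ "x \<oplus>\<^bsub>M\<^esub> y"]) (simp_all add: f(2))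
  next
    fix r a assume r: "r \<in> carrier R" and "a \<in> f ` carrier M"
    then obtain x where "a = f x" "x \<in> carrier M" by blast
    with r show "r \<odot>\<^bsub>N\<^esub> a \<in> f ` carrier M" by (intro image_eqI[of _ _ "r \<odot>\<^bsub>M\<^esub> x"]) (simp_all add: f(3))
  qed (use f(1) in auto)
qed

section \<open>Homomorphisms out of a free abelian group\<close>

lemma hom_free_Abelian_group:
  assumes "abelian_group N" "h \<in> hom (free_Abelian_group B) (add_monoid N)"
  shows "Poly_Mapping.keys c \<subseteq> B \<Longrightarrow> h c \<in> carrier N" and "h 0 = \<zero>\<^bsub>N\<^esub>"
    and "Poly_Mapping.keys c \<subseteq> B \<Longrightarrow> Poly_Mapping.keys d \<subseteq> B \<Longrightarrow> h (c + d) = h c \<oplus>\<^bsub>N\<^esub> h d"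
    and "Poly_Mapping.keys c \<subseteq> B \<Longrightarrow> h (- c) = \<ominus>\<^bsub>N\<^esub> h c"
    and "Poly_Mapping.keys c \<subseteq> B \<Longrightarrow> Poly_Mapping.keys d \<subseteq> B \<Longrightarrow> h (c - d) = h c \<ominus>\<^bsub>N\<^esub> h d"
proof -
  interpret N: abelian_group N by fact
  interpret h: group_hom "free_Abelian_group B" "add_monoid N" h
    by (intro group_hom.intro group_hom_axioms.intro assms(2) N.a_group) simp
  show cl: "h c \<in> carrier N" if "Poly_Mapping.keys c \<subseteq> B" for c
    using h.hom_closed[of c] that by simp
  show "h 0 = \<zero>\<^bsub>N\<^esub>" using h.hom_one by simp
  show add: "h (c + d) = h c \<oplus>\<^bsub>N\<^esub> h d" if "Poly_Mapping.keys c \<subseteq> B" "Poly_Mapping.keys d \<subseteq> B" for c d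
    using h.hom_mult[of c d] that by simp
  show neg: "h (- c) = \<ominus>\<^bsub>N\<^esub> h c" if "Poly_Mapping.keys c \<subseteq> B" for c
    using h.hom_inv[of c] that by (simp add: a_inv_def)
  show "h (c - d) = h c \<ominus>\<^bsub>N\<^esub> h d" if "Poly_Mapping.keys c \<subseteq> B" "Poly_Mapping.keys d \<subseteq> B" for c d
    using add[of c "- d"] neg[of d] that by (simp add: N.minus_eq)
qed

text \<open>The bound on the keys of the partial sums is carried along because additivity of
  \<open>h\<close> asks for it at each induction step.\<close>

lemma hom_free_Abelian_group_sum:
  assumes "abelian_group N" "h \<in> hom (free_Abelian_group B) (add_monoid N)"
    and "finite T" "\<And>t. t \<in> T \<Longrightarrow> Poly_Mapping.keys (f t) \<subseteq> B"
  shows "Poly_Mapping.keys (\<Sum>t\<in>T. f t) \<subseteq> B \<and> h (\<Sum>t\<in>T. f t) = (\<Oplus>\<^bsub>N\<^esub>t\<in>T. h (f t))"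
  using assms(3,4)
proof (induction rule: finite_induct)
  interpret N: abelian_group N by fact
  case empty show ?case using hom_free_Abelian_group(2)[OF assms(1,2)] by simp
next
  interpret N: abelian_group N by fact
  note h = hom_free_Abelian_group[OF assms(1,2)]
  case (insert x T)
  have "(\<lambda>t. h (f t)) \<in> T \<rightarrow> carrier N" "h (f x) \<in> carrier N" using insert.prems h(1) by auto
  moreover have "Poly_Mapping.keys (f x + (\<Sum>t\<in>T. f t)) \<subseteq> B"
    using insert Poly_Mapping.keys_add[of "f x" "\<Sum>t\<in>T. f t"] by fastforce
  ultimately show ?case using insert by (simp add: h(3))
qed

text \<open>The syzygies of the generators, the \<open>K\<close> of the overview. Being a plain set
  of vectors, it can also index a free \<open>S\<close>-module, whose image in \<open>S^A\<close> is
  \<open>K S\<close>.\<close>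

definition relations :: "('a, 'x) ring_scheme \<Rightarrow> ('a, 'm, 'y) module_scheme \<Rightarrow> 'm set \<Rightarrow> ('m \<Rightarrow> 'a) set"
  where "relations R M A =
    {c \<in> carrier (free_module R A). linear_extension R M (\<lambda>a. a) c = \<zero>\<^bsub>M\<^esub>}"

locale generated_module = module R M for R :: "('a, 'x) ring_scheme" and M :: "('a, 'm, 'y) module_scheme" +
  fixes A :: "'m set"
  assumes A_finite: "finite A" and A_carrier: "A \<subseteq> carrier M"
    and generates: "x \<in> carrier M \<Longrightarrow> \<exists>c \<in> carrier (free_module R A). linear_extension R M (\<lambda>a. a) c = x"
begin

abbreviation lin :: "('m \<Rightarrow> 'a) \<Rightarrow> 'm" where "lin \<equiv> linear_extension R M (\<lambda>a. a)"

sublocale F: module R "free_module R A" by (rule module_free_module) (rule is_cring)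

lemma lin_hom: "lin \<in> module_hom R (free_module R A) M"
  by (rule linear_extension_hom[OF module_axioms]) (use A_carrier in auto)

lemmas linD = module_homD[OF lin_hom]

lemma relations_diff:
  assumes "c \<in> carrier (free_module R A)" "d \<in> carrier (free_module R A)" "lin c = lin d"
  shows "c \<ominus>\<^bsub>free_module R A\<^esub> d \<in> relations R M A"
  using assms linD(1)[OF assms(2)]
  by (simp add: relations_def module_hom_diff[OF F.module_axioms module_axioms lin_hom] M.minus_eq M.r_neg)

text \<open>A choice of lifts, normalised on the generators: with \<open>\<tau> a\<close> the basis
  vector of \<open>a\<close>, the formal sum of the \<open>a \<otimes> s a\<close> is carried back
  to \<open>s\<close> itself in \<open>proj_kernel\<close>.\<close>

lemma lin_section:
  obtains \<tau> where "\<And>x. x \<in> carrier M \<Longrightarrow> \<tau> x \<in> carrier (free_module R A)"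
    "\<And>x. x \<in> carrier M \<Longrightarrow> lin (\<tau> x) = x" "\<And>a. a \<in> A \<Longrightarrow> \<tau> a = unit_vector R a"
proof -
  from generates obtain \<tau> where \<tau>: "\<And>x. x \<in> carrier M \<Longrightarrow> \<tau> x \<in> carrier (free_module R A)"
    "\<And>x. x \<in> carrier M \<Longrightarrow> lin (\<tau> x) = x" by metis
  have u: "lin (unit_vector R a) = a" if "a \<in> A" for a
    by (rule linear_extension_unit_vector[OF module_axioms _ that]) (use A_carrier in auto)
  show thesis
    by (rule that[of "\<lambda>x. if x \<in> A then unit_vector R x else \<tau> x"])
       (auto simp: \<tau> u unit_vector_closed[OF is_cring])
qed

end

section \<open>The base change as a quotient of a free \<open>S\<close>-module\<close>

locale scalar_extension = generated_module R M A + S: cring S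
  for R :: "('a, 'x) ring_scheme" and M :: "('a, 'm, 'y) module_scheme" and A
    and S :: "('s, 'z) ring_scheme" and \<phi> :: "'a \<Rightarrow> 's" +
  assumes \<phi>_hom: "\<phi> \<in> ring_hom R S"
begin

abbreviation "N \<equiv> restrict_scalars \<phi> S"
abbreviation "P \<equiv> base_change R M \<phi> S"

sublocale N: module R N by (rule module_restrict_scalars[OF is_cring S.is_cring \<phi>_hom])
sublocale P: module S P by (rule module_base_change[OF module_axioms S.is_cring \<phi>_hom])
sublocale FS: module S "free_module S A" by (rule module_free_module[OF S.is_cring])

definition cls :: "('m \<times> 's \<Rightarrow>\<^sub>0 int) \<Rightarrow> ('m \<times> 's \<Rightarrow>\<^sub>0 int) set"
  where "cls c = tensor_kernel R M N #>\<^bsub>free_Abelian_group (carrier M \<times> carrier S)\<^esub> c"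

lemma carrier_N [simp]: "carrier N = carrier S"
  by (simp add: restrict_scalars_def)

lemma cls_hom: "cls \<in> hom (free_Abelian_group (carrier M \<times> carrier S)) (add_monoid P)"
proof -
  interpret G: comm_group "free_Abelian_group (carrier M \<times> carrier S)"
    by (rule abelian_free_Abelian_group)
  have "normal (tensor_kernel R M N) (free_Abelian_group (carrier M \<times> carrier S))"
    by (rule G.subgroup_imp_normal[OF tensor_kernel_subgroup[OF module_axioms N.module_axioms, unfolded carrier_N]])
  from normal.r_coset_hom_Mod[OF this] show ?thesis
    by (simp add: hom_def base_change_def tensor_group_def cls_def Pi_iff)
qed

lemma carrier_P: "carrier P = cls ` {c. Poly_Mapping.keys c \<subseteq> carrier M \<times> carrier S}"
  by (simp add: base_change_def carrier_tensor_group cls_def)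

lemma cls_eq_iff: "cls c = cls d \<longleftrightarrow> c - d \<in> tensor_kernel R M N"
  using tensor_coset_eq_iff[OF module_axioms N.module_axioms] by (simp add: cls_def)

lemmas clsD = hom_free_Abelian_group[OF P.M.abelian_group_axioms cls_hom]

lemma smult_cls:
  assumes "s \<in> carrier S"
  shows "s \<odot>\<^bsub>P\<^esub> cls c = cls (tensor_push (\<lambda>x. s \<otimes>\<^bsub>S\<^esub> x) c)"
proof -
  have "(\<lambda>x. s \<otimes>\<^bsub>S\<^esub> x) \<in> module_hom R N N"
    using assms \<phi>_hom
    by (intro module_homI) (simp_all add: restrict_scalars_def S.r_distr ring_hom_closed[OF \<phi>_hom] S.m_lcomm)
  from tensor_map_coset[OF module_axioms N.module_axioms N.module_axioms this, of c] show ?thesis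
    by (simp add: base_change_def cls_def)
qed

text \<open>The canonical map \<open>m \<mapsto> m \<otimes> 1\<close>; it is linear along
  \<open>\<phi>\<close>, and its values on \<open>A\<close> generate
  \<open>M \<otimes> S\<close>.\<close>

definition incl :: "'m \<Rightarrow> ('m \<times> 's \<Rightarrow>\<^sub>0 int) set"
  where "incl m = cls (frag_of (m, \<one>\<^bsub>S\<^esub>))"

lemma smult_incl: "s \<in> carrier S \<Longrightarrow> s \<odot>\<^bsub>P\<^esub> incl m = cls (frag_of (m, s))"
  by (simp add: incl_def smult_cls)

lemma incl_closed: "m \<in> carrier M \<Longrightarrow> incl m \<in> carrier P"
  unfolding incl_def by (rule clsD(1)) simp

lemma incl_add:
  assumes "m \<in> carrier M" "m' \<in> carrier M"
  shows "incl (m \<oplus>\<^bsub>M\<^esub> m') = incl m \<oplus>\<^bsub>P\<^esub> incl m'"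
proof -
  have "frag_of (m \<oplus>\<^bsub>M\<^esub> m', \<one>\<^bsub>S\<^esub>) - frag_of (m, \<one>\<^bsub>S\<^esub>) - frag_of (m', \<one>\<^bsub>S\<^esub>) \<in> tensor_relations R M N"
    using assms unfolding tensor_relations_def carrier_N by blast
  hence "cls (frag_of (m \<oplus>\<^bsub>M\<^esub> m', \<one>\<^bsub>S\<^esub>)) = cls (frag_of (m, \<one>\<^bsub>S\<^esub>) + frag_of (m', \<one>\<^bsub>S\<^esub>))"
    unfolding cls_eq_iff by (intro tensor_kernel_rel) (simp add: diff_diff_eq)
  also have "\<dots> = incl m \<oplus>\<^bsub>P\<^esub> incl m'"
    unfolding incl_def using assms by (intro clsD(3)) auto
  finally show ?thesis by (simp add: incl_def)
qed

lemma incl_smult: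
  assumes "r \<in> carrier R" "m \<in> carrier M"
  shows "incl (r \<odot>\<^bsub>M\<^esub> m) = \<phi> r \<odot>\<^bsub>P\<^esub> incl m"
proof -
  have "frag_of (r \<odot>\<^bsub>M\<^esub> m, \<one>\<^bsub>S\<^esub>) - frag_of (m, r \<odot>\<^bsub>N\<^esub> \<one>\<^bsub>S\<^esub>) \<in> tensor_relations R M N"
    using assms unfolding tensor_relations_def carrier_N by blast
  moreover have "r \<odot>\<^bsub>N\<^esub> \<one>\<^bsub>S\<^esub> = \<phi> r"
    using ring_hom_closed[OF \<phi>_hom assms(1)] by (simp add: restrict_scalars_def)
  ultimately show ?thesis
    using ring_hom_closed[OF \<phi>_hom assms(1)]
    by (simp add: smult_incl, simp add: incl_def cls_eq_iff tensor_kernel_rel)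
qed

abbreviation proj :: "('m \<Rightarrow> 's) \<Rightarrow> ('m \<times> 's \<Rightarrow>\<^sub>0 int) set"
  where "proj \<equiv> linear_extension S P incl"

lemma proj_hom: "proj \<in> module_hom S (free_module S A) P"
  by (rule linear_extension_hom[OF P.module_axioms]) (use incl_closed A_carrier in auto)

lemma comp_closed: "c \<in> carrier (free_module R I) \<Longrightarrow> \<phi> \<circ> c \<in> carrier (free_module S I)"
  by (rule comp_free_module_closed[OF is_cring S.is_cring \<phi>_hom])

lemma comp_add:
  assumes "c \<in> carrier (free_module R I)" "d \<in> carrier (free_module R I)"
  shows "\<phi> \<circ> (c \<oplus>\<^bsub>free_module R I\<^esub> d) = (\<phi> \<circ> c) \<oplus>\<^bsub>free_module S I\<^esub> (\<phi> \<circ> d)"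
  using free_module_carrierD(1)[OF is_cring assms(1)] free_module_carrierD(1)[OF is_cring assms(2)]
  by (intro ext) (simp add: free_module_simps ring_hom_add[OF \<phi>_hom])

lemma comp_smult:
  assumes "r \<in> carrier R" "c \<in> carrier (free_module R I)"
  shows "\<phi> \<circ> (r \<odot>\<^bsub>free_module R I\<^esub> c) = \<phi> r \<odot>\<^bsub>free_module S I\<^esub> (\<phi> \<circ> c)"
  using free_module_carrierD(1)[OF is_cring assms(2)] assms(1)
  by (intro ext) (simp add: free_module_simps ring_hom_mult[OF \<phi>_hom])

text \<open>The square formed by \<open>R^A \<rightarrow> M \<rightarrow> M \<otimes> S\<close> and
  \<open>R^A \<rightarrow> S^A \<rightarrow> M \<otimes> S\<close> commutes, since all its maps are
  additive and compatible with scalars and it commutes on basis vectors.\<close>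

lemma proj_comp:
  assumes "c \<in> carrier (free_module R A)"
  shows "proj (\<phi> \<circ> c) = incl (lin c)"
  using semilinear_linear_extension[OF module_axioms P.module_axioms \<phi>_hom incl_closed incl_add incl_smult _ assms,
      of "\<lambda>a. a"] A_carrier
  by (auto simp: comp_def)

lemma incl_zero: "incl \<zero>\<^bsub>M\<^esub> = \<zero>\<^bsub>P\<^esub>"
  using incl_smult[of "\<zero>\<^bsub>R\<^esub>" "\<zero>\<^bsub>M\<^esub>"] ring_hom_zero'[OF is_cring S.is_cring \<phi>_hom]
  by (simp add: incl_closed)

lemma proj_surj: "proj ` carrier (free_module S A) = carrier P"
proof (rule equalityI; rule subsetI)
  fix x assume "x \<in> carrier P"
  then obtain c where c: "x = cls c" "Poly_Mapping.keys c \<subseteq> carrier M \<times> carrier S"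
    unfolding carrier_P by blast
  \<comment> \<open>The bound on the keys stays in the induction claim because \<open>cls\<close> is
    known to be additive only on formal sums supported in
    \<open>carrier M \<times> carrier S\<close>.\<close>
  have "Poly_Mapping.keys c \<subseteq> carrier M \<times> carrier S \<and> cls c \<in> proj ` carrier (free_module S A)"
    using c(2)
  proof (induction c rule: frag_induction)
    case zero show ?case
      using submodule.axioms(1)[OF submodule_image[OF FS.module_axioms P.module_axioms proj_hom]]
        subgroup.one_closed clsD(2) by fastforce
  next
    case (one y)
    then obtain m s where y: "y = (m, s)" "m \<in> carrier M" "s \<in> carrier S" by auto
    obtain c where c: "c \<in> carrier (free_module R A)" "lin c = m" using generates[OF y(2)] by blast
    have "cls (frag_of y) = s \<odot>\<^bsub>P\<^esub> proj (\<phi> \<circ> c)"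
      using y c by (simp add: proj_comp smult_incl)
    also have "\<dots> = proj (s \<odot>\<^bsub>free_module S A\<^esub> (\<phi> \<circ> c))"
      using y comp_closed[OF c(1)] by (simp add: module_homD(3)[OF proj_hom])
    finally show ?case using y comp_closed[OF c(1)] by simp
  next
    case (diff c d)
    then obtain x y where "cls c = proj x" "cls d = proj y"
      "x \<in> carrier (free_module S A)" "y \<in> carrier (free_module S A)" by blast
    hence "cls (c - d) = proj (x \<ominus>\<^bsub>free_module S A\<^esub> y)"
      using diff by (simp add: clsD(5) module_hom_diff[OF FS.module_axioms P.module_axioms proj_hom])
    moreover have "x \<ominus>\<^bsub>free_module S A\<^esub> y \<in> carrier (free_module S A)"
      by (intro FS.M.minus_closed) fact+
    moreover have "Poly_Mapping.keys (c - d) \<subseteq> carrier M \<times> carrier S"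
      using diff keys_diff[of c d] by blast
    ultimately show ?case by blast
  qed
  thus "x \<in> proj ` carrier (free_module S A)" using c by simp
qed (use module_homD(1)[OF proj_hom] in blast)

text \<open>Serves to translate \<open>proj s = 0\<close> into membership of one explicit formal sum
  in \<open>tensor_kernel\<close>, where induction over the bilinearity relations is
  available.\<close>

lemma proj_eq_cls:
  assumes s: "s \<in> carrier (free_module S A)"
  shows "proj s = cls (\<Sum>a\<in>A. frag_of (a, s a))"
proof -
  note fD = free_module_carrierD[OF S.is_cring s]
  have keys: "Poly_Mapping.keys (frag_of (a, s a)) \<subseteq> carrier M \<times> carrier S" if "a \<in> A" for a
    using that A_carrier fD(1) by auto
  have "cls (\<Sum>a\<in>A. frag_of (a, s a)) = (\<Oplus>\<^bsub>P\<^esub>a\<in>A. cls (frag_of (a, s a)))"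
    using hom_free_Abelian_group_sum[OF P.M.abelian_group_axioms cls_hom A_finite, of "\<lambda>a. frag_of (a, s a)"] keys by simp
  also have "\<dots> = (\<Oplus>\<^bsub>P\<^esub>a\<in>A. s a \<odot>\<^bsub>P\<^esub> incl a)"
    by (simp add: smult_incl fD(1))
  also have "\<dots> = proj s"
    by (rule linear_extension_eq[OF P.module_axioms _ s A_finite, symmetric])
      (use incl_closed A_carrier fD(3) in auto)
  finally show ?thesis ..
qed

text \<open>The free \<open>S\<close>-module on the set \<open>K\<close> mapped to
  \<open>S^A\<close>; its image is \<open>K S\<close>.\<close>

abbreviation rel_map :: "(('m \<Rightarrow> 'a) \<Rightarrow> 's) \<Rightarrow> 'm \<Rightarrow> 's"
  where "rel_map \<equiv> linear_extension S (free_module S A) (\<lambda>x. \<phi> \<circ> x)"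

lemma rel_map_hom: "rel_map \<in> module_hom S (free_module S (relations R M A)) (free_module S A)"
  by (rule linear_extension_hom[OF FS.module_axioms]) (use comp_closed in \<open>auto simp: relations_def\<close>)

text \<open>Right exactness of the tensor product for
  \<open>K \<rightarrow> R^A \<rightarrow> M\<close>. Lifting \<open>m \<otimes> t\<close> to
  \<open>t\<close> times the image of a preimage of \<open>m\<close> is well defined modulo
  \<open>K S\<close> and inverts \<open>proj\<close> there, so whatever \<open>proj\<close> kills
  lies in \<open>K S\<close>.\<close>

lemma proj_kernel:
  assumes s: "s \<in> carrier (free_module S A)" and ker: "proj s = \<zero>\<^bsub>P\<^esub>"
  shows "s \<in> rel_map ` carrier (free_module S (relations R M A))"
proof -
  let ?FS = "free_module S A" and ?F = "free_module R A" and ?B = "carrier M \<times> carrier S"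
  define L where "L = rel_map ` carrier (free_module S (relations R M A))"
  have L: "submodule L S ?FS"
    unfolding L_def by (rule submodule_image[OF module_free_module[OF S.is_cring] FS.module_axioms rel_map_hom])
  note LE = FS.submoduleE[OF L]
  note fD = free_module_carrierD[OF S.is_cring s]
  obtain \<tau> where \<tau>: "\<And>x. x \<in> carrier M \<Longrightarrow> \<tau> x \<in> carrier ?F"
    "\<And>x. x \<in> carrier M \<Longrightarrow> lin (\<tau> x) = x" "\<And>a. a \<in> A \<Longrightarrow> \<tau> a = unit_vector R a"
    by (rule lin_section) blast
  \<comment> \<open>Two lifts of the same element of \<open>M\<close> differ by a relation, so any
    choice of lift is harmless modulo \<open>L\<close>.\<close>
  have L_cong: "t \<odot>\<^bsub>?FS\<^esub> (\<phi> \<circ> c) \<ominus>\<^bsub>?FS\<^esub> t \<odot>\<^bsub>?FS\<^esub> (\<phi> \<circ> d) \<in> L"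
    if "c \<in> carrier ?F" "d \<in> carrier ?F" "lin c = lin d" "t \<in> carrier S" for t c d
  proof -
    let ?x = "c \<ominus>\<^bsub>?F\<^esub> d"
    have x: "?x \<in> relations R M A" by (rule relations_diff) fact+
    have "rel_map (unit_vector S ?x) = \<phi> \<circ> ?x"
      by (rule linear_extension_unit_vector[OF FS.module_axioms _ x])
         (use comp_closed in \<open>auto simp: relations_def\<close>)
    hence "\<phi> \<circ> ?x \<in> L" unfolding L_def using unit_vector_closed[OF S.is_cring x] by (metis imageI)
    hence "t \<odot>\<^bsub>?FS\<^esub> (\<phi> \<circ> ?x) \<in> L" using LE that(4) by blast
    moreover have "(\<phi> \<circ> c) = (\<phi> \<circ> ?x) \<oplus>\<^bsub>?FS\<^esub> (\<phi> \<circ> d)"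
      using that by (subst comp_add[symmetric]) (simp_all add: F.M.minus_eq F.M.a_assoc F.M.l_neg)
    moreover have "\<phi> \<circ> ?x \<in> carrier ?FS" "\<phi> \<circ> d \<in> carrier ?FS" using that by (simp_all add: comp_closed)
    ultimately show ?thesis
      using that(4) by (simp add: FS.smult_r_distr FS.M.minus_eq FS.M.a_assoc FS.M.r_neg)
  qed
  let ?f = "\<lambda>(m, s). s \<odot>\<^bsub>?FS\<^esub> (\<phi> \<circ> \<tau> m)"
  have "?f ` ?B \<subseteq> carrier (add_monoid ?FS)" by (auto simp: \<tau>(1) comp_closed)
  then obtain h where h: "h \<in> hom (free_Abelian_group ?B) (add_monoid ?FS)"
    "\<And>x. x \<in> ?B \<Longrightarrow> h (frag_of x) = ?f x"
    using comm_group.free_Abelian_group_universal[OF FS.M.a_comm_group] by blast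
  note hD = hom_free_Abelian_group[OF FS.M.abelian_group_axioms h(1)]
  have hf: "h (frag_of (m, t)) = t \<odot>\<^bsub>?FS\<^esub> (\<phi> \<circ> \<tau> m)" if "m \<in> carrier M" "t \<in> carrier S" for m t
    using h(2)[of "(m, t)"] that by simp
  have tc: "t \<odot>\<^bsub>?FS\<^esub> (\<phi> \<circ> \<tau> m) \<in> carrier ?FS" if "m \<in> carrier M" "t \<in> carrier S" for m t
    using that by (simp add: \<tau>(1) comp_closed)
  \<comment> \<open>\<open>h\<close> induces an inverse of \<open>proj\<close> modulo \<open>L\<close>.\<close>
  have hrel: "h c \<in> L" if "c \<in> tensor_relations R M N" for c
  proof -
    from that consider
      (1) m m' n where "c = frag_of (m \<oplus>\<^bsub>M\<^esub> m', n) - frag_of (m, n) - frag_of (m', n)"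
        "m \<in> carrier M" "m' \<in> carrier M" "n \<in> carrier S"
    | (2) m n n' where "c = frag_of (m, n \<oplus>\<^bsub>S\<^esub> n') - frag_of (m, n) - frag_of (m, n')"
        "m \<in> carrier M" "n \<in> carrier S" "n' \<in> carrier S"
    | (3) r m n where "c = frag_of (r \<odot>\<^bsub>M\<^esub> m, n) - frag_of (m, \<phi> r \<otimes>\<^bsub>S\<^esub> n)"
        "r \<in> carrier R" "m \<in> carrier M" "n \<in> carrier S"
      unfolding tensor_relations_def by (auto simp: restrict_scalars_def)
    thus ?thesis
    proof cases
      case 1
      have "h c = n \<odot>\<^bsub>?FS\<^esub> (\<phi> \<circ> \<tau> (m \<oplus>\<^bsub>M\<^esub> m')) \<ominus>\<^bsub>?FS\<^esub> n \<odot>\<^bsub>?FS\<^esub> (\<phi> \<circ> \<tau> m) \<ominus>\<^bsub>?FS\<^esub> n \<odot>\<^bsub>?FS\<^esub> (\<phi> \<circ> \<tau> m')"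
      proof -
        have "Poly_Mapping.keys (frag_of (m \<oplus>\<^bsub>M\<^esub> m', n) - frag_of (m, n)) \<subseteq> ?B"
          using 1 keys_diff[of "frag_of (m \<oplus>\<^bsub>M\<^esub> m', n)" "frag_of (m, n)"] by auto
        thus ?thesis using 1 by (simp add: hD(5) hf)
      qed
      also have "\<dots> = n \<odot>\<^bsub>?FS\<^esub> (\<phi> \<circ> \<tau> (m \<oplus>\<^bsub>M\<^esub> m')) \<ominus>\<^bsub>?FS\<^esub> n \<odot>\<^bsub>?FS\<^esub> (\<phi> \<circ> (\<tau> m \<oplus>\<^bsub>?F\<^esub> \<tau> m'))"
        using 1 tc[of m n] tc[of m' n] tc[of "m \<oplus>\<^bsub>M\<^esub> m'" n]
        by (simp add: comp_add \<tau>(1) comp_closed FS.smult_r_distr FS.M.minus_eq FS.M.minus_add FS.M.a_assoc)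
      also have "\<dots> \<in> L"
        by (rule L_cong) (use 1 \<tau> linD(2) in simp_all)
      finally show ?thesis .
    next
      \<comment> \<open>The lift \<open>\<tau> m\<close> is the same in all three terms, so the
        value is zero and not merely in \<open>L\<close>.\<close>
      case 2
      have "h c = (n \<oplus>\<^bsub>S\<^esub> n') \<odot>\<^bsub>?FS\<^esub> (\<phi> \<circ> \<tau> m) \<ominus>\<^bsub>?FS\<^esub> n \<odot>\<^bsub>?FS\<^esub> (\<phi> \<circ> \<tau> m) \<ominus>\<^bsub>?FS\<^esub> n' \<odot>\<^bsub>?FS\<^esub> (\<phi> \<circ> \<tau> m)"
      proof -
        have "Poly_Mapping.keys (frag_of (m, n \<oplus>\<^bsub>S\<^esub> n') - frag_of (m, n)) \<subseteq> ?B"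
          using 2 keys_diff[of "frag_of (m, n \<oplus>\<^bsub>S\<^esub> n')" "frag_of (m, n)"] by auto
        thus ?thesis using 2 by (simp add: hD(5) hf)
      qed
      also have "\<dots> = \<zero>\<^bsub>?FS\<^esub>"
        using 2 tc[of m n] tc[of m n']
        by (simp add: \<tau>(1) comp_closed FS.smult_l_distr FS.M.minus_eq FS.M.r_neg FS.M.a_ac)
      finally show ?thesis using LE subgroup.one_closed[OF submodule.axioms(1)[OF L]] by simp
    next
      case 3
      have r: "\<phi> r \<in> carrier S" by (rule ring_hom_closed[OF \<phi>_hom 3(2)])
      have "h c = n \<odot>\<^bsub>?FS\<^esub> (\<phi> \<circ> \<tau> (r \<odot>\<^bsub>M\<^esub> m)) \<ominus>\<^bsub>?FS\<^esub> (\<phi> r \<otimes>\<^bsub>S\<^esub> n) \<odot>\<^bsub>?FS\<^esub> (\<phi> \<circ> \<tau> m)"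
        using 3 r by (simp add: hD(5) hf)
      also have "\<dots> = n \<odot>\<^bsub>?FS\<^esub> (\<phi> \<circ> \<tau> (r \<odot>\<^bsub>M\<^esub> m)) \<ominus>\<^bsub>?FS\<^esub> n \<odot>\<^bsub>?FS\<^esub> (\<phi> \<circ> (r \<odot>\<^bsub>?F\<^esub> \<tau> m))"
        using 3 r by (simp add: comp_smult \<tau>(1) comp_closed FS.smult_assoc1[symmetric] S.m_comm)
      also have "\<dots> \<in> L"
        by (rule L_cong) (use 3 \<tau> linD(3) in simp_all)
      finally show ?thesis .
    qed
  qed
  have hker: "h c \<in> L" if "c \<in> tensor_kernel R M N" for c
    using module_axioms N.module_axioms that
  proof (induction rule: tensor_kernel_induct)
    case zero show ?case using hD(2) subgroup.one_closed[OF submodule.axioms(1)[OF L]] by simp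
  next
    case (neg_rel c)
    have "Poly_Mapping.keys c \<subseteq> ?B"
      using tensor_kernel_closed(5)[OF module_axioms N.module_axioms tensor_kernel_rel[OF neg_rel]] by simp
    thus ?case using hrel[OF neg_rel] LE by (simp add: hD(4))
  next
    case (add c d)
    thus ?case using tensor_kernel_closed(5)[OF module_axioms N.module_axioms] LE by (simp add: hD(3))
  qed (rule hrel)
  let ?c = "\<Sum>a\<in>A. frag_of (a, s a)"
  have keys: "Poly_Mapping.keys (frag_of (a, s a)) \<subseteq> ?B" if "a \<in> A" for a
    using that A_carrier fD(1) by auto
  have "cls ?c = proj s" by (rule proj_eq_cls[OF s, symmetric])
  also have "\<dots> = cls 0" using ker clsD(2) by simp
  finally have c: "?c \<in> tensor_kernel R M N" by (simp add: cls_eq_iff)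
  \<comment> \<open>As \<open>\<tau>\<close> sends generators to basis vectors, \<open>h\<close>
    maps the formal sum of \<open>s\<close> to \<open>s\<close>; the sum lies in the tensor kernel,
    so \<open>s\<close> is in \<open>L\<close>.\<close>
  have "h ?c = (\<Oplus>\<^bsub>?FS\<^esub>a\<in>A. h (frag_of (a, s a)))"
    using hom_free_Abelian_group_sum[OF FS.M.abelian_group_axioms h(1) A_finite, of "\<lambda>a. frag_of (a, s a)"] keys by simp
  also have "\<dots> = (\<Oplus>\<^bsub>?FS\<^esub>a\<in>A. s a \<odot>\<^bsub>?FS\<^esub> unit_vector S a)"
  proof (rule FS.M.finsum_cong'[OF refl])
    show "(\<lambda>a. s a \<odot>\<^bsub>?FS\<^esub> unit_vector S a) \<in> A \<rightarrow> carrier ?FS"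
      by (intro Pi_I FS.smult_closed fD(1) unit_vector_closed[OF S.is_cring])
    fix a assume a: "a \<in> A"
    have "\<phi> \<circ> unit_vector R a = unit_vector S a"
      by (auto simp: unit_vector_def ring_hom_one[OF \<phi>_hom] ring_hom_zero'[OF is_cring S.is_cring \<phi>_hom])
    thus "h (frag_of (a, s a)) = s a \<odot>\<^bsub>?FS\<^esub> unit_vector S a"
      using a A_carrier fD(1) by (subst hf) (auto simp: \<tau>(3))
  qed
  also have "\<dots> = linear_extension S ?FS (unit_vector S) s"
    by (rule linear_extension_eq[OF FS.module_axioms _ s A_finite, symmetric])
      (use unit_vector_closed[OF S.is_cring, where I = A] fD(3) in auto)
  also have "\<dots> = s" by (rule linear_extension_unit_vectors[OF S.is_cring s])
  finally show ?thesis using hker[OF c] by (simp add: L_def)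
qed

end


section \<open>Flatness\<close>

context generated_module
begin

lemma relations_closed: "c \<in> relations R M A \<Longrightarrow> c \<in> carrier (free_module R A)"
  by (simp add: relations_def)

lemma linear_extension_lin:
  assumes "v \<in> I \<rightarrow> carrier (free_module R A)" "c \<in> carrier (free_module R I)"
  shows "lin (linear_extension R (free_module R A) v c) = linear_extension R M (\<lambda>i. lin (v i)) c"
  using module_hom_linear_extension[OF F.module_axioms module_axioms lin_hom assms] by (simp add: comp_def)

text \<open>
  The equational criterion for flatness: with \<open>I\<close> the ideal generated by the coefficients of
  \<open>f\<close>, the tensor \<open>\<Sum> a \<otimes> f a\<close> vanishes in \<open>M \<otimes> R\<close>, hence in \<open>M \<otimes> I\<close>.
\<close>

lemma flat_equational:
  assumes flat: "flat_module R M" and f: "f \<in> relations R M A"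
  shows "\<exists>B \<in> A \<rightarrow> carrier (free_module R A). \<exists>D \<in> A \<rightarrow> carrier (free_module R A).
    (\<forall>a \<in> A. lin (B a) = lin (D a)) \<and>
    linear_extension R (free_module R A) B f = \<zero>\<^bsub>free_module R A\<^esub> \<and>
    linear_extension R (free_module R A) D f = f"
proof -
  let ?F = "free_module R A" and ?RR = "regular_module R"
  interpret RR: module R ?RR by (rule module_regular_module[OF is_cring])
  note fF = relations_closed[OF f]
  have f0: "lin f = \<zero>\<^bsub>M\<^esub>" using f by (simp add: relations_def)
  note fD = free_module_carrierD[OF is_cring fF]
  note uv = unit_vector_closed[OF is_cring, where I = A]
  \<comment> \<open>Pairing with \<open>f\<close>: its image is the ideal generated by the
    coefficients of \<open>f\<close>, and its kernel consists of the syzygies of these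
    coefficients.\<close>
  let ?\<epsilon> = "linear_extension R ?RR f"
  have \<epsilon>: "?\<epsilon> \<in> module_hom R ?F ?RR"
    by (rule linear_extension_hom[OF RR.module_axioms]) (use fD(1) in auto)
  note \<epsilon>D = module_homD[OF \<epsilon>, unfolded regular_module_simps]
  define I where "I = ?\<epsilon> ` carrier ?F"
  have I: "submodule I R ?RR" unfolding I_def by (rule submodule_image[OF F.module_axioms RR.module_axioms \<epsilon>])
  note IE = RR.submoduleE[OF I]
  let ?NI = "?RR\<lparr>carrier := I\<rparr>"
  have mI: "module R ?NI" using submodule.submodule_is_module[OF I RR.module_axioms] .
  have cI: "carrier ?NI = I" by simp
  have Isub: "I \<subseteq> carrier R" using IE(1) by simp
  have incl: "(\<lambda>x. x) \<in> module_hom R ?NI ?RR" by (rule module_hom_inclusion) (use Isub in simp)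
  have inj: "c \<in> tensor_kernel R M ?NI"
    if "Poly_Mapping.keys c \<subseteq> carrier M \<times> I" "tensor_push (\<lambda>x. x) c \<in> tensor_kernel R M ?RR" for c
    using flat_module_inj[OF flat mI RR.module_axioms incl] that
    unfolding tensor_map_inj_iff[OF module_axioms mI RR.module_axioms incl] by simp
  \<comment> \<open>The trivial base change, with \<open>S = R\<close>: it shows
    \<open>\<Sum> a \<otimes> f a = lin f \<otimes> 1 = 0\<close> in
    \<open>M \<otimes> R\<close>.\<close>
  interpret E: scalar_extension R M A R "\<lambda>x. x"
    by unfold_locales (auto intro: ring_hom_memI)
  let ?z = "\<Sum>a\<in>A. frag_of (a, f a)"
  have "E.cls ?z = \<zero>\<^bsub>E.P\<^esub>"
    using E.proj_eq_cls[OF fF] E.proj_comp[OF fF] E.incl_zero f0 by (simp add: comp_def)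
  hence zR: "?z \<in> tensor_kernel R M ?RR"
    using E.cls_eq_iff[of ?z 0] E.clsD(2) by simp
  have fI: "f a \<in> I" if "a \<in> A" for a
  proof -
    have "?\<epsilon> (unit_vector R a) = f a"
      by (rule linear_extension_unit_vector[OF RR.module_axioms _ that]) (use fD(1) in auto)
    thus ?thesis unfolding I_def using uv[OF that] by (metis imageI)
  qed
  have keys: "Poly_Mapping.keys (frag_of (a, f a)) \<subseteq> carrier M \<times> I" if "a \<in> A" for a
    using that A_carrier fI by auto
  have keysz: "Poly_Mapping.keys ?z \<subseteq> carrier M \<times> I"
    by (rule order.trans[OF keys_sum]) (use keys in blast)
  have z: "?z \<in> tensor_kernel R M ?NI"
    by (rule inj[OF keysz]) (use zR in \<open>simp add: tensor_push_id\<close>)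
  obtain \<tau> where \<tau>: "\<And>x. x \<in> carrier M \<Longrightarrow> \<tau> x \<in> carrier ?F"
    "\<And>x. x \<in> carrier M \<Longrightarrow> lin (\<tau> x) = x" "\<And>a. a \<in> A \<Longrightarrow> \<tau> a = unit_vector R a"
    by (rule lin_section) blast
  \<comment> \<open>\<open>\<sigma> n\<close> writes \<open>n\<close> as a combination of the
    coefficients of \<open>f\<close>. It is not additive; its defects lie in the kernel of
    \<open>?\<epsilon>\<close>.\<close>
  have "\<exists>s \<in> carrier ?F. ?\<epsilon> s = n" if "n \<in> I" for n using that unfolding I_def by auto
  then obtain \<sigma> where \<sigma>: "\<And>n. n \<in> I \<Longrightarrow> \<sigma> n \<in> carrier ?F" "\<And>n. n \<in> I \<Longrightarrow> ?\<epsilon> (\<sigma> n) = n" by metis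
  have \<sigma>R: "\<sigma> n a \<in> carrier R" if "n \<in> I" for n a by (rule free_module_carrierD(1)[OF is_cring \<sigma>(1)[OF that]])
  \<comment> \<open>\<open>h a\<close> is coordinate \<open>a\<close> of the lift of
    \<open>m \<otimes> n\<close> from \<open>M \<otimes> I\<close> to \<open>M^A\<close> along
    \<open>\<sigma>\<close>, defined on formal sums only.\<close>
  have "\<exists>h. h \<in> hom (free_Abelian_group (carrier M \<times> I)) (add_monoid M) \<and>
      (\<forall>m \<in> carrier M. \<forall>n \<in> I. h (frag_of (m, n)) = \<sigma> n a \<odot>\<^bsub>M\<^esub> m)" for a
  proof -
    let ?g = "\<lambda>(m, n). \<sigma> n a \<odot>\<^bsub>M\<^esub> m"
    have "?g ` (carrier M \<times> I) \<subseteq> carrier (add_monoid M)" using \<sigma>R by auto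
    then obtain h where "h \<in> hom (free_Abelian_group (carrier M \<times> I)) (add_monoid M)"
      "\<And>x. x \<in> carrier M \<times> I \<Longrightarrow> h (frag_of x) = ?g x"
      using comm_group.free_Abelian_group_universal[OF M.a_comm_group] by blast
    thus ?thesis by (intro exI[of _ h]) auto
  qed
  then obtain h where h: "\<And>a. h a \<in> hom (free_Abelian_group (carrier M \<times> I)) (add_monoid M)"
    "\<And>a m n. m \<in> carrier M \<Longrightarrow> n \<in> I \<Longrightarrow> h a (frag_of (m, n)) = \<sigma> n a \<odot>\<^bsub>M\<^esub> m"
    by metis
  note hD = hom_free_Abelian_group[OF M.abelian_group_axioms h(1)]
  \<comment> \<open>\<open>Q c\<close> says that \<open>h\<close> maps \<open>c\<close> into the image of \<open>M \<otimes> ker \<epsilon>\<close> in \<open>M \<otimes> R\<^sup>A = M\<^sup>A\<close>, so the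
      kernel of the tensor product is sent there by right exactness.\<close>
  define Q where "Q c \<longleftrightarrow> (\<exists>B \<in> A \<rightarrow> carrier ?F. (\<forall>a \<in> A. lin (B a) = h a c) \<and>
    linear_extension R ?F B f = \<zero>\<^bsub>?F\<^esub>)" for c
  \<comment> \<open>This is the tensor of \<open>m\<close> with a syzygy \<open>\<alpha>\<close>.
    Its coordinates \<open>\<alpha> a \<odot> m\<close> lift to
    \<open>\<alpha> a \<odot> \<tau> m\<close>, and combining these with coefficients
    \<open>f a\<close> gives \<open>?\<epsilon> \<alpha>\<close> times \<open>\<tau> m\<close>,
    which is zero.\<close>
  have rank_one: "Q c" if \<alpha>: "\<alpha> \<in> carrier ?F" "?\<epsilon> \<alpha> = \<zero>\<^bsub>R\<^esub>" and m: "m \<in> carrier M"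
    and hc: "\<And>a. h a c = \<alpha> a \<odot>\<^bsub>M\<^esub> m" for c \<alpha> m
  proof -
    let ?B = "\<lambda>a. \<alpha> a \<odot>\<^bsub>?F\<^esub> \<tau> m"
    note \<alpha>R = free_module_carrierD(1)[OF is_cring \<alpha>(1)]
    have g: "(\<lambda>r. r \<odot>\<^bsub>?F\<^esub> \<tau> m) \<in> module_hom R ?RR ?F"
      using \<tau>(1)[OF m] by (intro module_homI) (auto simp: F.smult_l_distr F.smult_assoc1)
    have "linear_extension R ?F ?B f = linear_extension R ?RR \<alpha> f \<odot>\<^bsub>?F\<^esub> \<tau> m"
      using module_hom_linear_extension[OF RR.module_axioms F.module_axioms g _ fF, of \<alpha>] \<alpha>R
      by (simp add: comp_def)
    also have "linear_extension R ?RR \<alpha> f = \<zero>\<^bsub>R\<^esub>"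
      using \<alpha>(2) linear_extension_regular_commute[OF is_cring \<alpha>(1) fF] by simp
    finally have "linear_extension R ?F ?B f = \<zero>\<^bsub>?F\<^esub>" using \<tau>(1)[OF m] by simp
    moreover have "lin (?B a) = h a c" for a
      using \<alpha>R \<tau>(1,2)[OF m] m by (simp add: linD(3) hc)
    ultimately show ?thesis
      unfolding Q_def using \<alpha>R \<tau>(1)[OF m] by (intro bexI[of _ ?B]) auto
  qed
  \<comment> \<open>\<open>\<alpha>\<close> is zero or the defect of \<open>\<sigma>\<close> against
    addition or scalars, which \<open>?\<epsilon>\<close> kills. The pair \<open>\<alpha>\<close>,
    \<open>m\<close> is returned in place of \<open>Q c\<close> so that the negative of a relation
    can be treated by replacing \<open>m\<close> with its negative.\<close>
  have rel: "\<exists>\<alpha> m. \<alpha> \<in> carrier ?F \<and> ?\<epsilon> \<alpha> = \<zero>\<^bsub>R\<^esub> \<and> m \<in> carrier M \<and> (\<forall>a. h a c = \<alpha> a \<odot>\<^bsub>M\<^esub> m)"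
    if "c \<in> tensor_relations R M ?NI" for c
  proof -
    from that consider
      (1) m m' n where "c = frag_of (m \<oplus>\<^bsub>M\<^esub> m', n) - frag_of (m, n) - frag_of (m', n)"
        "m \<in> carrier M" "m' \<in> carrier M" "n \<in> I"
    | (2) m n n' where "c = frag_of (m, n \<oplus>\<^bsub>R\<^esub> n') - frag_of (m, n) - frag_of (m, n')"
        "m \<in> carrier M" "n \<in> I" "n' \<in> I"
    | (3) r m n where "c = frag_of (r \<odot>\<^bsub>M\<^esub> m, n) - frag_of (m, r \<otimes>\<^bsub>R\<^esub> n)"
        "r \<in> carrier R" "m \<in> carrier M" "n \<in> I"
      unfolding tensor_relations_def by (auto simp: restrict_scalars_def)
    thus ?thesis
    proof cases
      case 1
      have "Poly_Mapping.keys (frag_of (m \<oplus>\<^bsub>M\<^esub> m', n) - frag_of (m, n)) \<subseteq> carrier M \<times> I"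
        using 1 keys_diff[of "frag_of (m \<oplus>\<^bsub>M\<^esub> m', n)" "frag_of (m, n)"] by auto
      hence "h a c = \<zero>\<^bsub>M\<^esub>" for a
        using 1 \<sigma>R[OF 1(4)]
        by (simp add: hD(5) h(2) smult_r_distr M.minus_eq M.r_neg M.a_ac)
      thus ?thesis
        using module_hom_zero[OF F.module_axioms RR.module_axioms \<epsilon>]
        by (intro exI[of _ "\<zero>\<^bsub>?F\<^esub>"] exI[of _ "\<zero>\<^bsub>M\<^esub>"] conjI F.M.zero_closed M.zero_closed)
           (simp_all add: free_module_simps)
    next
      case 2
      have n: "n \<oplus>\<^bsub>R\<^esub> n' \<in> I" using 2 IE(5)[of n n'] by simp
      have nR: "n \<in> carrier R" "n' \<in> carrier R" using 2 Isub by auto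
      let ?\<alpha> = "\<sigma> (n \<oplus>\<^bsub>R\<^esub> n') \<oplus>\<^bsub>?F\<^esub> (\<ominus>\<^bsub>R\<^esub> \<one>\<^bsub>R\<^esub>) \<odot>\<^bsub>?F\<^esub> (\<sigma> n \<oplus>\<^bsub>?F\<^esub> \<sigma> n')"
      have "?\<epsilon> ?\<alpha> = \<zero>\<^bsub>R\<^esub>"
        using 2 n nR R.r_neg[of "n \<oplus>\<^bsub>R\<^esub> n'"] by (simp add: \<epsilon>D \<sigma> R.l_minus)
      moreover have "Poly_Mapping.keys (frag_of (m, n \<oplus>\<^bsub>R\<^esub> n') - frag_of (m, n)) \<subseteq> carrier M \<times> I"
        using 2 n keys_diff[of "frag_of (m, n \<oplus>\<^bsub>R\<^esub> n')" "frag_of (m, n)"] by auto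
      hence "h a c = ?\<alpha> a \<odot>\<^bsub>M\<^esub> m" for a
        using 2 n \<sigma>R[OF 2(3)] \<sigma>R[OF 2(4)] \<sigma>R[OF n]
        by (simp add: hD(5) h(2) free_module_simps smult_l_distr smult_l_minus R.l_minus M.minus_eq
            M.minus_add M.a_ac R.minus_add)
      ultimately show ?thesis using 2 n \<sigma>(1) by (intro exI[of _ ?\<alpha>] exI[of _ m]) simp
    next
      case 3
      have n: "r \<otimes>\<^bsub>R\<^esub> n \<in> I" using 3 IE(4)[of r n] by simp
      have nR: "n \<in> carrier R" using 3 Isub by auto
      let ?\<alpha> = "r \<odot>\<^bsub>?F\<^esub> \<sigma> n \<oplus>\<^bsub>?F\<^esub> (\<ominus>\<^bsub>R\<^esub> \<one>\<^bsub>R\<^esub>) \<odot>\<^bsub>?F\<^esub> \<sigma> (r \<otimes>\<^bsub>R\<^esub> n)"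
      have "?\<epsilon> ?\<alpha> = \<zero>\<^bsub>R\<^esub>"
        using 3 n nR R.r_neg[of "r \<otimes>\<^bsub>R\<^esub> n"] by (simp add: \<epsilon>D \<sigma> R.l_minus)
      moreover have "h a c = ?\<alpha> a \<odot>\<^bsub>M\<^esub> m" for a
        using 3 n \<sigma>R[OF 3(4)] \<sigma>R[OF n]
        by (simp add: hD(5) h(2) free_module_simps smult_l_distr smult_l_minus R.l_minus M.minus_eq
            smult_assoc1[symmetric] m_comm)
      ultimately show ?thesis using 3 n \<sigma>(1) by (intro exI[of _ ?\<alpha>] exI[of _ m]) simp
    qed
  qed
  have "Q ?z" using module_axioms mI z
  proof (induction rule: tensor_kernel_induct)
    case zero
    show ?case
      by (rule rank_one[of "\<zero>\<^bsub>?F\<^esub>" "\<zero>\<^bsub>M\<^esub>"])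
        (use module_hom_zero[OF F.module_axioms RR.module_axioms \<epsilon>] F.M.zero_closed hD(2) in
          \<open>auto simp: free_module_simps\<close>)
  next
    case (rel c) with \<open>\<And>c. c \<in> tensor_relations R M ?NI \<Longrightarrow> _\<close> show ?case using rank_one by blast
  next
    case (neg_rel c)
    then obtain \<alpha> m where *: "\<alpha> \<in> carrier ?F" "?\<epsilon> \<alpha> = \<zero>\<^bsub>R\<^esub>" "m \<in> carrier M" "\<And>a. h a c = \<alpha> a \<odot>\<^bsub>M\<^esub> m"
      using rel by blast
    have "Poly_Mapping.keys c \<subseteq> carrier M \<times> I"
      using tensor_kernel_closed(5)[OF module_axioms mI tensor_kernel_rel[OF neg_rel]] by simp
    hence "h a (- c) = \<alpha> a \<odot>\<^bsub>M\<^esub> (\<ominus>\<^bsub>M\<^esub> m)" for a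
      using * free_module_carrierD(1)[OF is_cring *(1)] by (simp add: hD(4) smult_r_minus)
    thus ?case using * by (intro rank_one[of \<alpha> "\<ominus>\<^bsub>M\<^esub> m"]) auto
  next
    case (add c d)
    then obtain B B' where B: "B \<in> A \<rightarrow> carrier ?F" "\<forall>a \<in> A. lin (B a) = h a c"
        "linear_extension R ?F B f = \<zero>\<^bsub>?F\<^esub>"
      and B': "B' \<in> A \<rightarrow> carrier ?F" "\<forall>a \<in> A. lin (B' a) = h a d"
        "linear_extension R ?F B' f = \<zero>\<^bsub>?F\<^esub>" unfolding Q_def by blast
    let ?C = "\<lambda>a. B a \<oplus>\<^bsub>?F\<^esub> B' a"
    have C: "?C \<in> A \<rightarrow> carrier ?F" using B(1) B'(1) by auto
    have hom: "linear_extension R ?F V \<in> module_hom R ?F ?F" if "V \<in> A \<rightarrow> carrier ?F" for V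
      by (rule linear_extension_hom[OF F.module_axioms that])
    \<comment> \<open>Additivity in the family of vectors: the sum of the linear maps given by
      \<open>B\<close> and \<open>B'\<close> is linear and has the values \<open>?C\<close> on the
      basis.\<close>
    have "linear_extension R ?F ?C f = linear_extension R ?F
      ((\<lambda>x. linear_extension R ?F B x \<oplus>\<^bsub>?F\<^esub> linear_extension R ?F B' x) \<circ> unit_vector R) f"
      by (rule linear_extension_cong[OF F.module_axioms fF])
         (use B(1) B'(1) uv module_homD(1)[OF hom] in
            \<open>auto simp: linear_extension_unit_vector[OF F.module_axioms] Pi_iff\<close>)
    also have "\<dots> = linear_extension R ?F B f \<oplus>\<^bsub>?F\<^esub> linear_extension R ?F B' f"
      by (rule module_hom_free_module_eq[OF F.module_axioms _ fF, symmetric])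
        (intro module_hom_add F.module_axioms hom B B')
    finally have "linear_extension R ?F ?C f = \<zero>\<^bsub>?F\<^esub>" by (simp only: B B' F.M.l_zero F.M.zero_closed)
    moreover have "lin (?C a) = h a (c + d)" if "a \<in> A" for a
      using that B B' tensor_kernel_closed(5)[OF module_axioms mI add(1)]
        tensor_kernel_closed(5)[OF module_axioms mI add(2)]
      by (auto simp: linD(2) hD(3) Pi_iff)
    ultimately show ?case unfolding Q_def using C by (intro bexI[of _ ?C]) auto
  qed
  then obtain B where B: "B \<in> A \<rightarrow> carrier ?F" "\<And>a. a \<in> A \<Longrightarrow> lin (B a) = h a ?z"
    "linear_extension R ?F B f = \<zero>\<^bsub>?F\<^esub>" unfolding Q_def by blast
  \<comment> \<open>The matrix of the chosen expressions of the \<open>f b\<close>, transposed: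
    coordinate \<open>b\<close> of \<open>D\<close> applied to \<open>f\<close> is
    \<open>?\<epsilon> (\<sigma> (f b)) = f b\<close>, while \<open>lin (D a)\<close> is
    \<open>h a\<close> of the formal sum and so equals \<open>lin (B a)\<close>.\<close>
  define D where "D a = (\<lambda>b. if b \<in> A then \<sigma> (f b) a else \<zero>\<^bsub>R\<^esub>)" for a
  have D: "D a \<in> carrier ?F" for a
    using A_finite fI \<sigma>R by (auto simp: D_def free_module_def)
  have hz: "h a ?z = lin (D a)" for a
  proof -
    have "h a ?z = (\<Oplus>\<^bsub>M\<^esub>b\<in>A. h a (frag_of (b, f b)))"
      using hom_free_Abelian_group_sum[OF M.abelian_group_axioms h(1) A_finite, of "\<lambda>a. frag_of (a, f a)"] keys
      by simp
    also have "\<dots> = (\<Oplus>\<^bsub>M\<^esub>b\<in>A. D a b \<odot>\<^bsub>M\<^esub> b)"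
      by (rule M.finsum_cong'[OF refl]) (use A_carrier fI \<sigma>R in \<open>auto simp: h(2) D_def\<close>)
    also have "\<dots> = lin (D a)"
      by (rule linear_extension_eq[OF module_axioms _ D A_finite, symmetric])
        (use A_carrier in \<open>auto simp: D_def\<close>)
    finally show ?thesis .
  qed
  have Df: "linear_extension R ?F D f = f"
  proof
    fix b
    have DA: "D \<in> A \<rightarrow> carrier ?F" using D by auto
    show "linear_extension R ?F D f b = f b"
    proof (cases "b \<in> A")
      case True
      have "linear_extension R ?F D f b = linear_extension R ?RR (\<lambda>a. D a b) f"
        by (rule linear_extension_apply[OF is_cring DA fF])
      also have "(\<lambda>a. D a b) = \<sigma> (f b)" using True by (auto simp: D_def)
      also have "linear_extension R ?RR (\<sigma> (f b)) f = ?\<epsilon> (\<sigma> (f b))"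
        by (rule linear_extension_regular_commute[OF is_cring \<sigma>(1) fF]) (rule fI[OF True])
      also have "\<dots> = f b" by (rule \<sigma>(2)[OF fI[OF True]])
      finally show ?thesis .
    next
      case False
      have "linear_extension R ?F D f \<in> carrier ?F"
        by (rule module_homD(1)[OF linear_extension_hom[OF F.module_axioms DA] fF])
      thus ?thesis using False fF by (auto simp: free_module_def)
    qed
  qed
  show ?thesis using B D Df hz by (intro bexI[of _ B] bexI[of _ D]) auto
qed

text \<open>\<open>B\<close> and \<open>D\<close> send each basis vector to two lifts of one element
  of \<open>M\<close>, so \<open>D - B\<close> takes values in the relations; it maps
  \<open>f\<close> to \<open>f - 0\<close>.\<close>

lemma flat_retract_one:
  assumes "flat_module R M" "f \<in> relations R M A"
  shows "\<exists>E \<in> module_hom R (free_module R A) (free_module R A).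
    (\<forall>x \<in> carrier (free_module R A). E x \<in> relations R M A) \<and> E f = f"
proof -
  let ?F = "free_module R A"
  from flat_equational[OF assms] obtain B D where B: "B \<in> A \<rightarrow> carrier ?F" and D: "D \<in> A \<rightarrow> carrier ?F"
    and BD: "\<And>a. a \<in> A \<Longrightarrow> lin (B a) = lin (D a)"
    and Bf: "linear_extension R ?F B f = \<zero>\<^bsub>?F\<^esub>" and Df: "linear_extension R ?F D f = f" by blast
  let ?E = "\<lambda>x. linear_extension R ?F D x \<ominus>\<^bsub>?F\<^esub> linear_extension R ?F B x"
  have homB: "linear_extension R ?F B \<in> module_hom R ?F ?F" and homD: "linear_extension R ?F D \<in> module_hom R ?F ?F"
    by (rule linear_extension_hom[OF F.module_axioms]; fact)+
  have "?E x \<in> relations R M A" if x: "x \<in> carrier ?F" for x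
  proof (rule relations_diff)
    have "lin (linear_extension R ?F D x) = linear_extension R M (\<lambda>a. lin (D a)) x"
      by (rule linear_extension_lin[OF D x])
    also have "\<dots> = linear_extension R M (\<lambda>a. lin (B a)) x"
      by (rule linear_extension_cong[OF module_axioms x]) (use BD B D linD(1) in \<open>auto simp: Pi_iff\<close>)
    also have "\<dots> = lin (linear_extension R ?F B x)"
      by (rule linear_extension_lin[OF B x, symmetric])
    finally show "lin (linear_extension R ?F D x) = lin (linear_extension R ?F B x)" .
  qed (use module_homD(1)[OF homB x] module_homD(1)[OF homD x] in auto)
  moreover have "?E f = f"
    using relations_closed[OF assms(2)] F.M.minus_equality[OF F.M.l_zero[OF F.M.zero_closed]]
    by (simp add: Bf Df F.M.minus_eq)
  ultimately show ?thesis
    by (intro bexI[of _ ?E]) (auto intro: module_hom_minus[OF F.module_axioms homD homB])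
qed

text \<open>Relations are added one at a time. If \<open>E1\<close> fixes \<open>T\<close>, the
  remainder \<open>f - E1 f\<close> is again a relation, and a second map fixing it corrects
  \<open>E1\<close> at \<open>f\<close> without disturbing \<open>T\<close>, whose remainders are
  zero.\<close>

lemma flat_retract:
  assumes flat: "flat_module R M" and "finite T" "T \<subseteq> relations R M A"
  shows "\<exists>E \<in> module_hom R (free_module R A) (free_module R A).
    (\<forall>x \<in> carrier (free_module R A). E x \<in> relations R M A) \<and> (\<forall>f \<in> T. E f = f)"
  using assms(2,3)
proof (induction rule: finite_induct)
  \<comment> \<open>Any map into the relations serves; the one belonging to the zero relation is at
    hand.\<close>
  case empty
  have "\<zero>\<^bsub>free_module R A\<^esub> \<in> relations R M A"
    using module_hom_zero[OF F.module_axioms module_axioms lin_hom] F.M.zero_closed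
    by (simp add: relations_def)
  thus ?case using flat_retract_one[OF flat] by blast
next
  let ?F = "free_module R A"
  case (insert f T)
  then obtain E1 where E1: "E1 \<in> module_hom R ?F ?F" "\<And>x. x \<in> carrier ?F \<Longrightarrow> E1 x \<in> relations R M A"
    "\<And>g. g \<in> T \<Longrightarrow> E1 g = g" by auto
  have f: "f \<in> carrier ?F" "lin f = \<zero>\<^bsub>M\<^esub>" using insert by (auto simp: relations_def)
  have "f \<ominus>\<^bsub>?F\<^esub> E1 f \<in> relations R M A"
    using f E1(2)[OF f(1)] by (intro relations_diff) (auto simp: relations_def)
  from flat_retract_one[OF flat this] obtain E2 where E2: "E2 \<in> module_hom R ?F ?F"
    "\<And>x. x \<in> carrier ?F \<Longrightarrow> E2 x \<in> relations R M A" "E2 (f \<ominus>\<^bsub>?F\<^esub> E1 f) = f \<ominus>\<^bsub>?F\<^esub> E1 f" by blast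
  have id: "(\<lambda>x. x) \<in> module_hom R ?F ?F" by (rule module_homI) auto
  note E1c = module_homD(1)[OF E1(1)] and E2c = module_homD(1)[OF E2(1)]
  \<comment> \<open>The map with \<open>1 - E = (1 - E2) (1 - E1)\<close>.\<close>
  let ?E = "\<lambda>x. E1 x \<oplus>\<^bsub>?F\<^esub> E2 (x \<ominus>\<^bsub>?F\<^esub> E1 x)"
  have "?E \<in> module_hom R ?F ?F"
    by (intro module_hom_add F.module_axioms E1(1) module_hom_compose[OF module_hom_minus[OF F.module_axioms id E1(1)] E2(1)])
  moreover have "?E x \<in> relations R M A" if x: "x \<in> carrier ?F" for x
  proof -
    have "x \<ominus>\<^bsub>?F\<^esub> E1 x \<in> carrier ?F" using x E1c by simp
    from E2(2)[OF this] E1(2)[OF x] show ?thesis by (simp add: relations_def linD(2))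
  qed
  moreover have "?E g = g" if "g \<in> insert f T" for g
  proof -
    have g: "g \<in> carrier ?F" using that insert.prems relations_closed by auto
    have "E2 (g \<ominus>\<^bsub>?F\<^esub> E1 g) = g \<ominus>\<^bsub>?F\<^esub> E1 g"
    proof (cases "g = f")
      case False
      hence "g \<ominus>\<^bsub>?F\<^esub> E1 g = \<zero>\<^bsub>?F\<^esub>" using that E1(3) g by (simp add: F.M.minus_eq F.M.r_neg)
      thus ?thesis using module_hom_zero[OF F.module_axioms F.module_axioms E2(1)] by simp
    qed (use E2(3) in simp)
    moreover have "E1 g \<oplus>\<^bsub>?F\<^esub> (g \<ominus>\<^bsub>?F\<^esub> E1 g) = g"
      using g E1c[OF g] by (simp add: F.M.minus_eq F.M.a_lcomm F.M.r_neg)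
    ultimately show ?thesis by simp
  qed
  ultimately show ?case by (intro bexI[of _ ?E]) simp_all
qed

end


section \<open>Projectivity of base changes\<close>

context scalar_extension
begin

lemma proj_relation: "x \<in> relations R M A \<Longrightarrow> proj (\<phi> \<circ> x) = \<zero>\<^bsub>P\<^esub>"
  by (simp add: relations_def proj_comp incl_zero)

lemma comp_relation: "x \<in> relations R M A \<Longrightarrow> \<phi> \<circ> x \<in> carrier (free_module S A)"
  by (simp add: relations_def comp_closed)

text \<open>\<open>E \<otimes> S\<close> on \<open>S^A\<close>: the matrix of \<open>E\<close> with
  \<open>\<phi>\<close> applied to its entries.\<close>

abbreviation extend :: "(('m \<Rightarrow> 'a) \<Rightarrow> ('m \<Rightarrow> 'a)) \<Rightarrow> ('m \<Rightarrow> 's) \<Rightarrow> ('m \<Rightarrow> 's)"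
  where "extend E \<equiv> linear_extension S (free_module S A) (\<lambda>a. \<phi> \<circ> E (unit_vector R a))"

lemma
  assumes E: "E \<in> module_hom R (free_module R A) (free_module R A)"
  shows extend_hom: "extend E \<in> module_hom S (free_module S A) (free_module S A)"
    and extend_comp: "x \<in> carrier (free_module R A) \<Longrightarrow> extend E (\<phi> \<circ> x) = \<phi> \<circ> E x"
proof -
  let ?F = "free_module R A"
  note uv = unit_vector_closed[OF is_cring, where I = A]
  note ED = module_homD[OF E]
  show "extend E \<in> module_hom S (free_module S A) (free_module S A)"
    by (rule linear_extension_hom[OF FS.module_axioms]) (auto intro!: comp_closed ED(1) uv)
  assume x: "x \<in> carrier ?F"
  have "\<phi> \<circ> E (linear_extension R ?F (unit_vector R) x) = extend E (\<phi> \<circ> x)"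
    by (subst semilinear_linear_extension[OF F.module_axioms FS.module_axioms \<phi>_hom, of "\<lambda>x. \<phi> \<circ> E x" _ A])
      (auto intro!: comp_closed ED(1) uv x simp: ED comp_add comp_smult, simp add: comp_def)
  thus "extend E (\<phi> \<circ> x) = \<phi> \<circ> E x" by (simp add: linear_extension_unit_vectors[OF is_cring x])
qed

text \<open>Only relations in the support of \<open>c\<close> have to be fixed. This covers both
  uses: a finite set fixed exactly, and all relations fixed up to \<open>\<phi>\<close>.\<close>

lemma extend_rel_map:
  assumes E: "E \<in> module_hom R (free_module R A) (free_module R A)"
    and c: "c \<in> carrier (free_module S (relations R M A))"
    and fixed: "\<And>x. x \<in> relations R M A \<Longrightarrow> c x \<noteq> \<zero>\<^bsub>S\<^esub> \<Longrightarrow> \<phi> \<circ> E x = \<phi> \<circ> x"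
  shows "extend E (rel_map c) = rel_map c"
proof -
  have "extend E (rel_map c) = linear_extension S (free_module S A) (extend E \<circ> (\<lambda>x. \<phi> \<circ> x)) c"
    by (rule module_hom_linear_extension[OF FS.module_axioms FS.module_axioms extend_hom[OF E] _ c])
      (auto intro: comp_relation)
  also have "\<dots> = rel_map c"
    by (rule linear_extension_cong[OF FS.module_axioms c])
      (auto intro: comp_relation simp: extend_comp[OF E] fixed relations_closed)
  finally show ?thesis .
qed

text \<open>\<open>E\<close> is a matrix over \<open>R\<close>, so on the right \<open>S\<close>
  occurs only in equations between images under \<open>\<phi>\<close>; this form makes different
  rings comparable.\<close>

proposition projective_base_change_iff:
  assumes flat: "flat_module R M"
  shows "projective_module S P \<longleftrightarrow>
    (\<exists>E \<in> module_hom R (free_module R A) (free_module R A).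
      (\<forall>x \<in> carrier (free_module R A). E x \<in> relations R M A) \<and>
      (\<forall>x \<in> relations R M A. \<phi> \<circ> E x = \<phi> \<circ> x))"
    (is "?l \<longleftrightarrow> (\<exists>E \<in> _. ?r E)")
proof
  let ?FS = "free_module S A"
  assume ?l
  note uv = unit_vector_closed[OF S.is_cring, where I = A]
  note pD = module_homD[OF proj_hom]
  have id: "(\<lambda>x. x) \<in> module_hom S P P" "(\<lambda>x. x) \<in> module_hom S ?FS ?FS" by (rule module_homI; simp)+
  from projective_module_lift[OF \<open>?l\<close> FS.module_axioms P.module_axioms proj_hom proj_surj id(1)]
  obtain \<sigma> where \<sigma>: "\<sigma> \<in> module_hom S P ?FS" "\<And>x. x \<in> carrier P \<Longrightarrow> proj (\<sigma> x) = x" by blast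
  \<comment> \<open>The projection of \<open>S^A\<close> onto the kernel of \<open>proj\<close>
    along the section \<open>\<sigma>\<close>.\<close>
  define w where "w = (\<lambda>s. s \<ominus>\<^bsub>?FS\<^esub> \<sigma> (proj s))"
  have w: "w \<in> module_hom S ?FS ?FS"
    unfolding w_def by (rule module_hom_minus[OF FS.module_axioms id(2) module_hom_compose[OF proj_hom \<sigma>(1)]])
  have "w (unit_vector S a) \<in> rel_map ` carrier (free_module S (relations R M A))" if "a \<in> A" for a
  proof (rule proj_kernel)
    show "w (unit_vector S a) \<in> carrier ?FS" using module_homD(1)[OF w] uv that by blast
    show "proj (w (unit_vector S a)) = \<zero>\<^bsub>P\<^esub>"
      unfolding w_def using uv[OF that] pD(1)[OF uv[OF that]] module_homD(1)[OF \<sigma>(1)]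
      by (simp add: module_hom_diff[OF FS.module_axioms P.module_axioms proj_hom] \<sigma>(2) P.M.minus_eq P.M.r_neg)
  qed
  hence "\<exists>c. c \<in> carrier (free_module S (relations R M A)) \<and> w (unit_vector S a) = rel_map c" if "a \<in> A" for a
    using that by blast
  then obtain c where c: "\<And>a. a \<in> A \<Longrightarrow> c a \<in> carrier (free_module S (relations R M A))"
    "\<And>a. a \<in> A \<Longrightarrow> w (unit_vector S a) = rel_map (c a)" by metis
  \<comment> \<open>The relations that occur in the columns of \<open>w\<close>: a finite set, as
    there are finitely many columns, each with finite support.\<close>
  define T where "T = (\<Union>a\<in>A. {x. c a x \<noteq> \<zero>\<^bsub>S\<^esub>})"
  have "finite T" "T \<subseteq> relations R M A"
    unfolding T_def using A_finite free_module_carrierD(2,3)[OF S.is_cring c(1)] by blast+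
  from flat_retract[OF flat this] obtain E where E: "E \<in> module_hom R (free_module R A) (free_module R A)"
    "\<And>x. x \<in> carrier (free_module R A) \<Longrightarrow> E x \<in> relations R M A" "\<And>f. f \<in> T \<Longrightarrow> E f = f" by blast
  have fixed: "extend E (w (unit_vector S a)) = w (unit_vector S a)" if "a \<in> A" for a
    unfolding c(2)[OF that]
    by (rule extend_rel_map[OF E(1) c(1)[OF that]]) (use that in \<open>auto simp: T_def intro!: arg_cong[where f = "\<lambda>x. \<phi> \<circ> x"] E(3)\<close>)
  \<comment> \<open>The image of a relation is killed by \<open>proj\<close>, hence fixed by
    \<open>w\<close>, hence a combination of the columns of \<open>w\<close>; these are fixed by
    \<open>extend E\<close>.\<close>
  have "\<phi> \<circ> E x = \<phi> \<circ> x" if x: "x \<in> relations R M A" for x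
  proof -
    let ?s = "\<phi> \<circ> x"
    have s: "?s \<in> carrier ?FS" by (rule comp_relation[OF x])
    have "\<sigma> (proj ?s) = \<zero>\<^bsub>?FS\<^esub>"
      unfolding proj_relation[OF x] by (rule module_hom_zero[OF P.module_axioms FS.module_axioms \<sigma>(1)])
    hence "w ?s = ?s"
      using s FS.M.minus_equality[OF FS.M.l_zero[OF FS.M.zero_closed]] by (simp add: w_def FS.M.minus_eq)
    moreover have "w ?s = linear_extension S ?FS (w \<circ> unit_vector S) ?s"
      by (rule module_hom_free_module_eq[OF FS.module_axioms w s])
    moreover have "extend E (linear_extension S ?FS (w \<circ> unit_vector S) ?s)
        = linear_extension S ?FS (extend E \<circ> (w \<circ> unit_vector S)) ?s"
      by (rule module_hom_linear_extension[OF FS.module_axioms FS.module_axioms extend_hom[OF E(1)] _ s])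
        (auto intro!: module_homD(1)[OF w] uv)
    moreover have "\<dots> = linear_extension S ?FS (w \<circ> unit_vector S) ?s"
      by (rule linear_extension_cong[OF FS.module_axioms s]) (auto intro!: module_homD(1)[OF w] uv simp: fixed)
    ultimately have "extend E ?s = ?s" by simp
    thus ?thesis by (simp add: extend_comp[OF E(1) relations_closed[OF x]])
  qed
  thus "\<exists>E \<in> module_hom R (free_module R A) (free_module R A). ?r E" using E(1,2) by blast
next
  let ?FS = "free_module S A"
  assume "\<exists>E \<in> module_hom R (free_module R A) (free_module R A). ?r E"
  then obtain E where E: "E \<in> module_hom R (free_module R A) (free_module R A)"
    "\<And>x. x \<in> carrier (free_module R A) \<Longrightarrow> E x \<in> relations R M A"
    "\<And>x. x \<in> relations R M A \<Longrightarrow> \<phi> \<circ> E x = \<phi> \<circ> x" by blast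
  note uv = unit_vector_closed[OF is_cring, where I = A]
  have id: "(\<lambda>x. x) \<in> module_hom S ?FS ?FS" by (rule module_homI) auto
  note X = extend_hom[OF E(1)]
  \<comment> \<open>The columns of \<open>extend E\<close> are images of relations, so
    \<open>1 - extend E\<close> does not change values under \<open>proj\<close>.\<close>
  have kernel: "proj (extend E s) = \<zero>\<^bsub>P\<^esub>" if s: "s \<in> carrier ?FS" for s
  proof -
    have "proj (extend E s) = linear_extension S P (proj \<circ> (\<lambda>a. \<phi> \<circ> E (unit_vector R a))) s"
      by (rule module_hom_linear_extension[OF FS.module_axioms P.module_axioms proj_hom _ s])
        (auto intro!: comp_relation E(2) uv)
    also have "\<dots> = linear_extension S P (\<lambda>_. \<zero>\<^bsub>P\<^esub>) s"
      by (rule linear_extension_cong[OF P.module_axioms s]) (auto intro!: proj_relation E(2) uv)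
    also have "\<dots> = \<zero>\<^bsub>P\<^esub>" by (rule linear_extension_zero[OF P.module_axioms s])
    finally show ?thesis .
  qed
  show ?l
  proof (rule projective_moduleI_split[OF P.module_axioms proj_hom proj_surj module_hom_minus[OF FS.module_axioms id X]])
    fix s assume s: "s \<in> carrier ?FS" "proj s = \<zero>\<^bsub>P\<^esub>"
    from proj_kernel[OF this] obtain c where c: "c \<in> carrier (free_module S (relations R M A))" "s = rel_map c"
      by blast
    have "extend E s = s" unfolding c(2) by (rule extend_rel_map[OF E(1) c(1) E(3)])
    thus "s \<ominus>\<^bsub>?FS\<^esub> extend E s = \<zero>\<^bsub>?FS\<^esub>" using s by (simp add: FS.M.minus_eq FS.M.r_neg)
  next
    fix s assume s: "s \<in> carrier ?FS"
    have "proj (s \<ominus>\<^bsub>?FS\<^esub> extend E s) = proj s \<ominus>\<^bsub>P\<^esub> \<zero>\<^bsub>P\<^esub>"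
      using module_hom_diff[OF FS.module_axioms P.module_axioms proj_hom s module_homD(1)[OF X s]] kernel[OF s]
      by simp
    also have "\<dots> = proj s"
      using module_homD(1)[OF proj_hom s] P.M.minus_equality[OF P.M.l_zero[OF P.M.zero_closed]]
      by (simp add: P.M.minus_eq)
    finally show "proj (s \<ominus>\<^bsub>?FS\<^esub> extend E s) = proj s" .
  qed
qed

end

section \<open>Comparison of base changes with equal kernels\<close>

lemma finitely_generated_moduleD:
  assumes "finitely_generated_module R M"
  shows "\<exists>A. generated_module R M A"
proof -
  from assms obtain A where M: "module R M" and A: "finite A" "A \<subseteq> carrier M"
    and gen: "\<And>x. x \<in> carrier M \<Longrightarrow> \<exists>c \<in> A \<rightarrow> carrier R. x = (\<Oplus>\<^bsub>M\<^esub>a\<in>A. c a \<odot>\<^bsub>M\<^esub> a)"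
    unfolding finitely_generated_module_def by blast
  interpret M: module R M by fact
  have "\<exists>c \<in> carrier (free_module R A). linear_extension R M (\<lambda>a. a) c = x" if x: "x \<in> carrier M" for x
  proof -
    obtain c where c: "c \<in> A \<rightarrow> carrier R" "x = (\<Oplus>\<^bsub>M\<^esub>a\<in>A. c a \<odot>\<^bsub>M\<^esub> a)" using gen[OF x] by blast
    \<comment> \<open>Coefficients are made zero off \<open>A\<close>, as the carrier of
      \<open>free_module R A\<close> demands.\<close>
    define d where "d = (\<lambda>a. if a \<in> A then c a else \<zero>\<^bsub>R\<^esub>)"
    have d: "d \<in> carrier (free_module R A)"
      using A(1) c(1) by (auto simp: d_def free_module_def)
    have "linear_extension R M (\<lambda>a. a) d = (\<Oplus>\<^bsub>M\<^esub>a\<in>A. d a \<odot>\<^bsub>M\<^esub> a)"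
      by (rule linear_extension_eq[OF M _ d A(1)]) (use A(2) in \<open>auto simp: d_def\<close>)
    also have "\<dots> = x"
      unfolding c(2) by (rule M.M.finsum_cong'[OF refl]) (use A(2) c(1) in \<open>auto simp: d_def\<close>)
    finally show ?thesis using d by blast
  qed
  hence "generated_module R M A"
    by (intro generated_module.intro generated_module_axioms.intro M A) auto
  thus ?thesis ..
qed

lemma ring_hom_eq_iff_diff_kernel:
  assumes "cring R" "cring S" "\<phi> \<in> ring_hom R S" "a \<in> carrier R" "b \<in> carrier R"
  shows "\<phi> a = \<phi> b \<longleftrightarrow> a \<ominus>\<^bsub>R\<^esub> b \<in> a_kernel R S \<phi>"
proof -
  interpret R: cring R by fact
  interpret S: cring S by fact
  interpret \<phi>: ring_hom_ring R S \<phi>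
    by (rule ring_hom_ringI2[OF R.ring_axioms S.ring_axioms assms(3)])
  have c: "\<phi> a \<in> carrier S" "\<phi> b \<in> carrier S" using assms(4,5) by simp_all
  have "\<phi> (a \<ominus>\<^bsub>R\<^esub> b) = \<phi> a \<oplus>\<^bsub>S\<^esub> \<ominus>\<^bsub>S\<^esub> \<phi> b"
    using assms(4,5) by (simp add: R.minus_eq)
  moreover have "\<phi> a \<oplus>\<^bsub>S\<^esub> \<ominus>\<^bsub>S\<^esub> \<phi> b = \<zero>\<^bsub>S\<^esub> \<longleftrightarrow> \<phi> a = \<phi> b"
  proof
    assume "\<phi> a \<oplus>\<^bsub>S\<^esub> \<ominus>\<^bsub>S\<^esub> \<phi> b = \<zero>\<^bsub>S\<^esub>"
    from S.minus_equality[OF this] c show "\<phi> a = \<phi> b" by simp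
  next
    assume "\<phi> a = \<phi> b"
    thus "\<phi> a \<oplus>\<^bsub>S\<^esub> \<ominus>\<^bsub>S\<^esub> \<phi> b = \<zero>\<^bsub>S\<^esub>" using S.r_neg[OF c(2)] by simp
  qed
  moreover have "a \<ominus>\<^bsub>R\<^esub> b \<in> carrier R" using assms(4,5) by simp
  ultimately show ?thesis by (simp only: a_kernel_def' mem_Collect_eq simp_thms)
qed

lemma projective_base_change_cong:
  fixes S :: "('s, 'z) ring_scheme" and S' :: "('t, 'w) ring_scheme"
  assumes fg: "finitely_generated_module R M" and flat: "flat_module R M"
    and S: "cring S" "\<phi> \<in> ring_hom R S" and S': "cring S'" "\<phi>' \<in> ring_hom R S'"
    and kernel: "a_kernel R S \<phi> = a_kernel R S' \<phi>'"
  shows "projective_module S (base_change R M \<phi> S) \<longleftrightarrow> projective_module S' (base_change R M \<phi>' S')"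
proof -
  obtain A where "generated_module R M A" using finitely_generated_moduleD[OF fg] ..
  then interpret generated_module R M A by simp
  have "scalar_extension R M A S \<phi>"
    by (rule scalar_extension.intro[OF generated_module_axioms S(1) scalar_extension_axioms.intro[OF S(2)]])
  then interpret E: scalar_extension R M A S \<phi> .
  have "scalar_extension R M A S' \<phi>'"
    by (rule scalar_extension.intro[OF generated_module_axioms S'(1) scalar_extension_axioms.intro[OF S'(2)]])
  then interpret E': scalar_extension R M A S' \<phi>' .
  \<comment> \<open>Ring maps with the same kernel identify the same pairs, even when their targets
    are unrelated rings.\<close>
  have eq: "\<phi> a = \<phi> b \<longleftrightarrow> \<phi>' a = \<phi>' b" if "a \<in> carrier R" "b \<in> carrier R" for a b
    using ring_hom_eq_iff_diff_kernel[OF is_cring S that] ring_hom_eq_iff_diff_kernel[OF is_cring S' that] kernel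
    by simp
  have "\<phi> \<circ> c = \<phi> \<circ> d \<longleftrightarrow> \<phi>' \<circ> c = \<phi>' \<circ> d"
    if "c \<in> carrier (free_module R A)" "d \<in> carrier (free_module R A)" for c d
    using eq free_module_carrierD(1)[OF is_cring that(1)] free_module_carrierD(1)[OF is_cring that(2)]
    by (simp add: fun_eq_iff)
  hence "(\<forall>x \<in> relations R M A. \<phi> \<circ> E x = \<phi> \<circ> x) \<longleftrightarrow> (\<forall>x \<in> relations R M A. \<phi>' \<circ> E x = \<phi>' \<circ> x)"
    if "\<forall>x \<in> carrier (free_module R A). E x \<in> relations R M A" for E
    using that relations_closed by meson
  thus ?thesis
    unfolding E.projective_base_change_iff[OF flat] E'.projective_base_change_iff[OF flat] by blast
qed

section \<open>Products of residue fields\<close>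

text \<open>Elements of \<open>p\<close> go into the ideal that is factored out, whereas an element
  outside \<open>p\<close> becomes a unit of the localization, with inverse \<open>1/r\<close>, and
  a unit cannot vanish in a field.\<close>

lemma residue_map_eq_zero_iff:
  assumes "primeideal p R" "r \<in> carrier R"
  shows "residue_map R p r = \<zero>\<^bsub>residue_field R p\<^esub> \<longleftrightarrow> r \<in> p"
proof -
  interpret mult_subset R "carrier R - p" by (rule mult_subset_prime[OF assms(1)])
  interpret p: primeideal p R by fact
  interpret L: cring "localization_at R p"
    unfolding localization_at_def by (rule localization_cring)
  interpret I: ideal "extended_ideal R p" "localization_at R p"
    by (rule extended_ideal_ideal[OF assms(1)])
  interpret k: field "residue_field R p" by (rule residue_field_field[OF assms(1)])
  let ?q = "\<lambda>x. extended_ideal R p +>\<^bsub>localization_at R p\<^esub> x"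
  let ?f = "fraction R (carrier R - p)"
  have q: "?q \<in> ring_hom (localization_at R p) (residue_field R p)"
    unfolding residue_field_def by (rule I.rcos_ring_hom)
  have f: "?f x s \<in> carrier (localization_at R p)" if "x \<in> carrier R" "s \<in> carrier R - p" for x s
    unfolding localization_at_def by (rule frac_closed[OF that])
  show ?thesis
  proof
    assume r: "r \<in> p"
    have "(\<lambda>r. ?f r \<one>\<^bsub>R\<^esub>) ` p \<subseteq> carrier (localization_at R p)"
      using f D_one p.a_subset by blast
    from L.genideal_self[OF this] have "?f r \<one>\<^bsub>R\<^esub> \<in> extended_ideal R p"
      using r unfolding extended_ideal_def by blast
    thus "residue_map R p r = \<zero>\<^bsub>residue_field R p\<^esub>"
      by (simp add: residue_map_def residue_field_def FactRing_def I.a_rcos_const)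
  next
    assume z: "residue_map R p r = \<zero>\<^bsub>residue_field R p\<^esub>"
    show "r \<in> p"
    proof (rule ccontr)
      assume "r \<notin> p"
      hence r: "r \<in> carrier R - p" using assms(2) by simp
      have "?f r \<one>\<^bsub>R\<^esub> \<otimes>\<^bsub>localization_at R p\<^esub> ?f \<one>\<^bsub>R\<^esub> r = ?f (r \<otimes>\<^bsub>R\<^esub> \<one>\<^bsub>R\<^esub>) (\<one>\<^bsub>R\<^esub> \<otimes>\<^bsub>R\<^esub> r)"
        unfolding localization_at_def by (rule localization_mult) (use r D_one in auto)
      also have "\<dots> = \<one>\<^bsub>localization_at R p\<^esub>"
        unfolding localization_at_def localization_zero_one
        by (rule fracI) (use r D_one in auto)
      finally have "\<one>\<^bsub>residue_field R p\<^esub> = ?q (?f r \<one>\<^bsub>R\<^esub>) \<otimes>\<^bsub>residue_field R p\<^esub> ?q (?f \<one>\<^bsub>R\<^esub> r)"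
        using ring_hom_mult[OF q, of "?f r \<one>\<^bsub>R\<^esub>" "?f \<one>\<^bsub>R\<^esub> r"] ring_hom_one[OF q] f r D_one by simp
      also have "\<dots> = \<zero>\<^bsub>residue_field R p\<^esub>"
        using z ring_hom_closed[OF q f[of "\<one>\<^bsub>R\<^esub>" r]] r by (simp add: residue_map_def)
      finally show False by simp
    qed
  qed
qed

text \<open>An element dies in the product exactly when it dies in every residue field. The factor
  \<open>carrier R\<close> matters for empty \<open>X\<close>, where the intersection is the whole
  type and the product is the zero ring.\<close>

lemma kernel_residue_product_map:
  assumes "X \<subseteq> Spec R"
  shows "a_kernel R (residue_product R X) (residue_product_map R X) = carrier R \<inter> \<Inter> X"
proof -
  have "residue_product_map R X r = \<zero>\<^bsub>residue_product R X\<^esub> \<longleftrightarrow> (\<forall>p\<in>X. r \<in> p)"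
    if r: "r \<in> carrier R" for r
  proof -
    have "residue_product_map R X r = \<zero>\<^bsub>residue_product R X\<^esub>
        \<longleftrightarrow> (\<forall>p\<in>X. residue_map R p r = \<zero>\<^bsub>residue_field R p\<^esub>)"
      by (simp add: residue_product_map_def residue_product_def product_ring_def fun_eq_iff restrict_def Ball_def)
    also have "\<dots> \<longleftrightarrow> (\<forall>p\<in>X. r \<in> p)"
      using assms r by (intro ball_cong refl residue_map_eq_zero_iff) (auto simp: Spec_def)
    finally show ?thesis .
  qed
  thus ?thesis by (auto simp: a_kernel_def')
qed

text \<open>Each prime of the cone contains a member of \<open>X\<close>, and \<open>X\<close>
  itself lies in the cone; enlarging \<open>X\<close> in this way leaves the intersection
  unchanged.\<close>

lemma Inter_specialization_cone:
  assumes "X \<subseteq> Spec R"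
  shows "\<Inter> (specialization_cone R X) = \<Inter> X"
  using assms by (auto simp: specialization_cone_def)

theorem theorem3p14:
  fixes R :: "('a, 'x) ring_scheme" and M :: "('a, 'm, 'y) module_scheme" and X :: "'a set set"
  assumes "cring R"
    and "module R M"
    and "finitely_generated_module R M"
    and "flat_module R M"
    and "X \<subseteq> Spec R"
  shows
    "projective_module (residue_product R X)
       (base_change R M (residue_product_map R X) (residue_product R X)) \<longleftrightarrow>
     projective_module (residue_product R (specialization_cone R X))
       (base_change R M (residue_product_map R (specialization_cone R X))
          (residue_product R (specialization_cone R X)))"
proof -
  have cone: "specialization_cone R X \<subseteq> Spec R" by (auto simp: specialization_cone_def)
  show ?thesis
    by (intro projective_base_change_cong assms residue_product_cring residue_product_map_hom cone)
      (simp add: kernel_residue_product_map assms cone Inter_specialization_cone)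
qed

end
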